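(* Let $d>4$, $\gamma>2$ and $\tau>0$. There exist constants $c_1,c_2,c_3>0$, depending only on $\gamma,\tau,d$, such that the following holds. Let $\mathbb{P}^\star$ be a zero mean probability distribution on $\mathbb{R}^d$ with covariance matrix $\bm{\Sigma}^\star\succ 0$ and $\mathbb{E}_{\mathbb{P}^\star}[e^{\|\bm{\xi}\|^\gamma}]\le\tau$, let $\bm{\xi}^1,\dots,\bm{\xi}^N$ ($N\ge1$) be i.i.d. samples from $\mathbb{P}^\star$, let $\hat{\mathbb{P}}$ be the associated centered empirical distribution with covariance $\hat{\bm{\Sigma}}$, and set $\alpha^\star=\lambda_{\min}(\bm{\Sigma}^\star)^{-1/2}$ and $\hat\beta=\lambda_{\max}(\hat{\bm{\Sigma}})^{1/2}$. For $r>0$ and $\zeta\in(0,1]$ define $$N_w^\star(r,\zeta)=\begin{cases}\frac{\log(2c_1/\zeta)}{c_2r^d}&\text{if } r\le1,\\ \frac{\log(2c_1/\zeta)}{c_2r^\gamma}&\text{otherwise,}\end{cases}\qquad N_\mu^\star(r,\zeta)=\frac{4K_{\gamma,\tau}^2\left(\log(4/\zeta)+d\log5\right)}{c_3r^2},$$ where $K_{\gamma,\tau}=\sqrt{\frac{2}{\gamma}\max\{1,\frac{\log M_{\gamma,\tau}}{\log 2}\}}$ and $M_{\gamma,\tau}=\tau e^{(\gamma-2)/2}$, and let $N^\star(r,\zeta)=\max\{N_w^\star(\tfrac r2,\zeta),N_\mu^\star(\tfrac r2,\zeta)\}$. For any $\epsilon>0$, fix the Wasserstein radius $$\rho=\sqrt{\hat\beta^2+\frac{\epsilon}{2{\alpha^\star}^2}}-\hat\beta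 .$$ Then, for any $\zeta\in(0,1]$, with probability at least $1-\zeta$ over the draw of the samples, the following implication holds: if $N$ exceeds $N^\star(\rho,\zeta)$, then $$J(\mathbf{K}_{\mathrm{dr}}^\star,\mathbb{P}^\star)\le J(\mathbf{K}^\star,\mathbb{P}^\star)(1+\epsilon).$$ Here $\mathbf{K}^\star$ is the $\mathbb{P}^\star$-optimal (oracle) controller and $\mathbf{K}^\star_{\mathrm{dr}}$ is the Wasserstein distributionally robust optimal controller of radius $\rho$, both defined in the context.
   Context: System. Fix a horizon $T\in\mathbb{N}$ and matrices $A_t,B_t,C_t$ of sizes $n\times n$, $n\times m$, $p\times n$. The dynamics are $x_{t+1}=A_tx_t+B_tu_t+w_t$, $y_t=C_tx_t+v_t$. Write $\mathbf{x}=(x_0,\dots,x_{T-1})$, $\mathbf{u}=(u_0,\dots,u_{T-1})$, $\mathbf{y}=(y_0,\dots,y_{T-1})$, $\mathbf{w}=(x_0,w_0,\dots,w_{T-2})$, $\mathbf{v}=(v_0,\dots,v_{T-1})$, and $\bm{\xi}=(\mathbf{w},\mathbf{v})\in\mathbb{R}^d$, $d=(n+p)T$, for the vector of all random exogenous quantities. Controllers. $\mathcal{K}$ is the set of lower block-triangular (causal) matrices $\mathbf{K}$ of size $mT\times pT$ (with $m\times p$ blocks); controller $\mathbf{K}\in\mathcal{K}$ applies $\mathbf{u}=\mathbf{K}\mathbf{y}$, so that $\mathbf{x}$ and $\mathbf{u}$ are linear functions of $\bm{\xi}$. Cost. Fix symmetric matrices $\mathbf{Q}\succeq0$ and $\mathbf{R}\succ0$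 of sizes $nT$ and $mT$. Let $\mathcal{P}$ be the set of zero mean probability distributions on $\mathbb{R}^d$. For $\mathbb{P}\in\mathcal{P}$, $J(\mathbf{K},\mathbb{P})=\mathbb{E}_{\mathbb{P}}[\mathbf{x}^\top\mathbf{Q}\mathbf{x}+\mathbf{u}^\top\mathbf{R}\mathbf{u}]$ where $\bm{\xi}\sim\mathbb{P}$ and $\mathbf{u}=\mathbf{K}\mathbf{y}$. Oracle controller: $\mathbf{K}^\star\in\arg\min_{\mathbf{K}\in\mathcal{K}}J(\mathbf{K},\mathbb{P}^\star)$. Centered empirical law: $\hat{\mathbb{P}}=\frac1N\sum_{k=1}^N\delta(\bm{\xi}^k-\bar{\bm{\xi}})$, where $\delta(\cdot)$ denotes a Dirac mass at the given point and $\bar{\bm{\xi}}=\frac1N\sum_{k=1}^N\bm{\xi}^k$; $\hat{\bm{\Sigma}}$ is its covariance matrix. Ambiguity set: $\mathbb{W}$ is the 2-Wasserstein distance on $\mathbb{R}^d$ with Euclidean ground norm, and $\mathbb{B}^\rho_{\mathbb{W}}(\hat{\mathbb{P}})=\{\mathbb{P}\in\mathcal{P}:\mathbb{W}(\hat{\mathbb{P}},\mathbb{P})\le\rho\}$. Distributionally robust controller: $\mathbf{K}^\star_{\mathrm{dr}}\in\arg\min_{\mathbf{K}\in\mathcal{K}}\sup_{\mathbb{P}\in\mathbb{B}^\rho_{\mathbb{W}}(\hat{\mathbb{P}})}J(\mathbf{K},\mathbb{P})$. $\|\cdot\|$ on vectors is the Euclidean norm; $\lambda_{\min},\lambda_{\max}$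 denote extreme eigenvalues. Note that $\hat\beta$, hence $\rho$ and $N^\star(\rho,\zeta)$, depend on the samples. *)

theory Defs
  imports "HOL-Probability.Probability" "Jordan_Normal_Form.Char_Poly"
begin

text \<open>
  The dimension is a natural number, so a point of \<open>d\<close>-dimensional space is an extensional function
  on \<open>{..<d}\<close>, and the product of the Borel spaces is the Borel space of the Euclidean topology.
\<close>

abbreviation Rd :: "nat \<Rightarrow> (nat \<Rightarrow> real) measure" where
  "Rd d \<equiv> \<Pi>\<^sub>M i\<in>{..<d}. borel"

definition euclid_norm :: "nat \<Rightarrow> (nat \<Rightarrow> real) \<Rightarrow> real" where
  "euclid_norm d x = L2_set x {..<d}"

definition zero_mean_laws :: "nat \<Rightarrow> (nat \<Rightarrow> real) measure set" where
  "zero_mean_laws d = {P. prob_space P \<and> sets P = sets (Rd d) \<and>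
     (\<forall>i<d. integrable P (\<lambda>\<xi>. \<xi> i) \<and> (LINT \<xi>|P. \<xi> i) = 0)}"

definition covariance :: "nat \<Rightarrow> (nat \<Rightarrow> real) measure \<Rightarrow> real mat" where
  "covariance d P = mat d d (\<lambda>(i, j).
     LINT \<xi>|P. (\<xi> i - (LINT \<eta>|P. \<eta> i)) * (\<xi> j - (LINT \<eta>|P. \<eta> j)))"

definition pos_semidef :: "nat \<Rightarrow> real mat \<Rightarrow> bool" where
  "pos_semidef k M \<longleftrightarrow> M \<in> carrier_mat k k \<and> transpose_mat M = M \<and>
     (\<forall>x \<in> carrier_vec k. 0 \<le> scalar_prod x (M *\<^sub>v x))"

definition pos_def :: "nat \<Rightarrow> real mat \<Rightarrow> bool" where
  "pos_def k M \<longleftrightarrow> M \<in> carrier_mat k k \<and> transpose_mat M = M \<and>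
     (\<forall>x \<in> carrier_vec k. x \<noteq> 0\<^sub>v k \<longrightarrow> 0 < scalar_prod x (M *\<^sub>v x))"

text \<open>The next two are only used for symmetric real matrices of positive size, which have a real eigenvalue.\<close>

definition lambda_min :: "real mat \<Rightarrow> real" where
  "lambda_min M = Min {k. eigenvalue M k}"

definition lambda_max :: "real mat \<Rightarrow> real" where
  "lambda_max M = Max {k. eigenvalue M k}"

definition centered_sample :: "nat \<Rightarrow> nat \<Rightarrow> (nat \<Rightarrow> nat \<Rightarrow> real) \<Rightarrow> nat \<Rightarrow> (nat \<Rightarrow> real)" where
  "centered_sample d N \<omega> k = (\<lambda>i\<in>{..<d}. \<omega> k i - (\<Sum>l<N. \<omega> l i) / real N)"

definition centered_empirical :: "nat \<Rightarrow> nat \<Rightarrow> (nat \<Rightarrow> nat \<Rightarrow> real) \<Rightarrow> (nat \<Rightarrow> real) measure" where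
  "centered_empirical d N \<omega> =
     distr (uniform_count_measure {..<N}) (Rd d) (centered_sample d N \<omega>)"

lemma centered_empirical_eq_average_of_Dirac:
  assumes "1 \<le> N" "S \<in> sets (Rd d)"
  shows "emeasure (centered_empirical d N \<omega>) S =
    (\<Sum>k<N. emeasure (return (Rd d) (centered_sample d N \<omega> k)) S) / of_nat N"
proof -
  let ?f = "centered_sample d N \<omega>"
  have m: "?f \<in> measurable (uniform_count_measure {..<N}) (Rd d)"
    by (auto simp: measurable_def uniform_count_measure_def space_PiM centered_sample_def
        sets_point_measure space_point_measure PiE_iff)
  have "emeasure (centered_empirical d N \<omega>) S
      = emeasure (uniform_count_measure {..<N}) (?f -` S \<inter> {..<N})"
    unfolding centered_empirical_def using emeasure_distr[OF m assms(2)]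
    by (simp add: space_uniform_count_measure)
  also have "\<dots> = ennreal (real (card (?f -` S \<inter> {..<N})) / real N)"
    by (subst emeasure_uniform_count_measure) auto
  also have "real (card (?f -` S \<inter> {..<N})) = (\<Sum>k<N. indicator S (?f k))"
    by (simp add: sum.If_cases indicator_def Int_def vimage_def conj_commute)
  also have "ennreal ((\<Sum>k<N. indicator S (?f k)) / real N)
      = (\<Sum>k<N. indicator S (?f k)) / of_nat N"
    using assms(1)
    by (simp add: divide_ennreal[symmetric] sum_nonneg ennreal_of_nat_eq_real_of_nat
        sum_ennreal[symmetric] ennreal_indicator)
  finally show ?thesis using assms(2) by simp
qed

definition couplings ::
    "nat \<Rightarrow> (nat \<Rightarrow> real) measure \<Rightarrow> (nat \<Rightarrow> real) measure \<Rightarrow> ((nat \<Rightarrow> real) \<times> (nat \<Rightarrow> real)) measure set" where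
  "couplings d P P' = {\<pi>. prob_space \<pi> \<and> sets \<pi> = sets (Rd d \<Otimes>\<^sub>M Rd d) \<and>
     distr \<pi> (Rd d) fst = P \<and> distr \<pi> (Rd d) snd = P'}"

definition ennreal_sqrt :: "ennreal \<Rightarrow> ennreal" where
  "ennreal_sqrt c = (if c = \<top> then \<top> else ennreal (sqrt (enn2real c)))"

text \<open>
  The distance is extended-real valued: if exactly one of the laws has infinite second moment, it is
  infinite, so that such a law lies in no ball around a finitely supported one.
\<close>

definition wasserstein2 ::
    "nat \<Rightarrow> (nat \<Rightarrow> real) measure \<Rightarrow> (nat \<Rightarrow> real) measure \<Rightarrow> ennreal" where
  "wasserstein2 d P P' = ennreal_sqrt (INF \<pi> \<in> couplings d P P'.
     \<integral>\<^sup>+ (\<xi>, \<eta>). ennreal ((euclid_norm d (\<lambda>i. \<xi> i - \<eta> i))\<^sup>2) \<partial>\<pi>)"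

definition wasserstein_ball ::
    "nat \<Rightarrow> real \<Rightarrow> (nat \<Rightarrow> real) measure \<Rightarrow> (nat \<Rightarrow> real) measure set" where
  "wasserstein_ball d \<rho> P = {P' \<in> zero_mean_laws d. wasserstein2 d P P' \<le> ennreal \<rho>}"

record lq_problem =
  horizon :: nat
  state_dim :: nat
  input_dim :: nat
  output_dim :: nat
  A_mat :: "nat \<Rightarrow> real mat"
  B_mat :: "nat \<Rightarrow> real mat"
  C_mat :: "nat \<Rightarrow> real mat"
  Q_mat :: "real mat"
  R_mat :: "real mat"

definition well_formed :: "lq_problem \<Rightarrow> bool" where
  "well_formed S \<longleftrightarrow>
     (\<forall>t < horizon S.
        A_mat S t \<in> carrier_mat (state_dim S) (state_dim S) \<and>
        B_mat S t \<in> carrier_mat (state_dim S) (input_dim S) \<and>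
        C_mat S t \<in> carrier_mat (output_dim S) (state_dim S)) \<and>
     pos_semidef (state_dim S * horizon S) (Q_mat S) \<and>
     pos_def (input_dim S * horizon S) (R_mat S)"

definition noise_dim :: "lq_problem \<Rightarrow> nat" where
  "noise_dim S = (state_dim S + output_dim S) * horizon S"

text \<open>
  The exogenous vector is \<open>\<xi> = (x\<^sub>0, w\<^sub>0, \<dots>, w\<^sub>T\<^sub>-\<^sub>2, v\<^sub>0, \<dots>, v\<^sub>T\<^sub>-\<^sub>1)\<close>; hence \<open>w\<^sub>t\<close> is its
  state-sized block number \<open>t + 1\<close>.
\<close>

definition initial_state :: "lq_problem \<Rightarrow> (nat \<Rightarrow> real) \<Rightarrow> real vec" where
  "initial_state S \<xi> = vec (state_dim S) \<xi>"

definition process_noise :: "lq_problem \<Rightarrow> (nat \<Rightarrow> real) \<Rightarrow> nat \<Rightarrow> real vec" where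
  "process_noise S \<xi> t = vec (state_dim S) (\<lambda>i. \<xi> (Suc t * state_dim S + i))"

definition output_noise :: "lq_problem \<Rightarrow> (nat \<Rightarrow> real) \<Rightarrow> nat \<Rightarrow> real vec" where
  "output_noise S \<xi> t =
     vec (output_dim S) (\<lambda>i. \<xi> (state_dim S * horizon S + t * output_dim S + i))"

definition causal_controllers :: "lq_problem \<Rightarrow> real mat set" where
  "causal_controllers S =
     {K \<in> carrier_mat (input_dim S * horizon S) (output_dim S * horizon S).
        \<forall>i < input_dim S * horizon S. \<forall>j < output_dim S * horizon S.
          i div input_dim S < j div output_dim S \<longrightarrow> K $$ (i, j) = 0}"

definition controller_block :: "lq_problem \<Rightarrow> real mat \<Rightarrow> nat \<Rightarrow> nat \<Rightarrow> real mat" where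
  "controller_block S K t s = mat (input_dim S) (output_dim S)
     (\<lambda>(i, j). K $$ (t * input_dim S + i, s * output_dim S + j))"

text \<open>
  Closed-loop trajectory under \<open>u\<^sub>t = (\<Sum>s\<le>t. K\<^sub>t\<^sub>,\<^sub>s y\<^sub>s)\<close>. That this is the feedback law
  \<open>u = K y\<close> for every causal \<open>K\<close> is lemma \<open>stacked_input_eq\<close> below.
\<close>

fun closed_loop_state :: "lq_problem \<Rightarrow> real mat \<Rightarrow> (nat \<Rightarrow> real) \<Rightarrow> nat \<Rightarrow> real vec" where
  "closed_loop_state S K \<xi> 0 = initial_state S \<xi>"
| "closed_loop_state S K \<xi> (Suc t) =
     A_mat S t *\<^sub>v closed_loop_state S K \<xi> t +
     B_mat S t *\<^sub>v vec (input_dim S) (\<lambda>i. \<Sum>s\<le>t.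
       (controller_block S K t s *\<^sub>v
         (C_mat S s *\<^sub>v closed_loop_state S K \<xi> s + output_noise S \<xi> s)) $ i) +
     process_noise S \<xi> t"

definition closed_loop_output :: "lq_problem \<Rightarrow> real mat \<Rightarrow> (nat \<Rightarrow> real) \<Rightarrow> nat \<Rightarrow> real vec" where
  "closed_loop_output S K \<xi> t = C_mat S t *\<^sub>v closed_loop_state S K \<xi> t + output_noise S \<xi> t"

definition closed_loop_input :: "lq_problem \<Rightarrow> real mat \<Rightarrow> (nat \<Rightarrow> real) \<Rightarrow> nat \<Rightarrow> real vec" where
  "closed_loop_input S K \<xi> t = vec (input_dim S) (\<lambda>i. \<Sum>s\<le>t.
     (controller_block S K t s *\<^sub>v closed_loop_output S K \<xi> s) $ i)"

lemma closed_loop_state_Suc: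
  "closed_loop_state S K \<xi> (Suc t) =
     A_mat S t *\<^sub>v closed_loop_state S K \<xi> t + B_mat S t *\<^sub>v closed_loop_input S K \<xi> t +
     process_noise S \<xi> t"
  by (simp add: closed_loop_input_def closed_loop_output_def)

definition stack :: "nat \<Rightarrow> nat \<Rightarrow> (nat \<Rightarrow> real vec) \<Rightarrow> real vec" where
  "stack k T z = vec (k * T) (\<lambda>i. z (i div k) $ (i mod k))"

lemma stacked_input_eq:
  assumes "K \<in> causal_controllers S"
  shows "stack (input_dim S) (horizon S) (closed_loop_input S K \<xi>) =
    K *\<^sub>v stack (output_dim S) (horizon S) (closed_loop_output S K \<xi>)"
proof (rule eq_vecI)
  let ?m = "input_dim S" and ?p = "output_dim S" and ?T = "horizon S"
  let ?y = "closed_loop_output S K \<xi>"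
  have K: "K \<in> carrier_mat (?m * ?T) (?p * ?T)"
    using assms by (simp add: causal_controllers_def)
  then show "dim_vec (stack ?m ?T (closed_loop_input S K \<xi>)) = dim_vec (K *\<^sub>v stack ?p ?T ?y)"
    by (simp add: stack_def)
  fix i assume "i < dim_vec (K *\<^sub>v stack ?p ?T ?y)"
  then have i: "i < ?m * ?T" using K by simp
  then have m: "0 < ?m" by (cases "?m = 0") auto
  define t where "t = i div ?m"
  have t: "t < ?T"
    unfolding t_def using i m by (simp add: less_mult_imp_div_less mult.commute)
  have it: "t * ?m + i mod ?m = i" by (simp add: t_def)
  let ?g = "\<lambda>s. \<Sum>j<?p. K $$ (i, s * ?p + j) * ?y s $ j"
  have dimy: "dim_vec (?y s) = ?p" for s
    by (simp add: closed_loop_output_def output_noise_def)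
  have L: "stack ?m ?T (closed_loop_input S K \<xi>) $ i = (\<Sum>s\<le>t. ?g s)"
    using i m
    by (simp add: stack_def closed_loop_input_def controller_block_def t_def[symmetric] it
        scalar_prod_def dimy lessThan_atLeast0)
  have "(K *\<^sub>v stack ?p ?T ?y) $ i
      = (\<Sum>j<?T * ?p. K $$ (i, j) * ?y (j div ?p) $ (j mod ?p))"
    using i K by (simp add: stack_def scalar_prod_def lessThan_atLeast0 mult.commute)
  also have "\<dots> = (\<Sum>s<?T. \<Sum>j = s * ?p ..< s * ?p + ?p. K $$ (i, j) * ?y (j div ?p) $ (j mod ?p))"
    by (simp add: sum.nat_group)
  also have "\<dots> = (\<Sum>s<?T. ?g s)"
  proof (rule sum.cong[OF refl])
    fix s
    have "(\<Sum>j = s * ?p ..< s * ?p + ?p. K $$ (i, j) * ?y (j div ?p) $ (j mod ?p))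
        = (\<Sum>j<?p. K $$ (i, s * ?p + j) * ?y ((s * ?p + j) div ?p) $ ((s * ?p + j) mod ?p))"
      using sum.shift_bounds_nat_ivl[of "\<lambda>j. K $$ (i, j) * ?y (j div ?p) $ (j mod ?p)" 0 "s * ?p" ?p]
      by (simp add: lessThan_atLeast0 add.commute)
    also have "\<dots> = ?g s" by (rule sum.cong) auto
    finally show "(\<Sum>j = s * ?p ..< s * ?p + ?p. K $$ (i, j) * ?y (j div ?p) $ (j mod ?p)) = ?g s" .
  qed
  also have "\<dots> = (\<Sum>s\<le>t. ?g s)"
  proof (rule sum.mono_neutral_right)
    show "\<forall>s \<in> {..<?T} - {..t}. ?g s = 0"
    proof (intro ballI sum.neutral)
      fix s j assume s: "s \<in> {..<?T} - {..t}" and j: "j \<in> {..<?p}"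
      have "s * ?p + j < Suc s * ?p" using j by simp
      also have "\<dots> \<le> ?T * ?p" using s by (intro mult_right_mono) auto
      finally have b: "s * ?p + j < ?p * ?T" by (simp add: mult.commute)
      have "(s * ?p + j) div ?p = s" using j by auto
      then have "i div ?m < (s * ?p + j) div ?p" using s by (simp add: t_def)
      then have "K $$ (i, s * ?p + j) = 0"
        using assms i b by (simp add: causal_controllers_def)
      then show "K $$ (i, s * ?p + j) * ?y s $ j = 0" by simp
    qed
  qed (use t in auto)
  finally show "stack ?m ?T (closed_loop_input S K \<xi>) $ i = (K *\<^sub>v stack ?p ?T ?y) $ i"
    using L by simp
qed

definition quadratic_cost :: "lq_problem \<Rightarrow> real mat \<Rightarrow> (nat \<Rightarrow> real) \<Rightarrow> real" where
  "quadratic_cost S K \<xi> =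
     (let x = stack (state_dim S) (horizon S) (closed_loop_state S K \<xi>);
          u = stack (input_dim S) (horizon S) (closed_loop_input S K \<xi>)
      in scalar_prod x (Q_mat S *\<^sub>v x) + scalar_prod u (R_mat S *\<^sub>v u))"

text \<open>
  The integrand is nonnegative, so its expectation always exists in the extended reals, also for
  laws without second moments.
\<close>

definition expected_cost :: "lq_problem \<Rightarrow> real mat \<Rightarrow> (nat \<Rightarrow> real) measure \<Rightarrow> ennreal" where
  "expected_cost S K P = (\<integral>\<^sup>+ \<xi>. ennreal (quadratic_cost S K \<xi>) \<partial>P)"

definition oracle_controller :: "lq_problem \<Rightarrow> (nat \<Rightarrow> real) measure \<Rightarrow> real mat \<Rightarrow> bool" where
  "oracle_controller S P K \<longleftrightarrow>
     is_arg_min (\<lambda>K'. expected_cost S K' P) (\<lambda>K'. K' \<in> causal_controllers S) K"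

definition dr_controller ::
    "lq_problem \<Rightarrow> real \<Rightarrow> (nat \<Rightarrow> real) measure \<Rightarrow> real mat \<Rightarrow> bool" where
  "dr_controller S \<rho> P K \<longleftrightarrow>
     is_arg_min (\<lambda>K'. SUP P' \<in> wasserstein_ball (noise_dim S) \<rho> P. expected_cost S K' P')
       (\<lambda>K'. K' \<in> causal_controllers S) K"

definition M_const :: "real \<Rightarrow> real \<Rightarrow> real" where
  "M_const \<gamma> \<tau> = \<tau> * exp ((\<gamma> - 2) / 2)"

definition K_const :: "real \<Rightarrow> real \<Rightarrow> real" where
  "K_const \<gamma> \<tau> = sqrt (2 / \<gamma> * max 1 (ln (M_const \<gamma> \<tau>) / ln 2))"

definition N_w :: "real \<Rightarrow> real \<Rightarrow> real \<Rightarrow> nat \<Rightarrow> real \<Rightarrow> real \<Rightarrow> real" where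
  "N_w c1 c2 \<gamma> d r \<zeta> =
     (if r \<le> 1 then ln (2 * c1 / \<zeta>) / (c2 * r ^ d) else ln (2 * c1 / \<zeta>) / (c2 * r powr \<gamma>))"

definition N_mu :: "real \<Rightarrow> real \<Rightarrow> real \<Rightarrow> nat \<Rightarrow> real \<Rightarrow> real \<Rightarrow> real" where
  "N_mu c3 \<gamma> \<tau> d r \<zeta> =
     4 * (K_const \<gamma> \<tau>)\<^sup>2 * (ln (4 / \<zeta>) + real d * ln 5) / (c3 * r\<^sup>2)"

definition N_star ::
    "real \<Rightarrow> real \<Rightarrow> real \<Rightarrow> real \<Rightarrow> real \<Rightarrow> nat \<Rightarrow> real \<Rightarrow> real \<Rightarrow> real" where
  "N_star c1 c2 c3 \<gamma> \<tau> d r \<zeta> =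
     max (N_w c1 c2 \<gamma> d (r / 2) \<zeta>) (N_mu c3 \<gamma> \<tau> d (r / 2) \<zeta>)"

definition alpha_star :: "nat \<Rightarrow> (nat \<Rightarrow> real) measure \<Rightarrow> real" where
  "alpha_star d P = lambda_min (covariance d P) powr (- 1 / 2)"

definition beta_hat :: "nat \<Rightarrow> nat \<Rightarrow> (nat \<Rightarrow> nat \<Rightarrow> real) \<Rightarrow> real" where
  "beta_hat d N \<omega> = sqrt (lambda_max (covariance d (centered_empirical d N \<omega>)))"

definition radius :: "real \<Rightarrow> real \<Rightarrow> real \<Rightarrow> real" where
  "radius \<alpha> \<beta> \<epsilon> = sqrt (\<beta>\<^sup>2 + \<epsilon> / (2 * \<alpha>\<^sup>2)) - \<beta>"

end

theory Submission
  imports Defs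
begin

text \<open>
  The cost of a fixed controller is a sum of squares of linear forms in the noise, so on a
  Wasserstein ball it varies by at most \<open>2 \<beta> \<rho> + \<rho>\<^sup>2\<close> times the sum \<open>T\<close> of their squared coefficients,
  while the oracle cost is at least \<open>\<lambda>\<^sub>m\<^sub>i\<^sub>n T\<close>; the radius balances the two, and the bound holds as
  soon as the true law lies in the ball. That the law lies in the ball is the Fournier--Guillin estimate.
  Both laws are truncated and cut into nested dyadic cells; one coupling matches the cell masses
  optimally at all levels, so that the transport cost is at most a weighted sum of discrepancies.
  The mean of this sum is controlled by variances (this is where \<open>d > 4\<close> enters), its fluctuations by
  the bounded differences inequality, and the truncated mass by a Chernoff bound. Since the true
  law has mean zero, centring the sample can only decrease the distance. The requirement on
  the sample size is monotone in the radius, so one event serves all data-dependent radii.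
\<close>

section \<open>Bounded differences\<close>

text \<open>All scales are tuned to one number, the deviation level s = ln(4/\<zeta>)/N. For small
  s, points are clipped at a radius R of order ln(1/s)^(1/\<gamma>) and resolved down to cells of
  side about s^(1/d), which gives a distance of order s^(1/d). The fluctuations are of order R^2
  sqrt(s); since 2/d \<le> 2/5 < 1/2, the logarithm hidden in R is absorbed. For s bounded below,
  second moments alone give the order s^(1/\<gamma>). These rates are the two branches of the sample
  size requirement, which says s < c2 (\<rho>/2)^d or s < c2 (\<rho>/2)^\<gamma>. The obstacle in
  the small regime is that the mean discrepancy involves the square roots of the probabilities of
  all cells, whose number grows with R. A polynomial weight on the cells, paid for by the
  exponential moment, makes the bound independent of R. On the control side the cross terms cost
  2\<beta>\<rho> in each direction between the centre and another law, but only one direction adds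
  \<rho>^2, so the identity 2\<beta>\<rho> + \<rho>^2 = \<epsilon>\<lambda>/2 used twice is
  enough.\<close>

abbreviation iid_law :: "nat \<Rightarrow> 'a measure \<Rightarrow> (nat \<Rightarrow> 'a) measure" where
  "iid_law N M \<equiv> \<Pi>\<^sub>M k\<in>{..<N}. M"

text \<open>Hoeffding's lemma needs an interval that contains the values. A bound on the oscillation
  supplies \<open>{a..a + c}\<close> with \<open>a\<close> the infimum. The nonnegative integral is
  used so that the induction below can integrate coordinate by coordinate without integrability of
  the exponentials.\<close>

lemma (in prob_space) exp_bounded_oscillation:
  fixes f :: "'a \<Rightarrow> real"
  assumes [measurable]: "f \<in> borel_measurable M" and c: "0 \<le> c" and l: "0 < l"
    and osc: "\<And>x y. x \<in> space M \<Longrightarrow> y \<in> space M \<Longrightarrow> \<bar>f x - f y\<bar> \<le> c"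
  shows "integrable M f" "(\<integral>\<^sup>+x. ennreal (exp (l * f x)) \<partial>M) \<le> ennreal (exp (l * expectation f + l\<^sup>2 * c\<^sup>2 / 8))"
proof -
  obtain x0 where x0: "x0 \<in> space M" using not_empty by auto
  define a where "a = (INF x\<in>space M. f x)"
  have "\<bar>f x - f x0\<bar> \<le> c" if "x \<in> space M" for x using osc[OF that x0] .
  then have bdd: "bdd_below (f ` space M)" by (intro bdd_belowI[of _ "f x0 - c"]) (force simp: abs_le_iff)
  have ab: "f x \<in> {a..a + c}" if x: "x \<in> space M" for x
  proof -
    have "f x - c \<le> a" unfolding a_def
    proof (rule cINF_greatest)
      fix y assume "y \<in> space M"
      from osc[OF x this] show "f x - c \<le> f y" by (simp add: abs_le_iff)
    qed (use not_empty in simp)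
    moreover have "a \<le> f x" unfolding a_def using bdd x by (rule cINF_lower)
    ultimately show ?thesis by simp
  qed
  interpret B: interval_bounded_random_variable M f a "a + c"
    by unfold_locales (use ab in auto)
  show int: "integrable M f" by (rule B.integrable)
  have "(\<integral>\<^sup>+x. ennreal (exp (l * f x)) \<partial>M)
      = (\<integral>\<^sup>+x. ennreal (exp (l * expectation f)) * ennreal (exp (l * (f x - expectation f))) \<partial>M)"
    by (intro nn_integral_cong) (simp add: ennreal_mult[symmetric] exp_add[symmetric] algebra_simps)
  also have "\<dots> = ennreal (exp (l * expectation f)) * (\<integral>\<^sup>+x. ennreal (exp (l * (f x - expectation f))) \<partial>M)"
    by (rule nn_integral_cmult) measurable
  also have "\<dots> \<le> ennreal (exp (l * expectation f)) * ennreal (exp (l\<^sup>2 * (a + c - a)\<^sup>2 / 8))"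
    using B.Hoeffdings_lemma_nn_integral[OF l] by (intro mult_left_mono) auto
  finally show "(\<integral>\<^sup>+x. ennreal (exp (l * f x)) \<partial>M) \<le> ennreal (exp (l * expectation f + l\<^sup>2 * c\<^sup>2 / 8))"
    by (simp add: ennreal_mult[symmetric] exp_add[symmetric])
qed

text \<open>Integrate out the last coordinate: with the others fixed, \<open>f\<close> oscillates by
  at most \<open>c\<close>, so Hoeffding's lemma replaces it by its average \<open>g\<close> at the
  price of one factor \<open>exp (l\<^sup>2 * c\<^sup>2 / 8)\<close>. The average inherits the bound
  \<open>B\<close> and the bounded differences, so the induction continues with \<open>g\<close>.
  The bound \<open>B\<close> makes \<open>f\<close> integrable, whence \<open>f\<close> and
  \<open>g\<close> have the same mean.\<close>

lemma (in prob_space) bounded_differences_exp: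
  fixes f :: "(nat \<Rightarrow> 'a) \<Rightarrow> real"
  assumes "f \<in> borel_measurable (iid_law N M)" and c: "0 \<le> c" and l: "0 < l"
    and B: "\<And>x. x \<in> space (iid_law N M) \<Longrightarrow> \<bar>f x\<bar> \<le> B"
    and bd: "\<And>x y k. x \<in> space (iid_law N M) \<Longrightarrow> y \<in> space M \<Longrightarrow> k < N \<Longrightarrow> \<bar>f (x(k := y)) - f x\<bar> \<le> c"
  shows "(\<integral>\<^sup>+x. ennreal (exp (l * f x)) \<partial>(iid_law N M))
    \<le> ennreal (exp (l * (\<integral>x. f x \<partial>(iid_law N M)) + N * (l\<^sup>2 * c\<^sup>2 / 8)))"
  using assms(1) B bd
proof (induction N arbitrary: f)
  case 0
  show ?case by (simp add: PiM_empty nn_integral_count_space_finite lebesgue_integral_count_space_finite)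
next
  case (Suc N)
  interpret PM: product_sigma_finite "\<lambda>_. M" by unfold_locales
  interpret P: prob_space "iid_law N M" by (intro prob_space_PiM prob_space_axioms)
  interpret P': prob_space "iid_law (Suc N) M" by (intro prob_space_PiM prob_space_axioms)
  have S: "insert N {..<N} = {..<Suc N}" by auto
  note f[measurable] = Suc.prems(1)
  have upd[measurable]: "(\<lambda>(x, y). x(N := y)) \<in> (iid_law N M) \<Otimes>\<^sub>M M \<rightarrow>\<^sub>M (iid_law (Suc N) M)"
    unfolding S[symmetric] by measurable
  have fm[measurable]: "(\<lambda>(x, y). f (x(N := y))) \<in> borel_measurable ((iid_law N M) \<Otimes>\<^sub>M M)"
    using measurable_comp[OF upd f] by (simp add: comp_def split_def)
  have inS: "x(N := y) \<in> space (iid_law (Suc N) M)"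
    if "x \<in> space (iid_law N M)" "y \<in> space M" for x y
    using that by (auto simp: space_PiM PiE_iff extensional_def less_Suc_eq)
  define g where "g x = (\<integral>y. f (x(N := y)) \<partial>M)" for x
  have fy[measurable]: "(\<lambda>y. f (x(N := y))) \<in> borel_measurable M" if "x \<in> space (iid_law N M)" for x
    using measurable_Pair2[OF fm that] by simp
  have osc: "\<bar>f (x(N := y)) - f (x(N := y'))\<bar> \<le> c"
    if "x \<in> space (iid_law N M)" "y \<in> space M" "y' \<in> space M" for x y y'
    using Suc.prems(3)[OF inS[OF that(1,3)] that(2) lessI] by (simp only: fun_upd_upd)
  have fi: "integrable M (\<lambda>y. f (x(N := y)))"
    and fe: "(\<integral>\<^sup>+y. ennreal (exp (l * f (x(N := y)))) \<partial>M) \<le> ennreal (exp (l * g x + l\<^sup>2 * c\<^sup>2 / 8))"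
    if "x \<in> space (iid_law N M)" for x
    using exp_bounded_oscillation[OF fy[OF that] c l osc[OF that]] by (auto simp: g_def)
  have g[measurable]: "g \<in> borel_measurable (iid_law N M)"
    unfolding g_def by measurable
  have gbd: "\<bar>g (x(k := z)) - g x\<bar> \<le> c"
    if x: "x \<in> space (iid_law N M)" and z: "z \<in> space M" and k: "k < N" for x z k
  proof -
    have x': "x(k := z) \<in> space (iid_law N M)"
      using x z k by (auto simp: space_PiM PiE_iff extensional_def)
    have le: "\<bar>f (x(k := z, N := y)) - f (x(N := y))\<bar> \<le> c" if "y \<in> space M" for y
    proof -
      have "x(k := z, N := y) = x(N := y, k := z)" using k by (intro fun_upd_twist) simp
      then show ?thesis
        using Suc.prems(3)[OF inS[OF x that] z less_SucI[OF k]] by (simp only:)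
    qed
    have "g (x(k := z)) - g x = (\<integral>y. f (x(k := z, N := y)) - f (x(N := y)) \<partial>M)"
      unfolding g_def using fi[OF x] fi[OF x'] by simp
    also have "\<bar>\<dots>\<bar> \<le> (\<integral>y. \<bar>f (x(k := z, N := y)) - f (x(N := y))\<bar> \<partial>M)"
      by (rule integral_abs_bound)
    also have "\<dots> \<le> (\<integral>y. c \<partial>M)"
      using fi[OF x] fi[OF x'] le by (intro integral_mono) auto
    finally show ?thesis by (simp add: prob_space)
  qed
  have gB: "\<bar>g x\<bar> \<le> B" if x: "x \<in> space (iid_law N M)" for x
  proof -
    have "\<bar>g x\<bar> \<le> (\<integral>y. \<bar>f (x(N := y))\<bar> \<partial>M)" unfolding g_def by (rule integral_abs_bound)
    also have "\<dots> \<le> (\<integral>y. B \<partial>M)"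
      using fi[OF x] by (intro integral_mono Suc.prems(2)[OF inS[OF x]]) auto
    finally show ?thesis by (simp add: prob_space)
  qed
  note IH = Suc.IH[OF g gB gbd]
  have "(\<integral>\<^sup>+x. ennreal (exp (l * f x)) \<partial>(iid_law (Suc N) M))
      = (\<integral>\<^sup>+x. (\<integral>\<^sup>+y. ennreal (exp (l * f (x(N := y)))) \<partial>M) \<partial>(iid_law N M))"
    unfolding S[symmetric] by (rule PM.product_nn_integral_insert) (auto simp: S)
  also have "\<dots> \<le> (\<integral>\<^sup>+x. ennreal (exp (l\<^sup>2 * c\<^sup>2 / 8)) * ennreal (exp (l * g x)) \<partial>(iid_law N M))"
    using fe by (intro nn_integral_mono) (simp add: ennreal_mult[symmetric] exp_add[symmetric] add.commute)
  also have "\<dots> = ennreal (exp (l\<^sup>2 * c\<^sup>2 / 8)) * (\<integral>\<^sup>+x. ennreal (exp (l * g x)) \<partial>(iid_law N M))"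
    by (rule nn_integral_cmult) measurable
  also have "\<dots> \<le> ennreal (exp (l\<^sup>2 * c\<^sup>2 / 8)) * ennreal (exp (l * (\<integral>x. g x \<partial>(iid_law N M)) + N * (l\<^sup>2 * c\<^sup>2 / 8)))"
    using IH by (intro mult_left_mono) auto
  also have "\<dots> = ennreal (exp (l * (\<integral>x. g x \<partial>(iid_law N M)) + Suc N * (l\<^sup>2 * c\<^sup>2 / 8)))"
    by (simp add: ennreal_mult[symmetric] exp_add[symmetric] algebra_simps)
  finally have 1: "(\<integral>\<^sup>+x. ennreal (exp (l * f x)) \<partial>(iid_law (Suc N) M)) \<le> \<dots>" .
  have fint: "integrable (iid_law (Suc N) M) f"
    using Suc.prems(2) by (intro P'.integrable_const_bound[of _ B]) auto
  moreover have "(\<integral>x. f x \<partial>(iid_law (Suc N) M)) = (\<integral>x. g x \<partial>(iid_law N M))"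
    unfolding g_def using PM.product_integral_insert[of "{..<N}" N f] fint by (simp add: S)
  ultimately show ?case using 1 by simp
qed

lemma (in prob_space) markov_exp:
  fixes f :: "'a \<Rightarrow> real"
  assumes [measurable]: "f \<in> borel_measurable M" and l: "0 < l"
    and E: "(\<integral>\<^sup>+x. ennreal (exp (l * f x)) \<partial>M) \<le> ennreal (exp B)"
  shows "prob {x \<in> space M. t \<le> f x} \<le> exp (B - l * t)"
proof -
  have "emeasure M {x \<in> space M. t \<le> f x} \<le> ennreal (exp (- l * t)) * (\<integral>\<^sup>+x\<in>space M. ennreal (exp (l * f x)) \<partial>M)"
    using Chernoff_ineq_nn_integral_ge[of l "space M" M f t] l by simp
  also have "\<dots> = ennreal (exp (- l * t)) * (\<integral>\<^sup>+x. ennreal (exp (l * f x)) \<partial>M)"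
    by (intro arg_cong2[where f = "(*)"] nn_integral_cong) auto
  also have "\<dots> \<le> ennreal (exp (- l * t)) * ennreal (exp B)"
    using E by (intro mult_left_mono) auto
  also have "\<dots> = ennreal (exp (B - l * t))"
    by (simp add: ennreal_mult[symmetric] exp_add[symmetric])
  finally show ?thesis by (simp add: emeasure_eq_measure)
qed

text \<open>The exponent is the value at the optimal \<open>l = 4 * t / (N * c\<^sup>2)\<close>.\<close>

lemma (in prob_space) mcdiarmid:
  fixes f :: "(nat \<Rightarrow> 'a) \<Rightarrow> real"
  assumes N: "0 < N" and f: "f \<in> borel_measurable (iid_law N M)" and c: "0 < c" and t: "0 < t"
    and B: "\<And>x. x \<in> space (iid_law N M) \<Longrightarrow> \<bar>f x\<bar> \<le> B"
    and bd: "\<And>x y k. x \<in> space (iid_law N M) \<Longrightarrow> y \<in> space M \<Longrightarrow> k < N \<Longrightarrow> \<bar>f (x(k := y)) - f x\<bar> \<le> c"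
  shows "measure (iid_law N M) {x \<in> space (iid_law N M). (\<integral>x. f x \<partial>(iid_law N M)) + t \<le> f x}
    \<le> exp (- 2 * t\<^sup>2 / (N * c\<^sup>2))"
proof -
  interpret P: prob_space "iid_law N M" by (intro prob_space_PiM prob_space_axioms)
  define l where "l = 4 * t / (N * c\<^sup>2)"
  have l: "0 < l" using N c t by (simp add: l_def)
  let ?m = "\<integral>x. f x \<partial>(iid_law N M)"
  have "P.prob {x \<in> space (iid_law N M). ?m + t \<le> f x} \<le> exp (l * ?m + N * (l\<^sup>2 * c\<^sup>2 / 8) - l * (?m + t))"
    using c by (intro P.markov_exp[OF f l] bounded_differences_exp[OF f _ l B bd]) auto
  also have "l * ?m + N * (l\<^sup>2 * c\<^sup>2 / 8) - l * (?m + t) = - 2 * t\<^sup>2 / (N * c\<^sup>2)"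
    using N c by (simp add: l_def field_simps power2_eq_square)
  finally show ?thesis .
qed

section \<open>Couplings of nested partitions\<close>

text \<open>On every class of \<open>G\<close> the residual masses \<open>ra\<close> and
  \<open>rb\<close> are coupled by a multiple of their product. As \<open>q\<close> stays inside the
  classes, the residual totals \<open>A c\<close> and \<open>B c\<close> are the class totals minus
  the mass already matched there, and adding \<open>min (A c) (B c)\<close> exhausts the poorer
  side.\<close>

lemma partial_coupling_step:
  fixes a b :: "'i \<Rightarrow> real" and q :: "'i \<Rightarrow> 'i \<Rightarrow> real" and G :: "'i \<Rightarrow> 'j"
  assumes I: "finite I"
    and q: "\<And>i j. i \<in> I \<Longrightarrow> j \<in> I \<Longrightarrow> 0 \<le> q i j"
    and row: "\<And>i. i \<in> I \<Longrightarrow> (\<Sum>j\<in>I. q i j) \<le> a i"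
    and col: "\<And>j. j \<in> I \<Longrightarrow> (\<Sum>i\<in>I. q i j) \<le> b j"
    and supp: "\<And>i j. i \<in> I \<Longrightarrow> j \<in> I \<Longrightarrow> G i \<noteq> G j \<Longrightarrow> q i j = 0"
  obtains q' where "\<And>i j. i \<in> I \<Longrightarrow> j \<in> I \<Longrightarrow> q i j \<le> q' i j"
    "\<And>i. i \<in> I \<Longrightarrow> (\<Sum>j\<in>I. q' i j) \<le> a i" "\<And>j. j \<in> I \<Longrightarrow> (\<Sum>i\<in>I. q' i j) \<le> b j"
    "\<And>i j. i \<in> I \<Longrightarrow> j \<in> I \<Longrightarrow> G i \<noteq> G j \<Longrightarrow> q' i j = 0"
    "\<And>c. min (\<Sum>i\<in>{i\<in>I. G i = c}. a i) (\<Sum>i\<in>{i\<in>I. G i = c}. b i)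
        \<le> (\<Sum>i\<in>{i\<in>I. G i = c}. \<Sum>j\<in>{j\<in>I. G j = c}. q' i j)"
proof -
  define ra where "ra i = a i - (\<Sum>j\<in>I. q i j)" for i
  define rb where "rb j = b j - (\<Sum>i\<in>I. q i j)" for j
  define A where "A c = (\<Sum>i\<in>{i\<in>I. G i = c}. ra i)" for c
  define B where "B c = (\<Sum>i\<in>{i\<in>I. G i = c}. rb i)" for c
  define M where "M c = max (A c) (B c)" for c
  \<comment> \<open>Dividing by the larger residual total keeps rows and columns within
    \<open>a\<close> and \<open>b\<close>, and the class receives
    \<open>A c * B c / max (A c) (B c) = min (A c) (B c)\<close>. If both totals vanish, division by
    zero adds nothing, as it should.\<close>
  define q' where "q' i j = q i j + (if G i = G j then ra i * rb j / M (G i) else 0)" for i j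
  have ra: "0 \<le> ra i" if "i \<in> I" for i using row[OF that] by (simp add: ra_def)
  have rb: "0 \<le> rb i" if "i \<in> I" for i using col[OF that] by (simp add: rb_def)
  have AB: "0 \<le> A c" "0 \<le> B c" for c
    by (auto simp: A_def B_def intro!: sum_nonneg ra rb)
  then have M: "0 \<le> M c" "A c / M c \<le> 1" "B c / M c \<le> 1" for c
    by (auto simp: M_def max_def divide_le_eq_1 less_le)
  show thesis
  proof (rule that[of q'])
    show "q i j \<le> q' i j" if "i \<in> I" "j \<in> I" for i j
      using ra[OF that(1)] rb[OF that(2)] M(1) by (simp add: q'_def)
    show "q' i j = 0" if "i \<in> I" "j \<in> I" "G i \<noteq> G j" for i j
      using supp[OF that] that by (simp add: q'_def)
    show "(\<Sum>j\<in>I. q' i j) \<le> a i" if i: "i \<in> I" for i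
    proof -
      have "(\<Sum>j\<in>I. q' i j) = (\<Sum>j\<in>I. q i j) + (\<Sum>j\<in>I. if G j = G i then ra i * rb j / M (G i) else 0)"
        by (auto simp: q'_def sum.distrib intro!: sum.cong)
      also have "(\<Sum>j\<in>I. if G j = G i then ra i * rb j / M (G i) else 0) = ra i * (B (G i) / M (G i))"
        by (simp add: B_def sum_distrib_left sum_divide_distrib sum.inter_filter[OF I] if_distrib if_distribR cong: if_cong)
      also have "\<dots> \<le> ra i * 1"
        using ra[OF i] M by (intro mult_left_mono) auto
      finally show ?thesis by (simp add: ra_def)
    qed
    show "(\<Sum>i\<in>I. q' i j) \<le> b j" if j: "j \<in> I" for j
    proof -
      have "(\<Sum>i\<in>I. q' i j) = (\<Sum>i\<in>I. q i j) + (\<Sum>i\<in>I. if G i = G j then ra i * rb j / M (G j) else 0)"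
        by (auto simp: q'_def sum.distrib intro!: sum.cong)
      also have "(\<Sum>i\<in>I. if G i = G j then ra i * rb j / M (G j) else 0) = rb j * (A (G j) / M (G j))"
        by (simp add: A_def sum_distrib_left sum_divide_distrib sum.inter_filter[OF I] mult.commute if_distrib if_distribR cong: if_cong)
      also have "\<dots> \<le> rb j * 1"
        using rb[OF j] M by (intro mult_left_mono) auto
      finally show ?thesis by (simp add: rb_def)
    qed
    fix c
    let ?c = "{i\<in>I. G i = c}"
    have 1: "(\<Sum>i\<in>?c. \<Sum>j\<in>?c. q i j) = (\<Sum>i\<in>?c. a i) - A c"
    proof -
      have "(\<Sum>j\<in>?c. q i j) = (\<Sum>j\<in>I. q i j)" if "i \<in> ?c" for i
        using that supp[of i] I by (intro sum.mono_neutral_left) (auto, metis)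
      then show ?thesis by (simp add: A_def ra_def sum_subtractf)
    qed
    have 2: "(\<Sum>i\<in>?c. \<Sum>j\<in>?c. q i j) = (\<Sum>i\<in>?c. b i) - B c"
    proof -
      have "(\<Sum>i\<in>?c. q i j) = (\<Sum>i\<in>I. q i j)" if "j \<in> ?c" for j
        using that supp[of _ j] I by (intro sum.mono_neutral_left) auto
      then show ?thesis by (subst sum.swap) (simp add: B_def rb_def sum_subtractf)
    qed
    have "(\<Sum>i\<in>?c. \<Sum>j\<in>?c. q' i j) = (\<Sum>i\<in>?c. \<Sum>j\<in>?c. q i j) + (\<Sum>i\<in>?c. \<Sum>j\<in>?c. ra i * rb j / M c)"
      by (simp add: q'_def sum.distrib)
    also have "(\<Sum>i\<in>?c. \<Sum>j\<in>?c. ra i * rb j / M c) = A c * B c / M c"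
      by (simp add: A_def B_def sum_product sum_divide_distrib)
    also have "\<dots> = min (A c) (B c)"
      using AB[of c] by (auto simp: M_def max_def min_def)
    finally show "min (sum a ?c) (sum b ?c) \<le> (\<Sum>i\<in>?c. \<Sum>j\<in>?c. q' i j)"
      using 1 2 by linarith
  qed
qed

text \<open>Greedy matching from fine to coarse: \<open>H k\<close> gets coarser as \<open>k\<close>
  grows, and step \<open>k\<close> matches what is left inside its classes. Entries only increase,
  so optimality at the finer levels is never lost, and the mass placed so far lies inside the
  classes of the next level, as the next step requires.\<close>

lemma nested_partial_coupling:
  fixes a b :: "'i \<Rightarrow> real" and H :: "nat \<Rightarrow> 'i \<Rightarrow> 'j"
  assumes I: "finite I" and a: "\<And>i. i \<in> I \<Longrightarrow> 0 \<le> a i" and b: "\<And>i. i \<in> I \<Longrightarrow> 0 \<le> b i"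
    and nested: "\<And>k i j. i \<in> I \<Longrightarrow> j \<in> I \<Longrightarrow> H k i = H k j \<Longrightarrow> H (Suc k) i = H (Suc k) j"
  shows "\<exists>q. (\<forall>i\<in>I. \<forall>j\<in>I. 0 \<le> q i j) \<and> (\<forall>i\<in>I. (\<Sum>j\<in>I. q i j) \<le> a i) \<and> (\<forall>j\<in>I. (\<Sum>i\<in>I. q i j) \<le> b j)
    \<and> (\<forall>i\<in>I. \<forall>j\<in>I. H n i \<noteq> H n j \<longrightarrow> q i j = 0)
    \<and> (\<forall>k<n. \<forall>c. min (\<Sum>i\<in>{i\<in>I. H k i = c}. a i) (\<Sum>i\<in>{i\<in>I. H k i = c}. b i)
        \<le> (\<Sum>i\<in>{i\<in>I. H k i = c}. \<Sum>j\<in>{j\<in>I. H k j = c}. q i j))"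
proof (induction n)
  case 0
  show ?case by (intro exI[of _ "\<lambda>_ _. 0"]) (use a b in auto)
next
  case (Suc n)
  obtain q where q: "\<forall>i\<in>I. \<forall>j\<in>I. 0 \<le> q i j"
      "\<forall>i\<in>I. (\<Sum>j\<in>I. q i j) \<le> a i" "\<forall>j\<in>I. (\<Sum>i\<in>I. q i j) \<le> b j"
      "\<forall>i\<in>I. \<forall>j\<in>I. H n i \<noteq> H n j \<longrightarrow> q i j = 0"
    and qm: "\<forall>k<n. \<forall>c. min (\<Sum>i\<in>{i\<in>I. H k i = c}. a i) (\<Sum>i\<in>{i\<in>I. H k i = c}. b i)
        \<le> (\<Sum>i\<in>{i\<in>I. H k i = c}. \<Sum>j\<in>{j\<in>I. H k j = c}. q i j)"
    using Suc.IH by (elim exE conjE) (rule that)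
  obtain q' where q': "\<And>i j. i \<in> I \<Longrightarrow> j \<in> I \<Longrightarrow> q i j \<le> q' i j"
    "\<And>i. i \<in> I \<Longrightarrow> (\<Sum>j\<in>I. q' i j) \<le> a i" "\<And>j. j \<in> I \<Longrightarrow> (\<Sum>i\<in>I. q' i j) \<le> b j"
    "\<And>i j. i \<in> I \<Longrightarrow> j \<in> I \<Longrightarrow> H n i \<noteq> H n j \<Longrightarrow> q' i j = 0"
    "\<And>c. min (\<Sum>i\<in>{i\<in>I. H n i = c}. a i) (\<Sum>i\<in>{i\<in>I. H n i = c}. b i)
        \<le> (\<Sum>i\<in>{i\<in>I. H n i = c}. \<Sum>j\<in>{j\<in>I. H n j = c}. q' i j)"
    by (rule partial_coupling_step[of I q a b "H n", OF I], use q(1) in blast, use q(2) in blast,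
        use q(3) in blast, use q(4) in blast, rule that)
  have "min (\<Sum>i\<in>{i\<in>I. H k i = c}. a i) (\<Sum>i\<in>{i\<in>I. H k i = c}. b i)
        \<le> (\<Sum>i\<in>{i\<in>I. H k i = c}. \<Sum>j\<in>{j\<in>I. H k j = c}. q' i j)" if "k < Suc n" for k c
  proof (cases "k = n")
    case False
    then have "min (\<Sum>i\<in>{i\<in>I. H k i = c}. a i) (\<Sum>i\<in>{i\<in>I. H k i = c}. b i)
        \<le> (\<Sum>i\<in>{i\<in>I. H k i = c}. \<Sum>j\<in>{j\<in>I. H k j = c}. q i j)"
      using that qm by simp
    also have "\<dots> \<le> (\<Sum>i\<in>{i\<in>I. H k i = c}. \<Sum>j\<in>{j\<in>I. H k j = c}. q' i j)"
      using q'(1) by (intro sum_mono) auto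
    finally show ?thesis .
  qed (use q'(5) in simp)
  moreover have "0 \<le> q' i j" if "i \<in> I" "j \<in> I" for i j
    using q(1) q'(1)[OF that] that by force
  moreover have "q' i j = 0" if "i \<in> I" "j \<in> I" "H (Suc n) i \<noteq> H (Suc n) j" for i j
    using q'(4) nested that by blast
  ultimately show ?case using q'(2,3) by (intro exI[of _ q'] conjI) blast+
qed

text \<open>Levels are numbered from coarse to fine; one coupling is optimal for all of them at once.\<close>

lemma nested_coupling:
  fixes a b :: "'i \<Rightarrow> real" and G :: "nat \<Rightarrow> 'i \<Rightarrow> 'j"
  assumes I: "finite I" and a: "\<And>i. i \<in> I \<Longrightarrow> 0 \<le> a i" and b: "\<And>i. i \<in> I \<Longrightarrow> 0 \<le> b i"
    and ab: "sum a I = sum b I"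
    and nested: "\<And>l i j. l < m \<Longrightarrow> i \<in> I \<Longrightarrow> j \<in> I \<Longrightarrow> G (Suc l) i = G (Suc l) j \<Longrightarrow> G l i = G l j"
  shows "\<exists>q. (\<forall>i\<in>I. \<forall>j\<in>I. 0 \<le> q i j) \<and> (\<forall>i\<in>I. (\<Sum>j\<in>I. q i j) = a i) \<and> (\<forall>j\<in>I. (\<Sum>i\<in>I. q i j) = b j)
    \<and> (\<forall>l\<le>m. (\<Sum>i\<in>I. \<Sum>j\<in>I. if G l i \<noteq> G l j then q i j else 0)
      \<le> (\<Sum>c\<in>G l ` I. \<bar>(\<Sum>i\<in>{i\<in>I. G l i = c}. a i) - (\<Sum>i\<in>{i\<in>I. G l i = c}. b i)\<bar>))"
proof -
  \<comment> \<open>Levels are reversed to run from fine to coarse, and \<open>None\<close> adds one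
    class above all of them. Matching there, at index \<open>m + 1\<close>, completes the partial
    coupling to a full one; hence the \<open>m + 2\<close> steps below.\<close>
  define H where "H k i = (if k \<le> m then Some (G (m - k) i) else None)" for k i
  have nest: "H (Suc k) i = H (Suc k) j" if "i \<in> I" "j \<in> I" "H k i = H k j" for k i j
  proof (cases "Suc k \<le> m")
    case True
    then have "m - k = Suc (m - Suc k)" by simp
    then show ?thesis using nested[of "m - Suc k" i j] that True by (simp add: H_def)
  qed (simp add: H_def)
  have "\<exists>q. (\<forall>i\<in>I. \<forall>j\<in>I. 0 \<le> q i j) \<and> (\<forall>i\<in>I. (\<Sum>j\<in>I. q i j) \<le> a i) \<and> (\<forall>j\<in>I. (\<Sum>i\<in>I. q i j) \<le> b j)
    \<and> (\<forall>i\<in>I. \<forall>j\<in>I. H (m + 2) i \<noteq> H (m + 2) j \<longrightarrow> q i j = 0)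
    \<and> (\<forall>k<m + 2. \<forall>c. min (\<Sum>i\<in>{i\<in>I. H k i = c}. a i) (\<Sum>i\<in>{i\<in>I. H k i = c}. b i)
        \<le> (\<Sum>i\<in>{i\<in>I. H k i = c}. \<Sum>j\<in>{j\<in>I. H k j = c}. q i j))"
    by (rule nested_partial_coupling) (auto intro: I a b nest)
  then obtain q where q: "\<forall>i\<in>I. \<forall>j\<in>I. 0 \<le> q i j"
      "\<forall>i\<in>I. (\<Sum>j\<in>I. q i j) \<le> a i" "\<forall>j\<in>I. (\<Sum>i\<in>I. q i j) \<le> b j"
    and qm: "\<forall>k<m + 2. \<forall>c. min (\<Sum>i\<in>{i\<in>I. H k i = c}. a i) (\<Sum>i\<in>{i\<in>I. H k i = c}. b i)
        \<le> (\<Sum>i\<in>{i\<in>I. H k i = c}. \<Sum>j\<in>{j\<in>I. H k j = c}. q i j)"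
    by (elim exE conjE) (rule that)
  \<comment> \<open>In the class \<open>None\<close> nothing remains unmatched. Row and column sums
    never exceed \<open>a\<close> and \<open>b\<close>, so equality of the totals forces equality in
    each row and column.\<close>
  have "min (sum a I) (sum b I) \<le> (\<Sum>i\<in>I. \<Sum>j\<in>I. q i j)"
    using qm[rule_format, of "Suc m" None] by (simp add: H_def)
  then have tot: "sum a I \<le> (\<Sum>i\<in>I. \<Sum>j\<in>I. q i j)" using ab by simp
  have row: "(\<Sum>j\<in>I. q i j) = a i" if "i \<in> I" for i
  proof -
    have "(\<Sum>i\<in>I. a i - (\<Sum>j\<in>I. q i j)) = 0"
    proof (rule antisym)
      show "(\<Sum>i\<in>I. a i - (\<Sum>j\<in>I. q i j)) \<le> 0" using tot by (simp add: sum_subtractf)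
    qed (use q in \<open>auto intro!: sum_nonneg\<close>)
    then show ?thesis using that q(2) I by (subst (asm) sum_nonneg_eq_0_iff) auto
  qed
  have col: "(\<Sum>i\<in>I. q i j) = b j" if "j \<in> I" for j
  proof -
    have "(\<Sum>j\<in>I. b j - (\<Sum>i\<in>I. q i j)) = 0"
    proof (rule antisym)
      have "(\<Sum>j\<in>I. \<Sum>i\<in>I. q i j) = (\<Sum>i\<in>I. \<Sum>j\<in>I. q i j)" by (rule sum.swap)
      then show "(\<Sum>j\<in>I. b j - (\<Sum>i\<in>I. q i j)) \<le> 0" using tot ab by (simp add: sum_subtractf)
    qed (use q in \<open>auto intro!: sum_nonneg\<close>)
    then show ?thesis using that q(3) I by (subst (asm) sum_nonneg_eq_0_iff) auto
  qed
  show ?thesis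
  proof (intro exI[of _ q] conjI allI impI)
    fix l assume l: "l \<le> m"
    define S where "S c = {i\<in>I. G l i = c}" for c
    have HS: "{i\<in>I. H (m - l) i = Some c} = S c" for c
      using l by (simp add: H_def S_def)
    have S: "finite (S c)" "S c \<subseteq> I" for c using I by (auto simp: S_def)
    have part: "(\<Sum>c\<in>G l ` I. sum f (S c)) = sum f I" for f :: "'i \<Rightarrow> real"
      using sum.image_gen[OF I, of f "G l"] by (simp add: S_def)
    \<comment> \<open>Mass that leaves a class of level \<open>l\<close> is the class total minus
      the mass kept inside, and the latter is at least the smaller of the two class totals.\<close>
    have "(\<Sum>i\<in>I. \<Sum>j\<in>I. if G l i \<noteq> G l j then q i j else 0)
        = (\<Sum>c\<in>G l ` I. \<Sum>i\<in>S c. (a i - (\<Sum>j\<in>S c. q i j)))"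
      unfolding part[symmetric, of "\<lambda>i. (\<Sum>j\<in>I. if G l i \<noteq> G l j then q i j else 0)"]
    proof (intro sum.cong refl)
      fix c i assume i: "i \<in> S c"
      then have "(\<Sum>j\<in>S c. q i j) = (\<Sum>j\<in>I. if G l i = G l j then q i j else 0)"
        unfolding S_def sum.inter_filter[OF I] by (auto intro!: sum.cong)
      moreover have "(\<Sum>j\<in>I. if G l i = G l j then q i j else 0)
          + (\<Sum>j\<in>I. if G l i \<noteq> G l j then q i j else 0) = (\<Sum>j\<in>I. q i j)"
        unfolding sum.distrib[symmetric] by (auto intro!: sum.cong)
      ultimately show "(\<Sum>j\<in>I. if G l i \<noteq> G l j then q i j else 0) = a i - (\<Sum>j\<in>S c. q i j)"
        using row[of i] i by (simp add: S_def)
    qed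
    also have "\<dots> = (\<Sum>c\<in>G l ` I. sum a (S c) - (\<Sum>i\<in>S c. \<Sum>j\<in>S c. q i j))"
      by (simp add: sum_subtractf)
    also have "\<dots> \<le> (\<Sum>c\<in>G l ` I. \<bar>sum a (S c) - sum b (S c)\<bar>)"
    proof (rule sum_mono)
      fix c
      show "sum a (S c) - (\<Sum>i\<in>S c. \<Sum>j\<in>S c. q i j) \<le> \<bar>sum a (S c) - sum b (S c)\<bar>"
        using qm[rule_format, of "m - l" "Some c"] l unfolding HS by linarith
    qed
    finally show "(\<Sum>i\<in>I. \<Sum>j\<in>I. if G l i \<noteq> G l j then q i j else 0)
      \<le> (\<Sum>c\<in>G l ` I. \<bar>(\<Sum>i\<in>{i\<in>I. G l i = c}. a i) - (\<Sum>i\<in>{i\<in>I. G l i = c}. b i)\<bar>)"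
      by (simp add: S_def)
  qed (use q row col in auto)
qed

section \<open>Quadratic forms and eigenvalues\<close>

text \<open>The first-order condition at a minimum, without derivatives: a step
  \<open>t = - b / k\<close> with \<open>c < 2 * k\<close> makes the linear term win over the
  quadratic one.\<close>

lemma linear_coeff_eq_0:
  fixes b c :: real
  assumes "\<And>t. 0 \<le> 2 * t * b + t\<^sup>2 * c"
  shows "b = 0"
proof (rule ccontr)
  assume b: "b \<noteq> 0"
  define k where "k = \<bar>c\<bar> + 1"
  have k: "0 < k" "c < 2 * k" by (auto simp: k_def)
  have "2 * (- b / k) * b + (- b / k)\<^sup>2 * c = b\<^sup>2 * (c - 2 * k) / k\<^sup>2"
    using k by (simp add: field_simps power2_eq_square)
  also have "\<dots> < 0" using b k by (intro divide_neg_pos mult_pos_neg) auto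
  finally show False using assms[of "- b / k"] by simp
qed

definition quad :: "nat \<Rightarrow> (nat \<Rightarrow> nat \<Rightarrow> real) \<Rightarrow> (nat \<Rightarrow> real) \<Rightarrow> real" where
  "quad n D x = (\<Sum>i<n. \<Sum>j<n. D i j * x i * x j)"

lemma quad_cong: "(\<And>i. i < n \<Longrightarrow> x i = y i) \<Longrightarrow> quad n D x = quad n D y"
  by (simp add: quad_def)

lemma quad_Suc:
  assumes "\<And>i j. i < Suc n \<Longrightarrow> j < Suc n \<Longrightarrow> D i j = D j i"
  shows "quad (Suc n) D x = quad n D x + 2 * x n * (\<Sum>i<n. D i n * x i) + D n n * (x n)\<^sup>2"
proof -
  have "(\<Sum>j<n. D n j * x n * x j) = x n * (\<Sum>i<n. D i n * x i)"
    using assms by (auto simp: sum_distrib_left intro!: sum.cong)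
  moreover have "(\<Sum>i<n. D i n * x i * x n) = x n * (\<Sum>i<n. D i n * x i)"
    by (auto simp: sum_distrib_left intro!: sum.cong)
  ultimately show ?thesis
    by (simp add: quad_def sum.distrib power2_eq_square algebra_simps)
qed

text \<open>Cholesky factorisation by induction: the last variable is completed to a square, and the
  Schur complement \<open>D'\<close> of the pivot \<open>e\<close> remains. For a positive pivot its
  value is the minimum of the form over the last variable, hence nonnegative again.\<close>

lemma psd_sum_of_squares:
  assumes "\<And>i j. i < n \<Longrightarrow> j < n \<Longrightarrow> D i j = D j i" and "\<And>x. 0 \<le> quad n D x"
  shows "\<exists>L. \<forall>x. quad n D x = (\<Sum>k<n. (\<Sum>i<n. L k i * x i)\<^sup>2)"
  using assms
proof (induction n arbitrary: D)
  case 0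
  show ?case by (simp add: quad_def)
next
  case (Suc n)
  define e where "e = D n n"
  define b where "b x = (\<Sum>i<n. D i n * x i)" for x
  have qS: "quad (Suc n) D x = quad n D x + 2 * x n * b x + e * (x n)\<^sup>2" for x
    using quad_Suc[OF Suc.prems(1)] by (simp add: b_def e_def)
  have ext: "0 \<le> quad n D x + 2 * t * b x + e * t\<^sup>2" for x t
  proof -
    have "quad n D (x(n := t)) = quad n D x" "b (x(n := t)) = b x"
      by (auto simp: b_def intro!: quad_cong sum.cong)
    moreover have "0 \<le> quad n D (x(n := t)) + 2 * (x(n := t)) n * b (x(n := t)) + e * ((x(n := t)) n)\<^sup>2"
      using Suc.prems(2)[of "x(n := t)"] unfolding qS .
    ultimately show ?thesis by (simp only: fun_upd_same)
  qed
  have e: "0 \<le> e" using ext[of "\<lambda>_. 0" 1] by (simp add: quad_def b_def)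
  \<comment> \<open>With a zero pivot the form is affine in the last variable, so nonnegativity
    forces its linear coefficient to vanish. Division by zero then makes the formulas below valid in
    both cases.\<close>
  have b0: "b x = 0" if "e = 0" for x
  proof (rule ccontr)
    assume "b x \<noteq> 0"
    then show False using ext[of x "- (quad n D x + 1) / (2 * b x)"] that by (simp add: field_simps)
  qed
  define D' where "D' i j = D i j - D i n * D j n / e" for i j
  have q': "quad n D' x = quad n D x - (b x)\<^sup>2 / e" for x
  proof -
    have "(b x)\<^sup>2 = (\<Sum>i<n. \<Sum>j<n. D i n * x i * (D j n * x j))"
      by (simp add: b_def power2_eq_square sum_product)
    then show ?thesis
      by (simp add: quad_def D'_def sum_subtractf sum_divide_distrib algebra_simps)
  qed
  have pos: "0 \<le> quad n D' x" for x
  proof (cases "e = 0")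
    case False
    have "quad n D' x = quad n D x + 2 * (- b x / e) * b x + e * (- b x / e)\<^sup>2"
      using False by (simp add: q' field_simps power2_eq_square)
    then show ?thesis using ext[of x "- b x / e"] by simp
  qed (use ext[of x 0] in \<open>simp add: q'\<close>)
  obtain L where L: "quad n D' x = (\<Sum>k<n. (\<Sum>i<n. L k i * x i)\<^sup>2)" for x
    using Suc.IH[of D'] Suc.prems(1) pos by (fastforce simp: D'_def)
  define L' where "L' k i = (if k < n then if i < n then L k i else 0 else D i n / sqrt e)" for k i
  have "quad (Suc n) D x = (\<Sum>k<Suc n. (\<Sum>i<Suc n. L' k i * x i)\<^sup>2)" for x
  proof -
    have "(\<Sum>i<Suc n. L' n i * x i) = (b x + e * x n) / sqrt e"
      by (simp add: L'_def b_def e_def sum_divide_distrib add_divide_distrib)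
    then have "(\<Sum>i<Suc n. L' n i * x i)\<^sup>2 = (b x + e * x n)\<^sup>2 / e"
      using e by (simp add: power_divide)
    also have "\<dots> = (b x)\<^sup>2 / e + 2 * x n * b x + e * (x n)\<^sup>2"
      using b0[of x] by (cases "e = 0") (auto simp: field_simps power2_eq_square)
    moreover have "(\<Sum>k<n. (\<Sum>i<Suc n. L' k i * x i)\<^sup>2) = quad n D' x"
      by (simp add: L L'_def)
    ultimately show ?thesis by (simp add: qS q')
  qed
  then show ?case by blast
qed

section \<open>Extreme eigenvalues of symmetric matrices\<close>

lemma scalar_prod_mult_mat_vec:
  assumes "M \<in> carrier_mat n n"
  shows "scalar_prod (Matrix.vec n x) (M *\<^sub>v Matrix.vec n x) = quad n (\<lambda>i j. M $$ (i, j)) x"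
  using assms
  by (simp add: quad_def scalar_prod_def lessThan_atLeast0 sum_distrib_left mult_ac row_def)

lemma symmetric_mat_entry:
  assumes "M \<in> carrier_mat n n" "transpose_mat M = M" "i < n" "j < n"
  shows "M $$ (i, j) = M $$ (j, i)"
  using assms index_transpose_mat(1)[of i M j] by (metis carrier_matD)

text \<open>The form attains its minimum on the unit sphere, and the minimum is an eigenvalue, as
  seen by perturbing the minimiser along single coordinates. This gives existence of an eigenvalue
  and the lower bound at once; applied to \<open>- M\<close> it also serves
  \<open>lambda_max\<close>.\<close>

lemma symmetric_rayleigh_eigenvalue:
  fixes M :: "real mat"
  assumes M: "M \<in> carrier_mat n n" and sym: "transpose_mat M = M" and n: "0 < n"
  shows "\<exists>\<mu>. eigenvalue M \<mu> \<and> (\<forall>x. \<mu> * (\<Sum>i<n. (x i)\<^sup>2) \<le> quad n (\<lambda>i j. M $$ (i, j)) x)"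
proof -
  let ?q = "quad n (\<lambda>i j. M $$ (i, j))"
  \<comment> \<open>The dimension is a variable, so vectors are functions on all naturals that
    vanish from \<open>n\<close> on; \<open>K\<close> is a product of compact sets, hence compact in
    the product topology.\<close>
  define K :: "(nat \<Rightarrow> real) set" where "K = PiE UNIV (\<lambda>i. if i < n then {-1..1} else {0})"
  define S where "S = K \<inter> {x. (\<Sum>i<n. (x i)\<^sup>2) = 1}"
  have "compactin (product_topology (\<lambda>_. euclidean) UNIV) K"
    unfolding K_def compactin_PiE by (auto simp: compactin_euclidean_iff)
  then have K: "compact K"
    by (simp add: euclidean_product_topology compactin_euclidean_iff)
  have coord: "continuous_on A (\<lambda>x::nat \<Rightarrow> real. x i)" for A i
    by (rule continuous_on_product_coordinates[THEN continuous_on_subset]) simp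
  have S: "compact S"
    unfolding S_def
    by (intro compact_Int_closed K closed_Collect_eq continuous_intros coord)
  have q: "continuous_on S ?q" unfolding quad_def by (intro continuous_intros coord)
  have "(\<lambda>i. if i = 0 then 1 else 0) \<in> S"
    using n by (auto simp: S_def K_def if_distrib[of "\<lambda>x. x\<^sup>2"] cong: if_cong)
  then obtain x where x: "x \<in> S" and min: "\<And>y. y \<in> S \<Longrightarrow> ?q x \<le> ?q y"
    using continuous_attains_inf[OF S _ q] by auto
  define \<mu> where "\<mu> = ?q x"
  have x1: "(\<Sum>i<n. (x i)\<^sup>2) = 1" using x by (simp add: S_def)
  have ray: "\<mu> * (\<Sum>i<n. (y i)\<^sup>2) \<le> ?q y" for y
  proof (cases "(\<Sum>i<n. (y i)\<^sup>2) = 0")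
    case True
    then have "y i = 0" if "i < n" for i using that by (simp add: sum_nonneg_eq_0_iff)
    then show ?thesis by (simp add: quad_def)
  next
    case False
    define s where "s = sqrt (\<Sum>i<n. (y i)\<^sup>2)"
    have s2: "s\<^sup>2 = (\<Sum>i<n. (y i)\<^sup>2)" by (simp add: s_def sum_nonneg)
    have s: "0 < s" using False by (simp add: s_def sum_nonneg less_le)
    define z where "z i = (if i < n then y i / s else 0)" for i
    have z1: "(\<Sum>i<n. (z i)\<^sup>2) = 1"
      using s by (simp add: z_def power_divide sum_divide_distrib[symmetric] s2[symmetric])
    have "\<bar>z i\<bar> \<le> 1" if "i < n" for i
    proof -
      have "(z i)\<^sup>2 \<le> 1" unfolding z1[symmetric] using that by (intro member_le_sum) auto
      then show ?thesis by (simp add: abs_square_le_1)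
    qed
    then have "z \<in> S" using z1 by (auto simp: S_def K_def abs_le_iff) (auto simp: z_def)
    then have "\<mu> \<le> ?q z" unfolding \<mu>_def by (rule min)
    also have "?q z = ?q y / s\<^sup>2"
      by (simp add: quad_def z_def sum_divide_distrib power2_eq_square)
    finally show ?thesis using s by (simp add: s2[symmetric] field_simps)
  qed
  define Mx where "Mx i = (\<Sum>j<n. M $$ (i, j) * x j)" for i
  have eig: "Mx k = \<mu> * x k" if k: "k < n" for k
  proof -
    \<comment> \<open>Moving the minimiser by \<open>t\<close> along coordinate \<open>k\<close>
      takes the form minus \<open>\<mu>\<close> times the squared norm from 0 to exactly this
      quadratic in \<open>t\<close>, which therefore has no linear term.\<close>
    have "0 \<le> 2 * t * (Mx k - \<mu> * x k) + t\<^sup>2 * (M $$ (k, k) - \<mu>)" for t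
    proof -
      define y where "y i = x i + (if i = k then t else 0)" for i
      have "(\<Sum>i<n. (y i)\<^sup>2) = (\<Sum>i<n. (x i)\<^sup>2 + (if i = k then 2 * t * x k + t\<^sup>2 else 0))"
        by (intro sum.cong) (auto simp: y_def power2_eq_square algebra_simps)
      also have "\<dots> = 1 + 2 * t * x k + t\<^sup>2"
        using k by (simp add: sum.distrib x1)
      finally have 1: "(\<Sum>i<n. (y i)\<^sup>2) = 1 + 2 * t * x k + t\<^sup>2" .
      have "?q y = (\<Sum>i<n. \<Sum>j<n. M $$ (i, j) * x i * x j + (if j = k then M $$ (i, k) * x i * t else 0)
          + (if i = k then M $$ (k, j) * x j * t else 0) + (if i = k then if j = k then M $$ (k, k) * t\<^sup>2 else 0 else 0))"
        unfolding quad_def by (intro sum.cong) (auto simp: y_def power2_eq_square algebra_simps)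
      also have "\<dots> = ?q x + (\<Sum>i<n. M $$ (i, k) * x i * t) + (\<Sum>j<n. M $$ (k, j) * x j * t) + M $$ (k, k) * t\<^sup>2"
      proof -
        have *: "(\<Sum>j<n. if i = k then f j else 0) = (if i = k then \<Sum>j<n. f j else 0)" for i and f :: "nat \<Rightarrow> real"
          by simp
        show ?thesis using k by (simp add: sum.distrib quad_def *)
      qed
      also have "(\<Sum>i<n. M $$ (i, k) * x i * t) = t * Mx k"
        using symmetric_mat_entry[OF M sym] k
        by (auto simp: Mx_def sum_distrib_left mult_ac intro!: sum.cong)
      also have "(\<Sum>j<n. M $$ (k, j) * x j * t) = t * Mx k"
        by (auto simp: Mx_def sum_distrib_left mult_ac intro!: sum.cong)
      finally have "?q y = \<mu> + 2 * t * Mx k + M $$ (k, k) * t\<^sup>2" by (simp add: \<mu>_def)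
      then show ?thesis using ray[of y] by (simp add: 1 algebra_simps)
    qed
    from linear_coeff_eq_0[OF this] show ?thesis by simp
  qed
  have "eigenvector M (Matrix.vec n x) \<mu>"
    unfolding eigenvector_def
  proof (intro conjI)
    show "Matrix.vec n x \<noteq> 0\<^sub>v (dim_row M)"
    proof
      assume "Matrix.vec n x = 0\<^sub>v (dim_row M)"
      then have "x i = 0" if "i < n" for i
        using that M by (metis carrier_matD(1) index_vec index_zero_vec(1))
      then show False using x1 by simp
    qed
    show "M *\<^sub>v Matrix.vec n x = \<mu> \<cdot>\<^sub>v Matrix.vec n x"
    proof (rule eq_vecI)
      fix i assume "i < dim_vec (\<mu> \<cdot>\<^sub>v Matrix.vec n x)"
      then have i: "i < n" by simp
      have "vec_index (M *\<^sub>v Matrix.vec n x) i = Mx i"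
        using i M by (simp add: Mx_def scalar_prod_def lessThan_atLeast0 row_def)
      then show "vec_index (M *\<^sub>v Matrix.vec n x) i = vec_index (\<mu> \<cdot>\<^sub>v Matrix.vec n x) i"
        using eig[OF i] i by simp
    qed (use M in simp)
  qed (use M in simp)
  then show ?thesis using ray unfolding eigenvalue_def by blast
qed

lemma finite_eigenvalues:
  fixes M :: "real mat"
  assumes M: "M \<in> carrier_mat n n"
  shows "finite {k. eigenvalue M k}"
proof -
  have "char_poly M \<noteq> 0" using degree_monic_char_poly[OF M] by auto
  then show ?thesis using poly_roots_finite by (simp add: eigenvalue_root_char_poly[OF M])
qed

lemma lambda_min_le:
  assumes M: "M \<in> carrier_mat n n" and sym: "transpose_mat M = M" and n: "0 < n"
  shows "lambda_min M * (\<Sum>i<n. (x i)\<^sup>2) \<le> quad n (\<lambda>i j. M $$ (i, j)) x"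
proof -
  obtain \<mu> where \<mu>: "eigenvalue M \<mu>" "\<And>x. \<mu> * (\<Sum>i<n. (x i)\<^sup>2) \<le> quad n (\<lambda>i j. M $$ (i, j)) x"
    using symmetric_rayleigh_eigenvalue[OF assms] by blast
  have "lambda_min M \<le> \<mu>" unfolding lambda_min_def using \<mu>(1) finite_eigenvalues[OF M] by (intro Min_le) auto
  then have "lambda_min M * (\<Sum>i<n. (x i)\<^sup>2) \<le> \<mu> * (\<Sum>i<n. (x i)\<^sup>2)"
    by (intro mult_right_mono sum_nonneg) auto
  with \<mu>(2)[of x] show ?thesis by simp
qed

text \<open>The Rayleigh bound for \<open>- M\<close>: an eigenvector of \<open>- M\<close> is one
  of \<open>M\<close> for the opposite eigenvalue.\<close>

lemma le_lambda_max:
  assumes M: "M \<in> carrier_mat n n" and sym: "transpose_mat M = M" and n: "0 < n"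
  shows "quad n (\<lambda>i j. M $$ (i, j)) x \<le> lambda_max M * (\<Sum>i<n. (x i)\<^sup>2)"
proof -
  have M': "- M \<in> carrier_mat n n" using M by simp
  have sym': "transpose_mat (- M) = - M" using M sym transpose_uminus[of M] by simp
  obtain \<mu> where \<mu>: "eigenvalue (- M) \<mu>" "\<And>x. \<mu> * (\<Sum>i<n. (x i)\<^sup>2) \<le> quad n (\<lambda>i j. (- M) $$ (i, j)) x"
    using symmetric_rayleigh_eigenvalue[OF M' sym' n] by blast
  have neg: "quad n (\<lambda>i j. (- M) $$ (i, j)) x = - quad n (\<lambda>i j. M $$ (i, j)) x"
    using M by (simp add: quad_def sum_negf)
  obtain v where v: "eigenvector (- M) v \<mu>" using \<mu>(1) by (auto simp: eigenvalue_def)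
  then have vc: "v \<in> carrier_vec n" using M by (simp add: eigenvector_def)
  have "M *\<^sub>v v = (- \<mu>) \<cdot>\<^sub>v v"
  proof (rule eq_vecI)
    fix i assume "i < dim_vec ((- \<mu>) \<cdot>\<^sub>v v)"
    then have i: "i < n" using vc by simp
    have "vec_index ((- M) *\<^sub>v v) i = \<mu> * vec_index v i"
      using v i vc by (simp add: eigenvector_def)
    then show "vec_index (M *\<^sub>v v) i = vec_index ((- \<mu>) \<cdot>\<^sub>v v) i"
      using i M vc by simp
  qed (use M vc in simp)
  then have "eigenvalue M (- \<mu>)"
    using v M unfolding eigenvalue_def eigenvector_def by auto
  then have "- \<mu> \<le> lambda_max M"
    unfolding lambda_max_def using finite_eigenvalues[OF M] by (intro Max_ge) auto
  then have "- \<mu> * (\<Sum>i<n. (x i)\<^sup>2) \<le> lambda_max M * (\<Sum>i<n. (x i)\<^sup>2)"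
    by (intro mult_right_mono sum_nonneg) auto
  with \<mu>(2)[of x] neg show ?thesis by simp
qed

lemma lambda_min_pos:
  assumes M: "pos_def n M" and n: "0 < n"
  shows "0 < lambda_min M"
proof -
  have M': "M \<in> carrier_mat n n" "transpose_mat M = M" using M by (auto simp: pos_def_def)
  have "lambda_min M \<in> {k. eigenvalue M k}"
    unfolding lambda_min_def using symmetric_rayleigh_eigenvalue[OF M' n] finite_eigenvalues[OF M'(1)]
    by (intro Min_in) auto
  then obtain v where v: "eigenvector M v (lambda_min M)" by (auto simp: eigenvalue_def)
  then have vc: "v \<in> carrier_vec n" "v \<noteq> 0\<^sub>v n" using M' by (auto simp: eigenvector_def)
  have "0 < scalar_prod v (M *\<^sub>v v)" using M vc by (simp add: pos_def_def)
  also have "\<dots> = lambda_min M * scalar_prod v v"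
    using v vc by (simp add: eigenvector_def)
  finally show ?thesis
    using sum_nonneg[of "{0..<dim_vec v}" "\<lambda>i. vec_index v i * vec_index v i"]
    by (simp add: scalar_prod_def zero_less_mult_iff)
qed

section \<open>The cost as a sum of squares\<close>

text \<open>The coefficients are existentially bound, so that the closed loop need not be solved as
  a matrix equation: closure under the operations of its recursion is enough.\<close>

definition linear_form :: "nat \<Rightarrow> ((nat \<Rightarrow> real) \<Rightarrow> real) \<Rightarrow> bool" where
  "linear_form d f \<longleftrightarrow> (\<exists>c. \<forall>\<xi>. f \<xi> = (\<Sum>i<d. c i * \<xi> i))"

lemma linear_form_coordinate: "i < d \<Longrightarrow> linear_form d (\<lambda>\<xi>. \<xi> i)"
  unfolding linear_form_def
  by (rule exI[of _ "\<lambda>j. if j = i then 1 else 0"]) (simp add: if_distrib[of "\<lambda>c. c * _"] cong: if_cong)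

lemma linear_form_add:
  assumes "linear_form d f" "linear_form d g"
  shows "linear_form d (\<lambda>\<xi>. f \<xi> + g \<xi>)"
proof -
  obtain a b where "\<And>\<xi>. f \<xi> = (\<Sum>i<d. a i * \<xi> i)" "\<And>\<xi>. g \<xi> = (\<Sum>i<d. b i * \<xi> i)"
    using assms unfolding linear_form_def by blast
  then show ?thesis unfolding linear_form_def
    by (intro exI[of _ "\<lambda>i. a i + b i"]) (simp add: sum.distrib algebra_simps)
qed

lemma linear_form_scale:
  assumes "linear_form d f"
  shows "linear_form d (\<lambda>\<xi>. c * f \<xi>)"
proof -
  obtain a where "\<And>\<xi>. f \<xi> = (\<Sum>i<d. a i * \<xi> i)"
    using assms unfolding linear_form_def by blast
  then show ?thesis unfolding linear_form_def
    by (intro exI[of _ "\<lambda>i. c * a i"]) (simp add: sum_distrib_left mult.assoc)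
qed

lemma linear_form_sum:
  assumes "\<And>k. k \<in> A \<Longrightarrow> linear_form d (f k)"
  shows "linear_form d (\<lambda>\<xi>. \<Sum>k\<in>A. f k \<xi>)"
proof -
  have zero: "linear_form d (\<lambda>_. 0)"
    unfolding linear_form_def by (rule exI[of _ "\<lambda>_. 0"]) simp
  show ?thesis
    using assms by (induction A rule: infinite_finite_induct) (auto intro: linear_form_add zero)
qed

lemma mult_mat_vec_entry:
  fixes M :: "real mat"
  assumes "M \<in> carrier_mat a b" "dim_vec v = b" "i < a"
  shows "vec_index (M *\<^sub>v v) i = (\<Sum>j<b. M $$ (i, j) * vec_index v j)"
  using assms by (simp add: scalar_prod_def lessThan_atLeast0 row_def)

lemma dim_closed_loop [simp]:
  "dim_vec (closed_loop_state S K \<xi> t) = state_dim S"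
  "dim_vec (closed_loop_output S K \<xi> t) = output_dim S"
  "dim_vec (closed_loop_input S K \<xi> t) = input_dim S"
  by (cases t; simp add: initial_state_def process_noise_def)
     (simp_all add: closed_loop_output_def output_noise_def closed_loop_input_def)

lemma block_index_less:
  fixes i t n T :: nat
  assumes "i < n" "t < T"
  shows "t * n + i < n * T"
proof -
  have "t * n + i < Suc t * n" using assms(1) by simp
  also have "\<dots> \<le> T * n" using assms(2) by (intro mult_right_mono) auto
  finally show ?thesis by (simp add: mult.commute)
qed

context
  fixes S :: lq_problem and d :: nat
  assumes wf: "well_formed S" and d: "noise_dim S = d"
begin

lemma linear_form_output:
  assumes state: "\<And>i. i < state_dim S \<Longrightarrow> linear_form d (\<lambda>\<xi>. vec_index (closed_loop_state S K \<xi> s) i)"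
    and s: "s < horizon S" and i: "i < output_dim S"
  shows "linear_form d (\<lambda>\<xi>. vec_index (closed_loop_output S K \<xi> s) i)"
proof -
  have C: "C_mat S s \<in> carrier_mat (output_dim S) (state_dim S)"
    using wf s by (simp add: well_formed_def)
  \<comment> \<open>The output noise follows \<open>horizon S\<close> blocks of state size, and
    \<open>s < horizon S\<close> keeps its index inside the noise vector.\<close>
  have b: "state_dim S * horizon S + s * output_dim S + i < d"
    using block_index_less[OF i s] d by (simp add: noise_dim_def algebra_simps)
  have "vec_index (closed_loop_output S K \<xi> s) i
      = (\<Sum>j<state_dim S. C_mat S s $$ (i, j) * vec_index (closed_loop_state S K \<xi> s) j)
        + \<xi> (state_dim S * horizon S + s * output_dim S + i)" for \<xi>
    using i by (simp add: closed_loop_output_def output_noise_def mult_mat_vec_entry[OF C])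
  then show ?thesis
    using state b by (simp only:) (intro linear_form_add linear_form_sum linear_form_scale linear_form_coordinate; simp)
qed

lemma linear_form_input:
  assumes state: "\<And>s i. s \<le> t \<Longrightarrow> i < state_dim S \<Longrightarrow> linear_form d (\<lambda>\<xi>. vec_index (closed_loop_state S K \<xi> s) i)"
    and t: "t < horizon S" and i: "i < input_dim S"
  shows "linear_form d (\<lambda>\<xi>. vec_index (closed_loop_input S K \<xi> t) i)"
proof -
  have K: "controller_block S K t s \<in> carrier_mat (input_dim S) (output_dim S)" for s
    by (simp add: controller_block_def)
  have "vec_index (closed_loop_input S K \<xi> t) i
      = (\<Sum>s\<le>t. \<Sum>j<output_dim S. controller_block S K t s $$ (i, j) * vec_index (closed_loop_output S K \<xi> s) j)" for \<xi>
    using i by (simp add: closed_loop_input_def mult_mat_vec_entry[OF K])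
  then show ?thesis
    using state t by (simp only:) (intro linear_form_sum linear_form_scale linear_form_output; simp)
qed

text \<open>Complete induction, since the input at one time feeds back all outputs up to that time
  and with them all the states before.\<close>

lemma linear_form_state:
  assumes "t < horizon S" "i < state_dim S"
  shows "linear_form d (\<lambda>\<xi>. vec_index (closed_loop_state S K \<xi> t) i)"
  using assms
proof (induction t arbitrary: i rule: less_induct)
  case (less t)
  show ?case
  proof (cases t)
    case 0
    have "i < d"
      using block_index_less[of i "state_dim S" 0 "horizon S"] less.prems 0 d
      by (simp add: noise_dim_def algebra_simps)
    then show ?thesis
      using less.prems 0 by (simp add: initial_state_def linear_form_coordinate)
  next
    case (Suc r)
    have A: "A_mat S r \<in> carrier_mat (state_dim S) (state_dim S)"
      and B: "B_mat S r \<in> carrier_mat (state_dim S) (input_dim S)"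
      using wf less.prems Suc by (auto simp: well_formed_def)
    have b: "Suc r * state_dim S + i < d"
      using block_index_less[of i "state_dim S" "Suc r" "horizon S"] less.prems Suc d
      by (simp add: noise_dim_def algebra_simps)
    have "vec_index (closed_loop_state S K \<xi> t) i
      = (\<Sum>j<state_dim S. A_mat S r $$ (i, j) * vec_index (closed_loop_state S K \<xi> r) j)
        + (\<Sum>j<input_dim S. B_mat S r $$ (i, j) * vec_index (closed_loop_input S K \<xi> r) j)
        + \<xi> (Suc r * state_dim S + i)" for \<xi>
    proof -
      have "dim_vec (process_noise S \<xi> r) = state_dim S" by (simp add: process_noise_def)
      then show ?thesis
        unfolding Suc closed_loop_state_Suc using less.prems A B
        by (simp del: index_mult_mat_vec add: mult_mat_vec_entry[OF A] mult_mat_vec_entry[OF B]) (simp add: process_noise_def)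
    qed
    then show ?thesis
      using less Suc b
      by (simp only:)
        (intro linear_form_add linear_form_sum linear_form_scale linear_form_input linear_form_coordinate; simp)
  qed
qed

lemma linear_form_stack:
  assumes z: "\<And>t i. t < horizon S \<Longrightarrow> i < k \<Longrightarrow> linear_form d (\<lambda>\<xi>. vec_index (z \<xi> t) i)"
    and i: "i < k * horizon S"
  shows "linear_form d (\<lambda>\<xi>. vec_index (stack k (horizon S) (z \<xi>)) i)"
proof -
  have k: "0 < k" using i by (cases "k = 0") auto
  have "i div k < horizon S" using i by (simp add: less_mult_imp_div_less mult.commute)
  then show ?thesis using z[of "i div k" "i mod k"] i k by (simp add: stack_def)
qed

end

lemma psd_form_of_linear_forms:
  assumes M: "pos_semidef n M" and z: "\<And>i. i < n \<Longrightarrow> linear_form d (\<lambda>\<xi>. vec_index (z \<xi>) i)"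
    and dim: "\<And>\<xi>. dim_vec (z \<xi>) = n"
  shows "\<exists>L. \<forall>\<xi>. scalar_prod (z \<xi>) (M *\<^sub>v z \<xi>) = (\<Sum>k<n. (\<Sum>i<d. L k i * \<xi> i)\<^sup>2)"
proof -
  have Mc: "M \<in> carrier_mat n n" "transpose_mat M = M"
    and Mp: "\<And>x. x \<in> carrier_vec n \<Longrightarrow> 0 \<le> scalar_prod x (M *\<^sub>v x)"
    using M by (auto simp: pos_semidef_def)
  have "0 \<le> quad n (\<lambda>i j. M $$ (i, j)) x" for x
    using Mp[of "Matrix.vec n x"] by (simp add: scalar_prod_mult_mat_vec[OF Mc(1)])
  then obtain L where L: "\<And>x. quad n (\<lambda>i j. M $$ (i, j)) x = (\<Sum>k<n. (\<Sum>i<n. L k i * x i)\<^sup>2)"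
    using psd_sum_of_squares[of n "\<lambda>i j. M $$ (i, j)"] symmetric_mat_entry[OF Mc] by blast
  have "linear_form d (\<lambda>\<xi>. \<Sum>i<n. L k i * vec_index (z \<xi>) i)" for k
    using z by (intro linear_form_sum linear_form_scale) auto
  then obtain c where c: "\<And>k \<xi>. (\<Sum>i<n. L k i * vec_index (z \<xi>) i) = (\<Sum>i<d. c k i * \<xi> i)"
    unfolding linear_form_def by metis
  have "scalar_prod (z \<xi>) (M *\<^sub>v z \<xi>) = (\<Sum>k<n. (\<Sum>i<d. c k i * \<xi> i)\<^sup>2)" for \<xi>
  proof -
    have "z \<xi> = Matrix.vec n (vec_index (z \<xi>))" using dim[of \<xi>] by (intro eq_vecI) auto
    then have "scalar_prod (z \<xi>) (M *\<^sub>v z \<xi>) = quad n (\<lambda>i j. M $$ (i, j)) (vec_index (z \<xi>))"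
      using scalar_prod_mult_mat_vec[OF Mc(1), of "vec_index (z \<xi>)"] by simp
    then show ?thesis by (simp add: L c)
  qed
  then show ?thesis by blast
qed

lemma sum_lessThan_append:
  fixes f g :: "nat \<Rightarrow> real"
  shows "(\<Sum>k<m + n. if k < m then f k else g (k - m)) = (\<Sum>k<m. f k) + (\<Sum>k<n. g k)"
  by (induction n) simp_all

text \<open>Both weight matrices are factored into squares, and the linear forms for states and
  inputs are substituted. From here on a controller enters only through a finite family of linear
  forms in the noise.\<close>

lemma quadratic_cost_sum_of_squares:
  assumes wf: "well_formed S" and d: "noise_dim S = d"
  obtains L :: "nat \<Rightarrow> nat \<Rightarrow> real" and r where "\<And>\<xi>. quadratic_cost S K \<xi> = (\<Sum>k<r. (\<Sum>i<d. L k i * \<xi> i)\<^sup>2)"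
proof -
  let ?n = "state_dim S * horizon S" and ?m = "input_dim S * horizon S"
  let ?x = "\<lambda>\<xi>. stack (state_dim S) (horizon S) (closed_loop_state S K \<xi>)"
  let ?u = "\<lambda>\<xi>. stack (input_dim S) (horizon S) (closed_loop_input S K \<xi>)"
  have Q: "pos_semidef ?n (Q_mat S)" and R: "pos_semidef ?m (R_mat S)"
    using wf by (auto simp: well_formed_def pos_semidef_def pos_def_def scalar_prod_def
        intro: less_imp_le)
  note state = linear_form_state[OF wf d]
  have "linear_form d (\<lambda>\<xi>. vec_index (?x \<xi>) i)" if "i < ?n" for i
    using that by (intro linear_form_stack[OF wf d] state) auto
  then obtain L1 where L1: "\<And>\<xi>. scalar_prod (?x \<xi>) (Q_mat S *\<^sub>v ?x \<xi>) = (\<Sum>k<?n. (\<Sum>i<d. L1 k i * \<xi> i)\<^sup>2)"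
    using psd_form_of_linear_forms[OF Q, of d ?x] by (auto simp: stack_def)
  have "linear_form d (\<lambda>\<xi>. vec_index (?u \<xi>) i)" if "i < ?m" for i
    using that by (intro linear_form_stack[OF wf d] linear_form_input[OF wf d] state) auto
  then obtain L2 where L2: "\<And>\<xi>. scalar_prod (?u \<xi>) (R_mat S *\<^sub>v ?u \<xi>) = (\<Sum>k<?m. (\<Sum>i<d. L2 k i * \<xi> i)\<^sup>2)"
    using psd_form_of_linear_forms[OF R, of d ?u] by (auto simp: stack_def)
  have "quadratic_cost S K \<xi> = (\<Sum>k<?n + ?m. (\<Sum>i<d. (if k < ?n then L1 k i else L2 (k - ?n) i) * \<xi> i)\<^sup>2)" for \<xi>
  proof -
    have "(\<Sum>i<d. (if k < ?n then L1 k i else L2 (k - ?n) i) * \<xi> i)\<^sup>2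
       = (if k < ?n then (\<Sum>i<d. L1 k i * \<xi> i)\<^sup>2 else (\<Sum>i<d. L2 (k - ?n) i * \<xi> i)\<^sup>2)" for k
      by simp
    then show ?thesis
      using sum_lessThan_append[of ?n "\<lambda>k. (\<Sum>i<d. L1 k i * \<xi> i)\<^sup>2" "\<lambda>k. (\<Sum>i<d. L2 k i * \<xi> i)\<^sup>2" ?m]
      by (simp only: quadratic_cost_def Let_def L1 L2)
  qed
  then show thesis by (rule that)
qed

section \<open>Suboptimality of the robust controller\<close>

definition sum_sq :: "nat \<Rightarrow> nat \<Rightarrow> (nat \<Rightarrow> nat \<Rightarrow> real) \<Rightarrow> (nat \<Rightarrow> real) \<Rightarrow> real" where
  "sum_sq d r L \<xi> = (\<Sum>k<r. (\<Sum>i<d. L k i * \<xi> i)\<^sup>2)"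

text \<open>The squared Frobenius norm of \<open>L\<close>, that is, the trace of the matrix of the
  quadratic form \<open>sum_sq\<close>.\<close>

definition weight_sq :: "nat \<Rightarrow> nat \<Rightarrow> (nat \<Rightarrow> nat \<Rightarrow> real) \<Rightarrow> real" where
  "weight_sq d r L = (\<Sum>k<r. \<Sum>i<d. (L k i)\<^sup>2)"

lemma sum_sq_nonneg [simp]: "0 \<le> sum_sq d r L \<xi>"
  by (simp add: sum_sq_def sum_nonneg)

lemma weight_sq_nonneg [simp]: "0 \<le> weight_sq d r L"
  by (simp add: weight_sq_def sum_nonneg)

lemma euclid_norm_sq: "(euclid_norm d x)\<^sup>2 = (\<Sum>i<d. (x i)\<^sup>2)"
  by (simp add: euclid_norm_def L2_set_def sum_nonneg)

lemma sum_sq_le: "sum_sq d r L \<xi> \<le> weight_sq d r L * (euclid_norm d \<xi>)\<^sup>2"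
proof -
  have "(\<Sum>i<d. L k i * \<xi> i)\<^sup>2 \<le> (\<Sum>i<d. (L k i)\<^sup>2) * (\<Sum>i<d. (\<xi> i)\<^sup>2)" for k
    by (rule Cauchy_Schwarz_ineq_sum)
  then show ?thesis
    unfolding sum_sq_def weight_sq_def euclid_norm_sq sum_distrib_right by (intro sum_mono) auto
qed

lemma two_mult_le_weighted:
  fixes a c t :: real
  assumes "0 < t"
  shows "\<bar>2 * a * c\<bar> \<le> t * a\<^sup>2 + c\<^sup>2 / t"
proof -
  have "0 \<le> (t * a - c)\<^sup>2 / t" "0 \<le> (t * a + c)\<^sup>2 / t" using assms by auto
  moreover have "(t * a - c)\<^sup>2 / t = t * a\<^sup>2 + c\<^sup>2 / t - 2 * a * c" "(t * a + c)\<^sup>2 / t = t * a\<^sup>2 + c\<^sup>2 / t + 2 * a * c"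
    using assms by (auto simp: field_simps power2_eq_square)
  ultimately show ?thesis by linarith
qed

text \<open>A pointwise substitute for the triangle inequality in L2, with the parameter
  \<open>t\<close> left free. Both parts charge the cross term to \<open>\<xi>\<close>, because
  later it is the law of \<open>\<xi>\<close> that comes with a bound on second moments. In the
  second part the square of the difference has a favourable sign and is dropped.\<close>

lemma sum_sq_young:
  assumes t: "0 < t"
  shows "sum_sq d r L \<eta> \<le> (1 + t) * sum_sq d r L \<xi> + (1 + 1 / t) * sum_sq d r L (\<lambda>i. \<xi> i - \<eta> i)"
    and "sum_sq d r L \<xi> \<le> sum_sq d r L \<eta> + t * sum_sq d r L \<xi> + 1 / t * sum_sq d r L (\<lambda>i. \<xi> i - \<eta> i)"
proof -
  define a where "a k = (\<Sum>i<d. L k i * \<xi> i)" for k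
  define b where "b k = (\<Sum>i<d. L k i * \<eta> i)" for k
  have c: "(\<Sum>i<d. L k i * (\<xi> i - \<eta> i)) = a k - b k" for k
    by (simp add: a_def b_def sum_subtractf algebra_simps)
  have y: "\<bar>2 * a k * (a k - b k)\<bar> \<le> t * (a k)\<^sup>2 + 1 / t * (a k - b k)\<^sup>2" for k
    using two_mult_le_weighted[OF t, of "a k" "a k - b k"] by simp
  have 1: "(b k)\<^sup>2 = (a k)\<^sup>2 - 2 * a k * (a k - b k) + (a k - b k)\<^sup>2" for k
    by (simp add: power2_eq_square algebra_simps)
  have "(b k)\<^sup>2 \<le> (1 + t) * (a k)\<^sup>2 + (1 + 1 / t) * (a k - b k)\<^sup>2" for k
    using y[of k] 1[of k] by (simp add: algebra_simps)
  then show "sum_sq d r L \<eta> \<le> (1 + t) * sum_sq d r L \<xi> + (1 + 1 / t) * sum_sq d r L (\<lambda>i. \<xi> i - \<eta> i)"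
    unfolding sum_sq_def c a_def[symmetric] b_def[symmetric] sum_distrib_left sum.distrib[symmetric]
    by (intro sum_mono)
  have "(a k)\<^sup>2 \<le> (b k)\<^sup>2 + t * (a k)\<^sup>2 + 1 / t * (a k - b k)\<^sup>2" for k
    using y[of k] 1[of k] zero_le_power2[of "a k - b k"] by linarith
  then show "sum_sq d r L \<xi> \<le> sum_sq d r L \<eta> + t * sum_sq d r L \<xi> + 1 / t * sum_sq d r L (\<lambda>i. \<xi> i - \<eta> i)"
    unfolding sum_sq_def c a_def[symmetric] b_def[symmetric] sum_distrib_left sum.distrib[symmetric]
    by (intro sum_mono)
qed

lemma coordinate_measurable [measurable]:
  "i < d \<Longrightarrow> sets P = sets (Rd d) \<Longrightarrow> (\<lambda>\<xi>. \<xi> i) \<in> borel_measurable P"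
  by (subst measurable_cong_sets[OF _ refl, of P "Rd d"]) auto

lemma sum_sq_measurable [measurable]:
  assumes "sets P = sets (Rd d)"
  shows "sum_sq d r L \<in> borel_measurable P"
  unfolding sum_sq_def using assms
  by (intro borel_measurable_sum borel_measurable_power borel_measurable_times borel_measurable_const coordinate_measurable) auto

lemma sum_sq_diff_measurable [measurable]:
  "(\<lambda>(\<xi>, \<eta>). sum_sq d r L (\<lambda>i. \<xi> i - \<eta> i)) \<in> borel_measurable (Rd d \<Otimes>\<^sub>M Rd d)"
  unfolding sum_sq_def split_def by measurable

lemma euclid_norm_diff_measurable [measurable]:
  "(\<lambda>(\<xi>, \<eta>). euclid_norm d (\<lambda>i. \<xi> i - \<eta> i)) \<in> borel_measurable (Rd d \<Otimes>\<^sub>M Rd d)"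
  unfolding euclid_norm_def L2_set_def split_def by measurable

text \<open>An infimum over couplings yields a coupling only up to some slack, hence
  \<open>\<rho> < r\<close>. The slack is removed afterwards by a limit.\<close>

lemma wasserstein2_leD:
  assumes "wasserstein2 d P P' \<le> ennreal \<rho>" "0 \<le> \<rho>" "\<rho> < r"
  obtains \<pi> where "\<pi> \<in> couplings d P P'"
    "(\<integral>\<^sup>+ (\<xi>, \<eta>). ennreal ((euclid_norm d (\<lambda>i. \<xi> i - \<eta> i))\<^sup>2) \<partial>\<pi>) \<le> ennreal (r\<^sup>2)"
proof -
  let ?I = "INF \<pi> \<in> couplings d P P'. \<integral>\<^sup>+ (\<xi>, \<eta>). ennreal ((euclid_norm d (\<lambda>i. \<xi> i - \<eta> i))\<^sup>2) \<partial>\<pi>"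
  have le: "ennreal_sqrt ?I \<le> ennreal \<rho>" using assms(1) by (simp add: wasserstein2_def)
  have "?I \<noteq> \<infinity>"
  proof
    assume "?I = \<infinity>"
    then show False using le by (simp only: ennreal_sqrt_def) (simp add: top_unique)
  qed
  then obtain c where c: "?I = ennreal c" "0 \<le> c" by (cases ?I) auto
  have "sqrt c \<le> \<rho>" using le c assms(2) by (simp add: ennreal_sqrt_def)
  then have "c \<le> \<rho>\<^sup>2" using c(2) assms(2) by (metis real_sqrt_le_iff real_sqrt_unique)
  also have "\<dots> < r\<^sup>2" using assms(2,3) by (intro power_strict_mono) auto
  finally have "?I < ennreal (r\<^sup>2)" using c by (auto simp: ennreal_less_iff)
  then show thesis using that by (auto simp: INF_less_iff intro: less_imp_le)
qed

text \<open>Lets the slack tend to zero in an inequality between extended reals in which only a real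
  error term depends on it.\<close>

lemma ennreal_le_limit:
  fixes F :: "real \<Rightarrow> real"
  assumes F: "isCont F 0" "0 \<le> F 0" and le: "\<And>\<delta>. 0 < \<delta> \<Longrightarrow> X \<le> Y + ennreal (F \<delta>)"
  shows "X \<le> Y + ennreal (F 0)"
proof (rule ennreal_le_epsilon)
  fix e :: real assume e: "0 < e"
  have "\<forall>\<^sub>F x in at 0. F x < F 0 + e"
    using F(1) e by (intro order_tendstoD(2)[of F "F 0"]) (auto simp: isCont_def)
  then obtain h where h: "0 < h" "\<And>x. x \<noteq> 0 \<Longrightarrow> dist x 0 < h \<Longrightarrow> F x < F 0 + e"
    by (auto simp: eventually_at)
  have "F (h / 2) \<le> F 0 + e" using h(1) h(2)[of "h / 2"] by simp
  then have F2: "ennreal (F (h / 2)) \<le> ennreal (F 0 + e)" by (rule ennreal_leI)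
  have "X \<le> Y + ennreal (F (h / 2))" using le[of "h / 2"] h(1) by simp
  also have "\<dots> \<le> Y + ennreal (F 0 + e)" by (intro add_left_mono F2)
  also have "\<dots> = Y + ennreal (F 0) + ennreal e"
    using F(2) e by (simp add: ennreal_plus add.assoc)
  finally show "X \<le> Y + ennreal (F 0) + ennreal e" .
qed

lemma wasserstein2_sum_sq:
  assumes W: "wasserstein2 d P P' \<le> ennreal \<rho>" and \<rho>: "0 \<le> \<rho>" and \<beta>: "0 \<le> \<beta>"
    and q: "(\<integral>\<^sup>+\<xi>. ennreal (sum_sq d r L \<xi>) \<partial>P) \<le> ennreal (\<beta>\<^sup>2 * weight_sq d r L)"
  shows "(\<integral>\<^sup>+\<xi>. ennreal (sum_sq d r L \<xi>) \<partial>P')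
      \<le> (\<integral>\<^sup>+\<xi>. ennreal (sum_sq d r L \<xi>) \<partial>P) + ennreal ((2 * \<beta> * \<rho> + \<rho>\<^sup>2) * weight_sq d r L)" (is ?A)
    and "(\<integral>\<^sup>+\<xi>. ennreal (sum_sq d r L \<xi>) \<partial>P)
      \<le> (\<integral>\<^sup>+\<xi>. ennreal (sum_sq d r L \<xi>) \<partial>P') + ennreal (2 * \<beta> * \<rho> * weight_sq d r L)" (is ?B)
proof -
  let ?T = "weight_sq d r L" and ?q = "sum_sq d r L"
  let ?D = "\<lambda>(\<xi>, \<eta>). ?q (\<lambda>i. \<xi> i - \<eta> i)"
  have *: "(\<integral>\<^sup>+\<xi>. ennreal (?q \<xi>) \<partial>P')
      \<le> (\<integral>\<^sup>+\<xi>. ennreal (?q \<xi>) \<partial>P) + ennreal ((2 * (\<beta> + \<delta>) * (\<rho> + \<delta>) + (\<rho> + \<delta>)\<^sup>2) * ?T)"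
    "(\<integral>\<^sup>+\<xi>. ennreal (?q \<xi>) \<partial>P)
      \<le> (\<integral>\<^sup>+\<xi>. ennreal (?q \<xi>) \<partial>P') + ennreal (2 * (\<beta> + \<delta>) * (\<rho> + \<delta>) * ?T)"
    if \<delta>: "0 < \<delta>" for \<delta>
  proof -
    define s where "s = \<rho> + \<delta>"
    define b where "b = \<beta> + \<delta>"
    \<comment> \<open>The parameter that balances Young's inequality: both
      \<open>t * b\<^sup>2\<close> and \<open>s\<^sup>2 / t\<close> become \<open>b * s\<close>. The
      slack in \<open>b\<close> keeps the quotient meaningful when
      \<open>\<beta> = 0\<close>.\<close>
    define t where "t = s / b"
    have pos: "0 < s" "0 < b" "0 < t" using \<rho> \<beta> \<delta> by (auto simp: s_def b_def t_def)
    obtain \<pi> where \<pi>: "\<pi> \<in> couplings d P P'"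
      and cost: "(\<integral>\<^sup>+ (\<xi>, \<eta>). ennreal ((euclid_norm d (\<lambda>i. \<xi> i - \<eta> i))\<^sup>2) \<partial>\<pi>) \<le> ennreal (s\<^sup>2)"
      using wasserstein2_leD[OF W \<rho>, of s] \<delta> by (auto simp: s_def)
    have sets\<pi>[measurable_cong]: "sets \<pi> = sets (Rd d \<Otimes>\<^sub>M Rd d)"
      and mP: "distr \<pi> (Rd d) fst = P" and mP': "distr \<pi> (Rd d) snd = P'"
      using \<pi> by (auto simp: couplings_def)
    have qm[measurable]: "?q \<in> borel_measurable (Rd d)" by (rule sum_sq_measurable) simp
    have fst: "(\<integral>\<^sup>+\<xi>. ennreal (?q \<xi>) \<partial>P) = (\<integral>\<^sup>+x. ennreal (?q (fst x)) \<partial>\<pi>)"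
      unfolding mP[symmetric] by (subst nn_integral_distr) auto
    have snd: "(\<integral>\<^sup>+\<xi>. ennreal (?q \<xi>) \<partial>P') = (\<integral>\<^sup>+x. ennreal (?q (snd x)) \<partial>\<pi>)"
      unfolding mP'[symmetric] by (subst nn_integral_distr) auto
    have "(\<integral>\<^sup>+x. ennreal (?D x) \<partial>\<pi>) \<le> (\<integral>\<^sup>+x. ennreal ?T * (case x of (\<xi>, \<eta>) \<Rightarrow> ennreal ((euclid_norm d (\<lambda>i. \<xi> i - \<eta> i))\<^sup>2)) \<partial>\<pi>)"
      using sum_sq_le[of d r L] by (intro nn_integral_mono) (auto simp: ennreal_mult[symmetric] split_def intro!: ennreal_leI)
    also have "\<dots> = ennreal ?T * (\<integral>\<^sup>+x. (case x of (\<xi>, \<eta>) \<Rightarrow> ennreal ((euclid_norm d (\<lambda>i. \<xi> i - \<eta> i))\<^sup>2)) \<partial>\<pi>)"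
      by (rule nn_integral_cmult) (simp add: split_def, measurable)
    also have "\<dots> \<le> ennreal ?T * ennreal (s\<^sup>2)" using cost by (intro mult_left_mono) auto
    finally have D: "(\<integral>\<^sup>+x. ennreal (?D x) \<partial>\<pi>) \<le> ennreal (s\<^sup>2 * ?T)"
      by (simp add: ennreal_mult[symmetric] mult.commute)
    have Dm[measurable]: "(\<lambda>x. ennreal (?D x)) \<in> borel_measurable \<pi>" by measurable
    have tq: "ennreal t * (\<integral>\<^sup>+\<xi>. ennreal (?q \<xi>) \<partial>P) \<le> ennreal (b * s * ?T)"
    proof -
      have "ennreal t * (\<integral>\<^sup>+\<xi>. ennreal (?q \<xi>) \<partial>P) \<le> ennreal t * ennreal (\<beta>\<^sup>2 * ?T)"
        using q by (intro mult_left_mono) auto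
      also have "\<dots> \<le> ennreal t * ennreal (b\<^sup>2 * ?T)"
        using \<beta> \<delta> by (intro mult_left_mono ennreal_leI mult_right_mono power_mono) (auto simp: b_def)
      also have "\<dots> = ennreal (b * s * ?T)"
        using pos by (simp add: ennreal_mult[symmetric] t_def power2_eq_square)
      finally show ?thesis .
    qed
    have tD: "ennreal (1 / t) * (\<integral>\<^sup>+x. ennreal (?D x) \<partial>\<pi>) \<le> ennreal (b * s * ?T)"
    proof -
      have "ennreal (1 / t) * (\<integral>\<^sup>+x. ennreal (?D x) \<partial>\<pi>) \<le> ennreal (1 / t) * ennreal (s\<^sup>2 * ?T)"
        using D by (intro mult_left_mono) auto
      also have "\<dots> = ennreal (b * s * ?T)"
        using pos by (simp add: ennreal_mult[symmetric] t_def power2_eq_square)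
      finally show ?thesis .
    qed
    have "(\<integral>\<^sup>+\<xi>. ennreal (?q \<xi>) \<partial>P') \<le> (\<integral>\<^sup>+x. (ennreal (?q (fst x)) + ennreal t * ennreal (?q (fst x)))
        + (ennreal (?D x) + ennreal (1 / t) * ennreal (?D x)) \<partial>\<pi>)"
      unfolding snd
    proof (intro nn_integral_mono)
      fix x :: "(nat \<Rightarrow> real) \<times> (nat \<Rightarrow> real)"
      have "?q (snd x) \<le> (?q (fst x) + t * ?q (fst x)) + (?D x + 1 / t * ?D x)"
        using sum_sq_young(1)[OF pos(3), of d r L "snd x" "fst x"] by (simp add: split_def algebra_simps)
      then show "ennreal (?q (snd x)) \<le> (ennreal (?q (fst x)) + ennreal t * ennreal (?q (fst x)))
        + (ennreal (?D x) + ennreal (1 / t) * ennreal (?D x))"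
        using pos by (simp add: ennreal_mult[symmetric] ennreal_plus[symmetric] split_def del: ennreal_plus)
    qed
    also have "\<dots> = ((\<integral>\<^sup>+\<xi>. ennreal (?q \<xi>) \<partial>P) + ennreal t * (\<integral>\<^sup>+\<xi>. ennreal (?q \<xi>) \<partial>P))
        + ((\<integral>\<^sup>+x. ennreal (?D x) \<partial>\<pi>) + ennreal (1 / t) * (\<integral>\<^sup>+x. ennreal (?D x) \<partial>\<pi>))"
      unfolding fst by (simp add: nn_integral_add nn_integral_cmult)
    also have "\<dots> \<le> ((\<integral>\<^sup>+\<xi>. ennreal (?q \<xi>) \<partial>P) + ennreal (b * s * ?T)) + (ennreal (s\<^sup>2 * ?T) + ennreal (b * s * ?T))"
      using tq tD D by (intro add_mono) auto
    also have "\<dots> = (\<integral>\<^sup>+\<xi>. ennreal (?q \<xi>) \<partial>P) + ennreal ((2 * b * s + s\<^sup>2) * ?T)"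
    proof -
      have "ennreal (b * s * ?T) + (ennreal (s\<^sup>2 * ?T) + ennreal (b * s * ?T)) = ennreal ((2 * b * s + s\<^sup>2) * ?T)"
        using pos by (simp add: ennreal_plus[symmetric] algebra_simps del: ennreal_plus)
      then show ?thesis by (simp only: add.assoc)
    qed
    finally show "(\<integral>\<^sup>+\<xi>. ennreal (?q \<xi>) \<partial>P')
      \<le> (\<integral>\<^sup>+\<xi>. ennreal (?q \<xi>) \<partial>P) + ennreal ((2 * (\<beta> + \<delta>) * (\<rho> + \<delta>) + (\<rho> + \<delta>)\<^sup>2) * ?T)"
      by (simp add: b_def s_def)
    have "(\<integral>\<^sup>+\<xi>. ennreal (?q \<xi>) \<partial>P) \<le> (\<integral>\<^sup>+x. (ennreal (?q (snd x)) + ennreal t * ennreal (?q (fst x)))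
        + ennreal (1 / t) * ennreal (?D x) \<partial>\<pi>)"
      unfolding fst
    proof (intro nn_integral_mono)
      fix x :: "(nat \<Rightarrow> real) \<times> (nat \<Rightarrow> real)"
      have "?q (fst x) \<le> (?q (snd x) + t * ?q (fst x)) + 1 / t * ?D x"
        using sum_sq_young(2)[OF pos(3), of d r L "fst x" "snd x"] by (simp add: split_def algebra_simps)
      then show "ennreal (?q (fst x)) \<le> (ennreal (?q (snd x)) + ennreal t * ennreal (?q (fst x)))
        + ennreal (1 / t) * ennreal (?D x)"
        using pos by (simp add: ennreal_mult[symmetric] ennreal_plus[symmetric] split_def del: ennreal_plus)
    qed
    also have "\<dots> = ((\<integral>\<^sup>+\<xi>. ennreal (?q \<xi>) \<partial>P') + ennreal t * (\<integral>\<^sup>+\<xi>. ennreal (?q \<xi>) \<partial>P))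
        + ennreal (1 / t) * (\<integral>\<^sup>+x. ennreal (?D x) \<partial>\<pi>)"
      unfolding fst snd by (simp add: nn_integral_add nn_integral_cmult)
    also have "\<dots> \<le> ((\<integral>\<^sup>+\<xi>. ennreal (?q \<xi>) \<partial>P') + ennreal (b * s * ?T)) + ennreal (b * s * ?T)"
      using tq tD by (intro add_mono) auto
    also have "\<dots> = (\<integral>\<^sup>+\<xi>. ennreal (?q \<xi>) \<partial>P') + ennreal (2 * b * s * ?T)"
    proof -
      have "ennreal (b * s * ?T) + ennreal (b * s * ?T) = ennreal (2 * b * s * ?T)"
        using pos by (simp add: ennreal_plus[symmetric] algebra_simps del: ennreal_plus)
      then show ?thesis by (simp only: add.assoc)
    qed
    finally show "(\<integral>\<^sup>+\<xi>. ennreal (?q \<xi>) \<partial>P)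
      \<le> (\<integral>\<^sup>+\<xi>. ennreal (?q \<xi>) \<partial>P') + ennreal (2 * (\<beta> + \<delta>) * (\<rho> + \<delta>) * ?T)"
      by (simp add: b_def s_def)
  qed
  have "0 \<le> (2 * (\<beta> + 0) * (\<rho> + 0) + (\<rho> + 0)\<^sup>2) * ?T" "0 \<le> 2 * (\<beta> + 0) * (\<rho> + 0) * ?T"
    using \<beta> \<rho> by auto
  then show ?A ?B
    using ennreal_le_limit[of "\<lambda>\<delta>. (2 * (\<beta> + \<delta>) * (\<rho> + \<delta>) + (\<rho> + \<delta>)\<^sup>2) * ?T", OF _ _ *(1)]
      ennreal_le_limit[of "\<lambda>\<delta>. 2 * (\<beta> + \<delta>) * (\<rho> + \<delta>) * ?T", OF _ _ *(2)]
    by (auto intro!: continuous_intros)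
qed

lemma covariance_symmetric:
  "covariance d P \<in> carrier_mat d d" "transpose_mat (covariance d P) = covariance d P"
  by (auto simp: covariance_def intro!: eq_matI) (simp add: mult.commute)

lemma nn_integral_sum_sq:
  assumes P: "P \<in> zero_mean_laws d"
    and int: "\<And>i j. i < d \<Longrightarrow> j < d \<Longrightarrow> integrable P (\<lambda>\<xi>. \<xi> i * \<xi> j)"
  shows "(\<integral>\<^sup>+\<xi>. ennreal (sum_sq d r L \<xi>) \<partial>P)
    = ennreal (\<Sum>k<r. quad d (\<lambda>i j. covariance d P $$ (i, j)) (L k))"
proof -
  have cov: "covariance d P $$ (i, j) = (LINT \<xi>|P. \<xi> i * \<xi> j)" if "i < d" "j < d" for i j
    using that P by (simp add: covariance_def zero_mean_laws_def)
  have sq: "sum_sq d r L \<xi> = (\<Sum>k<r. \<Sum>i<d. \<Sum>j<d. L k i * L k j * (\<xi> i * \<xi> j))" for \<xi>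
    by (simp add: sum_sq_def power2_eq_square sum_product mult_ac)
  have "has_bochner_integral P (sum_sq d r L) (\<Sum>k<r. \<Sum>i<d. \<Sum>j<d. L k i * L k j * (LINT \<xi>|P. \<xi> i * \<xi> j))"
    unfolding sq
    by (intro has_bochner_integral_sum has_bochner_integral_mult_right has_bochner_integral_integrable int) auto
  then have "(\<integral>\<^sup>+\<xi>. ennreal (sum_sq d r L \<xi>) \<partial>P)
      = ennreal (\<Sum>k<r. \<Sum>i<d. \<Sum>j<d. L k i * L k j * (LINT \<xi>|P. \<xi> i * \<xi> j))"
    by (subst nn_integral_eq_integral) (auto simp: has_bochner_integral_iff)
  also have "\<dots> = (\<Sum>k<r. quad d (\<lambda>i j. covariance d P $$ (i, j)) (L k))"
    by (auto simp: quad_def cov mult_ac intro!: sum.cong)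
  finally show ?thesis .
qed

lemma radius_square:
  assumes "0 \<le> \<epsilon> / (2 * \<alpha>\<^sup>2)"
  shows "2 * \<beta> * radius \<alpha> \<beta> \<epsilon> + (radius \<alpha> \<beta> \<epsilon>)\<^sup>2 = \<epsilon> / (2 * \<alpha>\<^sup>2)"
proof -
  have "(radius \<alpha> \<beta> \<epsilon> + \<beta>)\<^sup>2 = \<beta>\<^sup>2 + \<epsilon> / (2 * \<alpha>\<^sup>2)" using assms by (simp add: radius_def)
  then show ?thesis by (simp add: power2_eq_square algebra_simps)
qed

lemma radius_pos:
  assumes "0 < \<epsilon> / (2 * \<alpha>\<^sup>2)"
  shows "0 < radius \<alpha> \<beta> \<epsilon>"
proof -
  have "\<beta> \<le> sqrt (\<beta>\<^sup>2)" by simp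
  also have "\<dots> < sqrt (\<beta>\<^sup>2 + \<epsilon> / (2 * \<alpha>\<^sup>2))" using assms by (intro real_sqrt_less_mono) simp
  finally show ?thesis by (simp add: radius_def)
qed

text \<open>Only the oracle's cost is expanded into squares, and it is bounded uniformly over the
  ball, with a detour from \<open>P'\<close> through the centre \<open>Q\<close> to
  \<open>P\<close>. Optimality of \<open>Kdr\<close> compares worst cases, and as \<open>P\<close>
  lies in the ball, the worst case of \<open>Kdr\<close> dominates its cost under
  \<open>P\<close>.\<close>

lemma dr_controller_suboptimality:
  assumes wf: "well_formed S" "noise_dim S = d" and d: "0 < d"
    and P: "P \<in> zero_mean_laws d" "pos_def d (covariance d P)"
    and intP: "\<And>i j. i < d \<Longrightarrow> j < d \<Longrightarrow> integrable P (\<lambda>\<xi>. \<xi> i * \<xi> j)"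
    and Q: "Q \<in> zero_mean_laws d"
    and intQ: "\<And>i j. i < d \<Longrightarrow> j < d \<Longrightarrow> integrable Q (\<lambda>\<xi>. \<xi> i * \<xi> j)"
    and \<epsilon>: "0 < \<epsilon>"
    and \<rho>: "\<rho> = radius (alpha_star d P) (sqrt (lambda_max (covariance d Q))) \<epsilon>"
    and W: "wasserstein2 d Q P \<le> ennreal \<rho>"
    and opt: "oracle_controller S P Kstar" "dr_controller S \<rho> Q Kdr"
  shows "expected_cost S Kdr P \<le> expected_cost S Kstar P * ennreal (1 + \<epsilon>)"
proof -
  define lam where "lam = lambda_min (covariance d P)"
  define \<beta> where "\<beta> = sqrt (lambda_max (covariance d Q))"
  have lam: "0 < lam" unfolding lam_def using P(2) d by (rule lambda_min_pos)
  have al: "(alpha_star d P)\<^sup>2 = 1 / lam"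
    using lam by (simp add: alpha_star_def lam_def[symmetric] power2_eq_square powr_add[symmetric] powr_minus_divide)
  have eps: "\<epsilon> / (2 * (alpha_star d P)\<^sup>2) = \<epsilon> * lam / 2" by (simp add: al)
  have \<rho>0: "0 < \<rho>" unfolding \<rho> using \<epsilon> lam by (intro radius_pos) (simp add: eps)
  have \<rho>2: "2 * \<beta> * \<rho> + \<rho>\<^sup>2 = \<epsilon> * lam / 2"
    unfolding \<rho> \<beta>_def eps[symmetric] using \<epsilon> by (intro radius_square) simp
  obtain r L where L: "\<And>\<xi>. quadratic_cost S Kstar \<xi> = sum_sq d r L \<xi>"
    using quadratic_cost_sum_of_squares[OF wf] unfolding sum_sq_def by metis
  let ?T = "weight_sq d r L" and ?J = "\<lambda>P'. \<integral>\<^sup>+\<xi>. ennreal (sum_sq d r L \<xi>) \<partial>P'"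
  have J: "expected_cost S Kstar P' = ?J P'" for P' by (simp add: expected_cost_def L)
  \<comment> \<open>Tested on the first basis vector, where the form is a second moment. The sign is
    what makes \<open>\<beta>\<^sup>2\<close> equal to
    \<open>lambda_max (covariance d Q)\<close>.\<close>
  have lmax: "0 \<le> lambda_max (covariance d Q)"
  proof -
    let ?e = "\<lambda>k i. if i = (0::nat) then 1 else (0::real)"
    have e: "(\<Sum>i<d. (?e 0 i)\<^sup>2) = 1"
      using d by (auto simp: if_distrib[of "\<lambda>x. x\<^sup>2"] cong: if_cong)
    have "0 \<le> LINT \<xi>|Q. \<xi> 0 * \<xi> 0" by (rule Bochner_Integration.integral_nonneg) simp
    also have "\<dots> = quad d (\<lambda>i j. covariance d Q $$ (i, j)) (?e 0)"
    proof -
      have "quad d (\<lambda>i j. covariance d Q $$ (i, j)) (?e 0) = (\<Sum>i<d. if i = 0 then covariance d Q $$ (0, 0) else 0)"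
        unfolding quad_def
      proof (intro sum.cong refl)
        fix i
        have "covariance d Q $$ (i, j) * ?e 0 i * ?e 0 j
            = (if j = 0 then if i = 0 then covariance d Q $$ (0, 0) else 0 else 0)" for j
          by simp
        then show "(\<Sum>j<d. covariance d Q $$ (i, j) * ?e 0 i * ?e 0 j) = (if i = 0 then covariance d Q $$ (0, 0) else 0)"
          using d by (simp only: sum.delta finite_lessThan lessThan_iff if_True)
      qed
      then show ?thesis using d Q by (simp add: covariance_def zero_mean_laws_def)
    qed
    also have "\<dots> \<le> lambda_max (covariance d Q) * (\<Sum>i<d. (?e 0 i)\<^sup>2)"
      by (rule le_lambda_max[OF covariance_symmetric d])
    finally show ?thesis by (simp add: e)
  qed
  then have \<beta>: "0 \<le> \<beta>" "\<beta>\<^sup>2 = lambda_max (covariance d Q)" by (auto simp: \<beta>_def)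
  have "(\<Sum>k<r. quad d (\<lambda>i j. covariance d Q $$ (i, j)) (L k)) \<le> \<beta>\<^sup>2 * ?T"
    unfolding \<beta> weight_sq_def sum_distrib_left
    by (intro sum_mono) (simp add: sum_distrib_left[symmetric] le_lambda_max[OF covariance_symmetric d])
  then have JQ: "?J Q \<le> ennreal (\<beta>\<^sup>2 * ?T)"
    by (subst nn_integral_sum_sq[OF Q intQ]) (auto intro: ennreal_leI)
  have "lam * ?T \<le> (\<Sum>k<r. quad d (\<lambda>i j. covariance d P $$ (i, j)) (L k))"
    unfolding lam_def weight_sq_def sum_distrib_left
    by (intro sum_mono) (simp add: sum_distrib_left[symmetric] lambda_min_le[OF covariance_symmetric d])
  then have JP: "ennreal (lam * ?T) \<le> ?J P"
    by (subst nn_integral_sum_sq[OF P(1) intP]) (auto intro: ennreal_leI)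
  have bound: "?J P' \<le> ?J P * ennreal (1 + \<epsilon>)" if P': "P' \<in> wasserstein_ball d \<rho> Q" for P'
  proof -
    have W': "wasserstein2 d Q P' \<le> ennreal \<rho>" using P' by (simp add: wasserstein_ball_def)
    have "?J P' \<le> ?J Q + ennreal ((2 * \<beta> * \<rho> + \<rho>\<^sup>2) * ?T)"
      by (rule wasserstein2_sum_sq(1)[OF W' _ \<beta>(1) JQ]) (use \<rho>0 in simp)
    also have "\<dots> \<le> (?J P + ennreal (2 * \<beta> * \<rho> * ?T)) + ennreal ((2 * \<beta> * \<rho> + \<rho>\<^sup>2) * ?T)"
      by (intro add_right_mono wasserstein2_sum_sq(2)[OF W _ \<beta>(1) JQ]) (use \<rho>0 in simp)
    \<comment> \<open>Each of the two comparisons is charged half of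
      \<open>\<epsilon> * lam\<close>; the one without \<open>\<rho>\<^sup>2\<close> is enlarged to
      the same size.\<close>
    also have "\<dots> \<le> (?J P + ennreal (\<epsilon> * lam / 2 * ?T)) + ennreal (\<epsilon> * lam / 2 * ?T)"
      unfolding \<rho>2[symmetric] using \<rho>0 by (intro add_mono order_refl ennreal_leI mult_right_mono) auto
    also have "\<dots> = ?J P + ennreal \<epsilon> * ennreal (lam * ?T)"
      using \<epsilon> lam by (simp add: add.assoc ennreal_plus[symmetric] ennreal_mult[symmetric] del: ennreal_plus)
    also have "\<dots> \<le> ?J P + ennreal \<epsilon> * ?J P"
      by (intro add_left_mono mult_left_mono JP) simp
    also have "\<dots> = ?J P * ennreal (1 + \<epsilon>)"
      using \<epsilon> by (simp add: ennreal_plus distrib_left distrib_right mult.commute)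
    finally show ?thesis .
  qed
  have "P \<in> wasserstein_ball d \<rho> Q" using P W by (simp add: wasserstein_ball_def)
  then have "expected_cost S Kdr P \<le> (SUP P' \<in> wasserstein_ball (noise_dim S) \<rho> Q. expected_cost S Kdr P')"
    unfolding wf(2) by (rule SUP_upper)
  also have "\<dots> \<le> (SUP P' \<in> wasserstein_ball (noise_dim S) \<rho> Q. expected_cost S Kstar P')"
    using opt by (auto simp: oracle_controller_def dr_controller_def is_arg_min_def not_less)
  also have "\<dots> \<le> expected_cost S Kstar P * ennreal (1 + \<epsilon>)"
    unfolding wf(2) J by (rule SUP_least) (rule bound)
  finally show ?thesis .
qed

section \<open>Transport between a law and a sample\<close>

lemma sets_fibre:
  assumes "g \<in> measurable M (count_space I)" "i \<in> I"
  shows "{x\<in>space M. g x = i} \<in> sets M"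
proof -
  have "g -` {i} \<inter> space M \<in> sets M"
    by (rule measurable_sets[OF assms(1)]) (use assms(2) in simp)
  moreover have "{x\<in>space M. g x = i} = g -` {i} \<inter> space M" by auto
  ultimately show ?thesis by (simp only:)
qed

lemma nn_integral_finite_range:
  assumes g: "g \<in> measurable M (count_space I)" and I: "finite I"
  shows "(\<integral>\<^sup>+x. f (g x) \<partial>M) = (\<Sum>i\<in>I. f i * emeasure M {x\<in>space M. g x = i})"
proof -
  have fibre: "{x\<in>space M. g x = i} \<in> sets M" if "i \<in> I" for i
    using sets_fibre[OF g that] .
  have "(\<integral>\<^sup>+x. f (g x) \<partial>M) = (\<integral>\<^sup>+x. (\<Sum>i\<in>I. f i * indicator {x\<in>space M. g x = i} x) \<partial>M)"
  proof (rule nn_integral_cong)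
    fix x assume x: "x \<in> space M"
    then have "g x \<in> I" using measurable_space[OF g] by simp
    moreover have "(\<Sum>i\<in>I. f i * indicator {x\<in>space M. g x = i} x) = (\<Sum>i\<in>I. if g x = i then f i else 0)"
      using x by (intro sum.cong) (auto simp: indicator_def)
    ultimately show "f (g x) = (\<Sum>i\<in>I. f i * indicator {x\<in>space M. g x = i} x)"
      using I by (simp only: sum.delta' if_True)
  qed
  also have "\<dots> = (\<Sum>i\<in>I. f i * emeasure M {x\<in>space M. g x = i})"
  proof -
    have "(\<integral>\<^sup>+x. (\<Sum>i\<in>I. f i * indicator {x\<in>space M. g x = i} x) \<partial>M)
        = (\<Sum>i\<in>I. \<integral>\<^sup>+x. f i * indicator {x\<in>space M. g x = i} x \<partial>M)"
      by (rule nn_integral_sum) (intro borel_measurable_times_ennreal borel_measurable_const borel_measurable_indicator fibre)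
    also have "\<dots> = (\<Sum>i\<in>I. f i * emeasure M {x\<in>space M. g x = i})"
      by (intro sum.cong refl nn_integral_cmult_indicator fibre)
    finally show ?thesis .
  qed
  finally show ?thesis .
qed

text \<open>The density of the block coupling divides by cell masses; the points in the finitely
  many cells of mass zero form a null set.\<close>

lemma (in prob_space) AE_fibre_prob_nonzero:
  assumes g: "g \<in> measurable M (count_space I)" and I: "finite I"
  shows "AE x in M. prob {y\<in>space M. g y = g x} \<noteq> 0"
proof -
  have "AE x in M. \<forall>i\<in>I. prob {y\<in>space M. g y = i} = 0 \<longrightarrow> g x \<noteq> i"
  proof (rule AE_finite_allI[OF I])
    fix i assume i: "i \<in> I"
    show "AE x in M. prob {y\<in>space M. g y = i} = 0 \<longrightarrow> g x \<noteq> i"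
      using sets_fibre[OF g i]
      by (cases "prob {y\<in>space M. g y = i} = 0")
        (auto simp: emeasure_eq_measure intro: AE_I[where N = "{y\<in>space M. g y = i}"])
  qed
  with AE_space show ?thesis by eventually_elim (use measurable_space[OF g] in auto)
qed

text \<open>Given their cells, the two variables are taken independent, and the pair of cells
  \<open>(i, j)\<close> gets mass \<open>q i j\<close>. Each marginal keeps its conditional law on
  every cell, so a coupling of finitely many cell masses lifts to the laws themselves. One measure
  serves all costs \<open>F\<close> that depend on the cells alone.\<close>

lemma block_coupling:
  fixes q :: "'i \<Rightarrow> 'i \<Rightarrow> real"
  assumes M1: "prob_space M1" and M2: "prob_space M2" and I: "finite I"
    and g1: "g1 \<in> measurable M1 (count_space I)" and g2: "g2 \<in> measurable M2 (count_space I)"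
    and q: "\<And>i j. i \<in> I \<Longrightarrow> j \<in> I \<Longrightarrow> 0 \<le> q i j"
    and row: "\<And>i. i \<in> I \<Longrightarrow> (\<Sum>j\<in>I. q i j) = measure M1 {x\<in>space M1. g1 x = i}"
    and col: "\<And>j. j \<in> I \<Longrightarrow> (\<Sum>i\<in>I. q i j) = measure M2 {x\<in>space M2. g2 x = j}"
  shows "\<exists>\<pi>. sets \<pi> = sets (M1 \<Otimes>\<^sub>M M2) \<and> distr \<pi> M1 fst = M1 \<and> distr \<pi> M2 snd = M2 \<and>
    (\<forall>F. (\<forall>i j. 0 \<le> F i j) \<longrightarrow>
      (\<integral>\<^sup>+z. ennreal (F (g1 (fst z)) (g2 (snd z))) \<partial>\<pi>) = ennreal (\<Sum>i\<in>I. \<Sum>j\<in>I. F i j * q i j))"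
proof -
  interpret M1: prob_space M1 by fact
  interpret M2: prob_space M2 by fact
  interpret P: pair_sigma_finite M1 M2 by unfold_locales
  define a where "a i = measure M1 {x\<in>space M1. g1 x = i}" for i
  define b where "b i = measure M2 {x\<in>space M2. g2 x = i}" for i
  have ea: "emeasure M1 {x\<in>space M1. g1 x = i} = ennreal (a i)"
    and eb: "emeasure M2 {x\<in>space M2. g2 x = i} = ennreal (b i)" for i
    by (simp_all add: a_def b_def M1.emeasure_eq_measure M2.emeasure_eq_measure)
  have ab: "0 \<le> a i" "0 \<le> b i" for i by (auto simp: a_def b_def)
  have qa: "q i j = 0" if "a i = 0" "i \<in> I" "j \<in> I" for i j
    using that row[of i] q I by (simp add: a_def sum_nonneg_eq_0_iff)
  have qb: "q i j = 0" if "b j = 0" "i \<in> I" "j \<in> I" for i j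
    using that col[of j] q I by (simp add: b_def sum_nonneg_eq_0_iff)
  \<comment> \<open>The density with respect to the product law. A cell of mass zero forces its
    entries of \<open>q\<close> to vanish, and division by zero makes the density zero
    there.\<close>
  define h where "h z = (case z of (x, y) \<Rightarrow> ennreal (q (g1 x) (g2 y) / (a (g1 x) * b (g2 y))))" for z
  note g1[measurable] g2[measurable]
  have cell[measurable]: "(\<lambda>z. (g1 (fst z), g2 (snd z))) \<in> M1 \<Otimes>\<^sub>M M2 \<rightarrow>\<^sub>M count_space (I \<times> I)"
  proof -
    have "count_space (I \<times> I) = count_space I \<Otimes>\<^sub>M count_space I"
      using I by (intro pair_measure_countable[symmetric]) (auto intro: countable_finite)
    then show ?thesis by simp
  qed
  have meas: "(\<lambda>z. ennreal (F (g1 (fst z)) (g2 (snd z)))) \<in> borel_measurable (M1 \<Otimes>\<^sub>M M2)" for F :: "'i \<Rightarrow> 'i \<Rightarrow> real"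
    using measurable_compose[OF cell, of "\<lambda>(i, j). ennreal (F i j)" borel] by simp
  have h[measurable]: "h \<in> borel_measurable (M1 \<Otimes>\<^sub>M M2)"
    using meas[of "\<lambda>i j. q i j / (a i * b j)"] by (simp add: h_def[abs_def] split_def)
  define \<pi> where "\<pi> = density (M1 \<Otimes>\<^sub>M M2) h"
  have s\<pi>[measurable_cong]: "sets \<pi> = sets (M1 \<Otimes>\<^sub>M M2)" by (simp add: \<pi>_def)
  have g1I: "g1 x \<in> I" if "x \<in> space M1" for x using measurable_space[OF g1 that] by simp
  have g2I: "g2 x \<in> I" if "x \<in> space M2" for x using measurable_space[OF g2 that] by simp
  have in1: "(\<integral>\<^sup>+y. ennreal (q i (g2 y) / (a i * b (g2 y)) * F (g2 y)) \<partial>M2)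
      = ennreal (\<Sum>j\<in>I. q i j / a i * F j)" if i: "i \<in> I" and F: "\<And>j. 0 \<le> F j" for i F
  proof -
    have "(\<integral>\<^sup>+y. ennreal (q i (g2 y) / (a i * b (g2 y)) * F (g2 y)) \<partial>M2)
        = (\<Sum>j\<in>I. ennreal (q i j / (a i * b j) * F j) * ennreal (b j))"
      using nn_integral_finite_range[OF g2 I, of "\<lambda>j. ennreal (q i j / (a i * b j) * F j)"] by (simp add: eb)
    also have "\<dots> = (\<Sum>j\<in>I. ennreal (q i j / a i * F j))"
      using ab q[OF i] qb[OF _ i] F
      by (intro sum.cong refl) (auto simp: ennreal_mult'[symmetric] field_simps)
    also have "\<dots> = ennreal (\<Sum>j\<in>I. q i j / a i * F j)"
      using q[OF i] ab F by (intro sum_ennreal) auto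
    finally show ?thesis .
  qed
  have in2: "(\<integral>\<^sup>+x. ennreal (q (g1 x) j / (a (g1 x) * b j)) \<partial>M1)
      = ennreal (\<Sum>i\<in>I. q i j / b j)" if j: "j \<in> I" for j
  proof -
    have "(\<integral>\<^sup>+x. ennreal (q (g1 x) j / (a (g1 x) * b j)) \<partial>M1)
        = (\<Sum>i\<in>I. ennreal (q i j / (a i * b j)) * ennreal (a i))"
      using nn_integral_finite_range[OF g1 I, of "\<lambda>i. ennreal (q i j / (a i * b j))"] by (simp add: ea)
    also have "\<dots> = (\<Sum>i\<in>I. ennreal (q i j / b j))"
      using ab q[OF _ j] qa[OF _ _ j]
      by (intro sum.cong refl) (auto simp: ennreal_mult'[symmetric] field_simps)
    also have "\<dots> = ennreal (\<Sum>i\<in>I. q i j / b j)"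
      using q[OF _ j] ab by (intro sum_ennreal) auto
    finally show ?thesis .
  qed
  have ae1: "AE x in M1. a (g1 x) \<noteq> 0"
    unfolding a_def by (rule M1.AE_fibre_prob_nonzero[OF g1 I])
  have ae2: "AE x in M2. b (g2 x) \<noteq> 0"
    unfolding b_def by (rule M2.AE_fibre_prob_nonzero[OF g2 I])
  have fst: "distr \<pi> M1 fst = M1"
  proof (rule measure_eqI)
    fix A assume "A \<in> sets (distr \<pi> M1 fst)"
    then have A[measurable]: "A \<in> sets M1" by simp
    have "emeasure (distr \<pi> M1 fst) A = (\<integral>\<^sup>+z. indicator A (fst z) \<partial>\<pi>)"
      by (subst nn_integral_indicator[symmetric], simp) (subst nn_integral_distr, auto)
    also have "\<dots> = (\<integral>\<^sup>+z. h z * indicator A (fst z) \<partial>(M1 \<Otimes>\<^sub>M M2))"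
      unfolding \<pi>_def by (subst nn_integral_density) auto
    also have "\<dots> = (\<integral>\<^sup>+x. \<integral>\<^sup>+y. h (x, y) * indicator A x \<partial>M2 \<partial>M1)"
      by (subst M2.nn_integral_fst[symmetric]) auto
    also have "\<dots> = (\<integral>\<^sup>+x. indicator A x \<partial>M1)"
    proof (rule nn_integral_cong_AE)
      show "AE x in M1. (\<integral>\<^sup>+y. h (x, y) * indicator A x \<partial>M2) = indicator A x"
        using ae1 AE_space
      proof eventually_elim
        fix x assume ax: "a (g1 x) \<noteq> 0" and x: "x \<in> space M1"
        have "(\<integral>\<^sup>+y. h (x, y) * indicator A x \<partial>M2) = (\<integral>\<^sup>+y. h (x, y) \<partial>M2) * indicator A x"
          using x by (intro nn_integral_multc) simp
        also have "(\<integral>\<^sup>+y. h (x, y) \<partial>M2) = ennreal (\<Sum>j\<in>I. q (g1 x) j / a (g1 x))"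
          using in1[OF g1I[OF x], of "\<lambda>_. 1"] by (simp add: h_def)
        also have "\<dots> = 1"
          using ax row[OF g1I[OF x]] by (simp add: sum_divide_distrib[symmetric] a_def)
        finally show "(\<integral>\<^sup>+y. h (x, y) * indicator A x \<partial>M2) = indicator A x" by simp
      qed
    qed
    finally show "emeasure (distr \<pi> M1 fst) A = emeasure M1 A" by simp
  qed simp
  have snd: "distr \<pi> M2 snd = M2"
  proof (rule measure_eqI)
    fix A assume "A \<in> sets (distr \<pi> M2 snd)"
    then have A[measurable]: "A \<in> sets M2" by simp
    have "emeasure (distr \<pi> M2 snd) A = (\<integral>\<^sup>+z. indicator A (snd z) \<partial>\<pi>)"
      by (subst nn_integral_indicator[symmetric], simp) (subst nn_integral_distr, auto)
    also have "\<dots> = (\<integral>\<^sup>+z. h z * indicator A (snd z) \<partial>(M1 \<Otimes>\<^sub>M M2))"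
      unfolding \<pi>_def by (subst nn_integral_density) auto
    also have "\<dots> = (\<integral>\<^sup>+y. \<integral>\<^sup>+x. h (x, y) * indicator A y \<partial>M1 \<partial>M2)"
      by (subst P.nn_integral_snd[symmetric]) auto
    also have "\<dots> = (\<integral>\<^sup>+y. indicator A y \<partial>M2)"
    proof (rule nn_integral_cong_AE)
      show "AE y in M2. (\<integral>\<^sup>+x. h (x, y) * indicator A y \<partial>M1) = indicator A y"
        using ae2 AE_space
      proof eventually_elim
        fix y assume bne: "b (g2 y) \<noteq> 0" and y: "y \<in> space M2"
        have "(\<integral>\<^sup>+x. h (x, y) * indicator A y \<partial>M1) = (\<integral>\<^sup>+x. h (x, y) \<partial>M1) * indicator A y"
          using y by (intro nn_integral_multc) simp
        also have "(\<integral>\<^sup>+x. h (x, y) \<partial>M1) = ennreal (\<Sum>i\<in>I. q i (g2 y) / b (g2 y))"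
          using in2[OF g2I[OF y]] by (simp add: h_def)
        also have "\<dots> = 1"
          using bne col[OF g2I[OF y]] by (simp add: sum_divide_distrib[symmetric] b_def)
        finally show "(\<integral>\<^sup>+x. h (x, y) * indicator A y \<partial>M1) = indicator A y" by simp
      qed
    qed
    finally show "emeasure (distr \<pi> M2 snd) A = emeasure M2 A" by simp
  qed simp
  show ?thesis
  proof (intro exI[of _ \<pi>] conjI allI impI)
    fix F :: "'i \<Rightarrow> 'i \<Rightarrow> real" assume "\<forall>i j. 0 \<le> F i j"
    then have F: "\<And>i j. 0 \<le> F i j" by blast
    have [measurable]: "(\<lambda>z. ennreal (F (g1 (fst z)) (g2 (snd z)))) \<in> borel_measurable (M1 \<Otimes>\<^sub>M M2)"
      by (rule meas)
    have "(\<integral>\<^sup>+z. ennreal (F (g1 (fst z)) (g2 (snd z))) \<partial>\<pi>)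
        = (\<integral>\<^sup>+z. h z * ennreal (F (g1 (fst z)) (g2 (snd z))) \<partial>(M1 \<Otimes>\<^sub>M M2))"
      unfolding \<pi>_def by (subst nn_integral_density) auto
    also have "\<dots> = (\<integral>\<^sup>+x. \<integral>\<^sup>+y. h (x, y) * ennreal (F (g1 x) (g2 y)) \<partial>M2 \<partial>M1)"
      by (subst M2.nn_integral_fst[symmetric]) auto
    also have "\<dots> = (\<integral>\<^sup>+x. ennreal (\<Sum>j\<in>I. q (g1 x) j / a (g1 x) * F (g1 x) j) \<partial>M1)"
    proof (rule nn_integral_cong)
      fix x assume x: "x \<in> space M1"
      have "(\<integral>\<^sup>+y. h (x, y) * ennreal (F (g1 x) (g2 y)) \<partial>M2)
          = (\<integral>\<^sup>+y. ennreal (q (g1 x) (g2 y) / (a (g1 x) * b (g2 y)) * F (g1 x) (g2 y)) \<partial>M2)"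
        by (intro nn_integral_cong) (simp only: h_def prod.case ennreal_mult''[OF F])
      then show "(\<integral>\<^sup>+y. h (x, y) * ennreal (F (g1 x) (g2 y)) \<partial>M2)
          = ennreal (\<Sum>j\<in>I. q (g1 x) j / a (g1 x) * F (g1 x) j)"
        using in1[OF g1I[OF x], of "F (g1 x)"] F by simp
    qed
    also have "\<dots> = (\<Sum>i\<in>I. ennreal (\<Sum>j\<in>I. q i j / a i * F i j) * ennreal (a i))"
      using nn_integral_finite_range[OF g1 I, of "\<lambda>i. ennreal (\<Sum>j\<in>I. q i j / a i * F i j)"] by (simp add: ea)
    also have "\<dots> = (\<Sum>i\<in>I. ennreal (\<Sum>j\<in>I. F i j * q i j))"
    proof (intro sum.cong refl)
      fix i assume i: "i \<in> I"
      have "ennreal (\<Sum>j\<in>I. q i j / a i * F i j) * ennreal (a i) = ennreal ((\<Sum>j\<in>I. q i j / a i * F i j) * a i)"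
        using ab by (intro ennreal_mult''[symmetric])
      also have "(\<Sum>j\<in>I. q i j / a i * F i j) * a i = (\<Sum>j\<in>I. F i j * q i j)"
        unfolding sum_distrib_right using qa[OF _ i] by (intro sum.cong refl) (cases "a i = 0", auto)
      finally show "ennreal (\<Sum>j\<in>I. q i j / a i * F i j) * ennreal (a i) = ennreal (\<Sum>j\<in>I. F i j * q i j)" .
    qed
    also have "\<dots> = ennreal (\<Sum>i\<in>I. \<Sum>j\<in>I. F i j * q i j)"
      using F q by (intro sum_ennreal sum_nonneg) auto
    finally show "(\<integral>\<^sup>+z. ennreal (F (g1 (fst z)) (g2 (snd z))) \<partial>\<pi>) = ennreal (\<Sum>i\<in>I. \<Sum>j\<in>I. F i j * q i j)" .
  qed (use s\<pi> fst snd in auto)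
qed

text \<open>Couplings are built with the sample index instead of the sample point: every real
  function of the index is integrable, and one coupling can be read with the raw sample as well as
  with the centred one.\<close>

abbreviation index_law :: "nat \<Rightarrow> nat measure" where
  "index_law N \<equiv> uniform_count_measure {..<N}"

lemma prob_space_index_law: "0 < N \<Longrightarrow> prob_space (index_law N)"
  by (rule prob_space_uniform_count_measure) auto

lemma
  fixes f :: "nat \<Rightarrow> real"
  shows integrable_index_law: "integrable (index_law N) f"
    and integral_index_law: "(LINT k|index_law N. f k) = (\<Sum>k<N. f k) / real N"
  by (auto simp: uniform_count_measure_def integrable_point_measure_finite
      lebesgue_integral_point_measure_finite sum_divide_distrib)

lemma centered_sample_measurable [measurable]:
  "centered_sample d N \<omega> \<in> measurable (index_law N) (Rd d)"
  by (auto simp: measurable_def uniform_count_measure_def space_PiM centered_sample_def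
      sets_point_measure space_point_measure PiE_iff)

lemma
  assumes N: "0 < N"
  shows centered_empirical_zero_mean: "centered_empirical d N \<omega> \<in> zero_mean_laws d"
    and centered_empirical_integrable:
      "i < d \<Longrightarrow> j < d \<Longrightarrow> integrable (centered_empirical d N \<omega>) (\<lambda>\<xi>. \<xi> i * \<xi> j)"
proof -
  interpret prob_space "index_law N" by (rule prob_space_index_law[OF N])
  have 1: "integrable (centered_empirical d N \<omega>) f" if "f \<in> borel_measurable (Rd d)" for f :: "_ \<Rightarrow> real"
    unfolding centered_empirical_def
    by (subst integrable_distr_eq[OF centered_sample_measurable that]) (rule integrable_index_law)
  show "i < d \<Longrightarrow> j < d \<Longrightarrow> integrable (centered_empirical d N \<omega>) (\<lambda>\<xi>. \<xi> i * \<xi> j)"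
    by (rule 1) measurable
  have "(LINT \<xi>|centered_empirical d N \<omega>. \<xi> i) = 0" if i: "i < d" for i
  proof -
    have "(LINT \<xi>|centered_empirical d N \<omega>. \<xi> i) = (LINT k|index_law N. centered_sample d N \<omega> k i)"
      unfolding centered_empirical_def using i by (subst integral_distr) auto
    also have "\<dots> = 0"
      using N i by (simp add: integral_index_law centered_sample_def sum_subtractf)
    finally show ?thesis .
  qed
  then show "centered_empirical d N \<omega> \<in> zero_mean_laws d"
    by (auto simp: zero_mean_laws_def centered_empirical_def[symmetric] intro!: 1)
      (auto simp: centered_empirical_def intro!: prob_space_distr)
qed

text \<open>
  Centring the sample can only decrease the cost: the mean of the difference
  is the sample mean, because the second marginal has mean zero.
\<close>

lemma wasserstein2_centered_le:
  assumes N: "0 < N" and P: "P \<in> zero_mean_laws d"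
    and int: "\<And>i. i < d \<Longrightarrow> integrable P (\<lambda>\<xi>. \<xi> i * \<xi> i)"
    and sets: "sets \<pi> = sets (index_law N \<Otimes>\<^sub>M P)"
    and fst: "distr \<pi> (index_law N) fst = index_law N" and snd: "distr \<pi> P snd = P"
    and cost: "(\<integral>\<^sup>+z. ennreal ((euclid_norm d (\<lambda>i. \<omega> (fst z) i - snd z i))\<^sup>2) \<partial>\<pi>) \<le> ennreal (B\<^sup>2)"
    and B: "0 \<le> B"
  shows "wasserstein2 d (centered_empirical d N \<omega>) P \<le> ennreal B"
proof -
  have int1: "integrable P (\<lambda>\<xi>. \<xi> i)" and mean: "(LINT \<xi>|P. \<xi> i) = 0" if "i < d" for i
    using P that by (auto simp: zero_mean_laws_def)
  have setsP[measurable_cong]: "sets P = sets (Rd d)" and "prob_space P"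
    using P by (auto simp: zero_mean_laws_def)
  interpret P: prob_space P by fact
  interpret U: prob_space "index_law N" by (rule prob_space_index_law[OF N])
  note sets[measurable_cong]
  have pr: "prob_space \<pi>"
  proof (rule prob_spaceI)
    have "emeasure \<pi> (space \<pi>) = emeasure (distr \<pi> P snd) (space P)"
      by (subst emeasure_distr) (auto simp: sets_eq_imp_space_eq[OF sets] space_pair_measure intro!: arg_cong[of _ _ "emeasure \<pi>"])
    then show "emeasure \<pi> (space \<pi>) = 1" by (simp add: snd P.emeasure_space_1)
  qed
  interpret pi: prob_space \<pi> by fact
  define m where "m i = (\<Sum>l<N. \<omega> l i) / real N" for i
  let ?c = "centered_sample d N \<omega>"
  have c: "?c k i = \<omega> k i - m i" if "i < d" for k i using that by (simp add: centered_sample_def m_def)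
  have k: "integrable \<pi> (\<lambda>z. f (fst z))" "(LINT z|\<pi>. f (fst z)) = (LINT k|index_law N. f k)" for f :: "nat \<Rightarrow> real"
  proof -
    have f: "f \<in> borel_measurable (index_law N)"
      by (auto simp: measurable_def uniform_count_measure_def sets_point_measure space_point_measure)
    have m: "fst \<in> \<pi> \<rightarrow>\<^sub>M index_law N" by measurable
    show "integrable \<pi> (\<lambda>z. f (fst z))"
      using integrable_index_law[of N f] integrable_distr_eq[OF m f] unfolding fst by simp
    show "(LINT z|\<pi>. f (fst z)) = (LINT k|index_law N. f k)"
      using integral_distr[OF m f] unfolding fst by simp
  qed
  have y: "integrable \<pi> (\<lambda>z. f (snd z))" "(LINT z|\<pi>. f (snd z)) = (LINT \<xi>|P. f \<xi>)"
    if "integrable P f" for f :: "(nat \<Rightarrow> real) \<Rightarrow> real"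
  proof -
    have f: "f \<in> borel_measurable P" using that by auto
    have m: "snd \<in> \<pi> \<rightarrow>\<^sub>M P" by measurable
    show "integrable \<pi> (\<lambda>z. f (snd z))"
      using that integrable_distr_eq[OF m f] unfolding snd by simp
    show "(LINT z|\<pi>. f (snd z)) = (LINT \<xi>|P. f \<xi>)"
      using integral_distr[OF m f] unfolding snd by simp
  qed
  have mixed: "integrable \<pi> (\<lambda>z. \<omega> (fst z) i * snd z i)" if i: "i < d" for i
  proof (rule Bochner_Integration.integrable_bound)
    show "integrable \<pi> (\<lambda>z. (\<omega> (fst z) i)\<^sup>2 + snd z i * snd z i)"
      using k(1)[of "\<lambda>k. (\<omega> k i)\<^sup>2"] y(1)[OF int[OF i]] by (rule Bochner_Integration.integrable_add)
    show "AE z in \<pi>. norm (\<omega> (fst z) i * snd z i) \<le> norm ((\<omega> (fst z) i)\<^sup>2 + snd z i * snd z i)"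
    proof (rule AE_I2)
      fix z :: "nat \<times> (nat \<Rightarrow> real)"
      have "2 * (\<bar>\<omega> (fst z) i\<bar> * \<bar>snd z i\<bar>) \<le> (\<omega> (fst z) i)\<^sup>2 + (snd z i)\<^sup>2"
        using sum_squares_bound[of "\<bar>\<omega> (fst z) i\<bar>" "\<bar>snd z i\<bar>"] by (simp add: mult.assoc)
      moreover have "0 \<le> \<bar>\<omega> (fst z) i\<bar> * \<bar>snd z i\<bar>" by simp
      ultimately have "\<bar>\<omega> (fst z) i\<bar> * \<bar>snd z i\<bar> \<le> (\<omega> (fst z) i)\<^sup>2 + (snd z i)\<^sup>2" by linarith
      then show "norm (\<omega> (fst z) i * snd z i) \<le> norm ((\<omega> (fst z) i)\<^sup>2 + snd z i * snd z i)"
        by (simp add: abs_mult power2_eq_square)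
    qed
  qed (use borel_measurable_integrable[OF k(1)[of "\<lambda>k. \<omega> k i"]] borel_measurable_integrable[OF y(1)[OF int1[OF i]]] in measurable)
  have le_i: "(LINT z|\<pi>. (?c (fst z) i - snd z i)\<^sup>2) \<le> (LINT z|\<pi>. (\<omega> (fst z) i - snd z i)\<^sup>2)"
    and int_i: "integrable \<pi> (\<lambda>z. (?c (fst z) i - snd z i)\<^sup>2)" "integrable \<pi> (\<lambda>z. (\<omega> (fst z) i - snd z i)\<^sup>2)"
    if i: "i < d" for i
  proof -
    have e1: "(\<omega> (fst z) i - snd z i)\<^sup>2 = (\<omega> (fst z) i)\<^sup>2 - 2 * (\<omega> (fst z) i * snd z i) + snd z i * snd z i" for z
      by (simp add: power2_eq_square algebra_simps)
    have e2: "(?c (fst z) i - snd z i)\<^sup>2 = (\<omega> (fst z) i - snd z i)\<^sup>2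
        - 2 * m i * (\<omega> (fst z) i - snd z i) + (m i)\<^sup>2" for z
      by (simp add: c[OF i] power2_eq_square algebra_simps)
    show i1: "integrable \<pi> (\<lambda>z. (\<omega> (fst z) i - snd z i)\<^sup>2)"
      unfolding e1 using k(1)[of "\<lambda>k. (\<omega> k i)\<^sup>2"] mixed[OF i] y(1)[OF int[OF i]] by auto
    have i2: "integrable \<pi> (\<lambda>z. \<omega> (fst z) i - snd z i)"
      using k(1)[of "\<lambda>k. \<omega> k i"] y(1)[OF int1[OF i]] by auto
    show "integrable \<pi> (\<lambda>z. (?c (fst z) i - snd z i)\<^sup>2)"
      unfolding e2 using i1 i2 by auto
    have "(LINT z|\<pi>. \<omega> (fst z) i - snd z i) = m i"
      using k[of "\<lambda>k. \<omega> k i"] y[OF int1[OF i]] mean[OF i] by (simp add: integral_index_law m_def)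
    then have "(LINT z|\<pi>. (?c (fst z) i - snd z i)\<^sup>2) = (LINT z|\<pi>. (\<omega> (fst z) i - snd z i)\<^sup>2) - (m i)\<^sup>2"
      unfolding e2 using i1 i2 by (simp add: pi.prob_space power2_eq_square)
    then show "(LINT z|\<pi>. (?c (fst z) i - snd z i)\<^sup>2) \<le> (LINT z|\<pi>. (\<omega> (fst z) i - snd z i)\<^sup>2)" by simp
  qed
  have "(\<integral>\<^sup>+z. ennreal ((euclid_norm d (\<lambda>i. ?c (fst z) i - snd z i))\<^sup>2) \<partial>\<pi>)
      = ennreal (\<Sum>i<d. LINT z|\<pi>. (?c (fst z) i - snd z i)\<^sup>2)"
    unfolding euclid_norm_sq using int_i
    by (subst nn_integral_eq_integral) (auto intro!: Bochner_Integration.integrable_sum AE_I2 sum_nonneg arg_cong[of _ _ ennreal] Bochner_Integration.integral_sum)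
  also have "\<dots> \<le> ennreal (\<Sum>i<d. LINT z|\<pi>. (\<omega> (fst z) i - snd z i)\<^sup>2)"
    using le_i by (intro ennreal_leI sum_mono) auto
  also have "\<dots> = (\<integral>\<^sup>+z. ennreal ((euclid_norm d (\<lambda>i. \<omega> (fst z) i - snd z i))\<^sup>2) \<partial>\<pi>)"
    unfolding euclid_norm_sq using int_i
    by (subst nn_integral_eq_integral) (auto intro!: Bochner_Integration.integrable_sum AE_I2 sum_nonneg arg_cong[of _ _ ennreal] Bochner_Integration.integral_sum[symmetric])
  also note cost
  finally have cost': "(\<integral>\<^sup>+z. ennreal ((euclid_norm d (\<lambda>i. ?c (fst z) i - snd z i))\<^sup>2) \<partial>\<pi>) \<le> ennreal (B\<^sup>2)" .
  \<comment> \<open>Replacing the index by the centred sample point turns the index coupling into a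
    coupling of the two laws with the cost just bounded.\<close>
  define T where "T = (\<lambda>z. (?c (fst z), snd z :: nat \<Rightarrow> real))"
  have Tm[measurable]: "T \<in> \<pi> \<rightarrow>\<^sub>M Rd d \<Otimes>\<^sub>M Rd d" unfolding T_def by measurable
  define \<pi>' where "\<pi>' = distr \<pi> (Rd d \<Otimes>\<^sub>M Rd d) T"
  have "\<pi>' \<in> couplings d (centered_empirical d N \<omega>) P"
    unfolding couplings_def
  proof (intro CollectI conjI)
    show "prob_space \<pi>'" unfolding \<pi>'_def by (rule pi.prob_space_distr) measurable
    show "sets \<pi>' = sets (Rd d \<Otimes>\<^sub>M Rd d)" by (simp add: \<pi>'_def)
    have "distr \<pi>' (Rd d) fst = distr \<pi> (Rd d) (?c \<circ> fst)"
      unfolding \<pi>'_def by (subst distr_distr) (auto simp: T_def comp_def)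
    also have "\<dots> = distr (distr \<pi> (index_law N) fst) (Rd d) ?c"
      by (subst distr_distr) (auto simp: comp_def)
    finally show "distr \<pi>' (Rd d) fst = centered_empirical d N \<omega>"
      unfolding fst centered_empirical_def .
    have "distr \<pi>' (Rd d) snd = distr \<pi> (Rd d) snd"
      unfolding \<pi>'_def by (subst distr_distr) (auto simp: T_def comp_def)
    also have "\<dots> = distr \<pi> P snd" by (rule distr_cong) (auto simp: setsP)
    finally show "distr \<pi>' (Rd d) snd = P" using snd by simp
  qed
  moreover have "(\<integral>\<^sup>+ (\<xi>, \<eta>). ennreal ((euclid_norm d (\<lambda>i. \<xi> i - \<eta> i))\<^sup>2) \<partial>\<pi>') \<le> ennreal (B\<^sup>2)"
  proof -
    have "(\<integral>\<^sup>+ (\<xi>, \<eta>). ennreal ((euclid_norm d (\<lambda>i. \<xi> i - \<eta> i))\<^sup>2) \<partial>\<pi>')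
        = (\<integral>\<^sup>+z. ennreal ((euclid_norm d (\<lambda>i. ?c (fst z) i - snd z i))\<^sup>2) \<partial>\<pi>)"
      unfolding \<pi>'_def by (subst nn_integral_distr) (auto simp: T_def split_def)
    then show ?thesis using cost' by simp
  qed
  ultimately have "(INF \<pi> \<in> couplings d (centered_empirical d N \<omega>) P.
      \<integral>\<^sup>+ (\<xi>, \<eta>). ennreal ((euclid_norm d (\<lambda>i. \<xi> i - \<eta> i))\<^sup>2) \<partial>\<pi>) \<le> ennreal (B\<^sup>2)" (is "?I \<le> _")
    by (rule INF_lower2)
  moreover have "ennreal_sqrt x \<le> ennreal B" if le: "x \<le> ennreal (B\<^sup>2)" for x
  proof -
    obtain c where c: "x = ennreal c" "0 \<le> c" using le by (cases x) (auto simp: top_unique)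
    then have "c \<le> B\<^sup>2" using le by simp
    then have "sqrt c \<le> B" using B by (simp add: real_le_lsqrt c(2))
    then show ?thesis using c by (simp add: ennreal_sqrt_def ennreal_leI)
  qed
  ultimately show ?thesis unfolding wasserstein2_def by blast
qed

section \<open>Dyadic cells\<close>

text \<open>Clipping rather than discarding: far points keep a cell at the boundary, so that
  finitely many cells carry the full mass at every level. The displacement caused by clipping is
  charged to \<open>tail_sq\<close>.\<close>

definition truncate_at :: "real \<Rightarrow> real \<Rightarrow> real" where
  "truncate_at R x = max (- R) (min R x)"

definition cell :: "nat \<Rightarrow> real \<Rightarrow> nat \<Rightarrow> (nat \<Rightarrow> real) \<Rightarrow> nat \<Rightarrow> int" where
  "cell d R l x = (\<lambda>i\<in>{..<d}. \<lfloor>2 ^ l * truncate_at R (x i)\<rfloor>)"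

definition cells :: "nat \<Rightarrow> real \<Rightarrow> nat \<Rightarrow> (nat \<Rightarrow> int) set" where
  "cells d R l = ({..<d} \<rightarrow>\<^sub>E {- \<lceil>2 ^ l * R\<rceil>..\<lceil>2 ^ l * R\<rceil>})"

definition tail_sq :: "nat \<Rightarrow> real \<Rightarrow> (nat \<Rightarrow> real) \<Rightarrow> real" where
  "tail_sq d R x = (if R < euclid_norm d x then (euclid_norm d x)\<^sup>2 else 0)"

text \<open>For \<open>0 \<le> R\<close> this is twice the total variation distance between the
  empirical and the true distribution over the cells of level \<open>l\<close>.\<close>

definition discrepancy ::
    "nat \<Rightarrow> real \<Rightarrow> nat \<Rightarrow> (nat \<Rightarrow> real) measure \<Rightarrow> nat \<Rightarrow> (nat \<Rightarrow> nat \<Rightarrow> real) \<Rightarrow> real" where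
  "discrepancy d R N P l \<omega> = (\<Sum>c\<in>cells d R l.
     \<bar>real (card {k\<in>{..<N}. cell d R l (\<omega> k) = c}) / real N - measure P {x\<in>space P. cell d R l x = c}\<bar>)"

text \<open>
  Mass that is matched at level \<open>l\<close> but not at level \<open>l + 1\<close> travels at most the diameter
  of a cell of level \<open>l\<close>.
\<close>

definition level_weight :: "nat \<Rightarrow> real \<Rightarrow> nat \<Rightarrow> real" where
  "level_weight d R l = (if l = 0 then 4 * real d * R\<^sup>2 else 4 * real d / 4 ^ l)"

lemma level_weight_nonneg [simp]: "0 \<le> level_weight d R l"
  by (simp add: level_weight_def)

lemma tail_sq_nonneg [simp]: "0 \<le> tail_sq d R x"
  by (simp add: tail_sq_def)

lemma finite_cells [simp]: "finite (cells d R l)"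
  by (simp add: cells_def finite_PiE)

lemma truncate_at_bounds: "0 \<le> R \<Longrightarrow> - R \<le> truncate_at R x" "0 \<le> R \<Longrightarrow> truncate_at R x \<le> R"
  by (auto simp: truncate_at_def)

lemma cell_in_cells:
  assumes R: "0 \<le> R"
  shows "cell d R l x \<in> cells d R l"
proof -
  have "\<lfloor>2 ^ l * truncate_at R y\<rfloor> \<in> {- \<lceil>2 ^ l * R\<rceil>..\<lceil>2 ^ l * R\<rceil>}" for y
  proof -
    have 1: "2 ^ l * truncate_at R y \<le> 2 ^ l * R" "- (2 ^ l * R) \<le> 2 ^ l * truncate_at R y"
      using truncate_at_bounds[OF R, of y] mult_left_mono[of "- R" "truncate_at R y" "2 ^ l"] by auto
    have "\<lfloor>2 ^ l * truncate_at R y\<rfloor> \<le> \<lceil>2 ^ l * R\<rceil>" using 1(1) by linarith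
    moreover have "- \<lceil>2 ^ l * R\<rceil> \<le> \<lfloor>2 ^ l * truncate_at R y\<rfloor>" using 1(2) by linarith
    ultimately show ?thesis by simp
  qed
  then show ?thesis by (auto simp: cell_def cells_def)
qed

lemma cell_measurable:
  assumes R: "0 \<le> R" and P: "sets P = sets (Rd d)"
  shows "cell d R l \<in> measurable P (count_space (cells d R l))"
proof (subst measurable_count_space_eq2[OF finite_cells], intro conjI ballI)
  show "cell d R l \<in> space P \<rightarrow> cells d R l" using cell_in_cells[OF R] by auto
  fix c assume c: "c \<in> cells d R l"
  have "cell d R l x = c \<longleftrightarrow> (\<forall>i\<in>{..<d}. \<lfloor>2 ^ l * truncate_at R (x i)\<rfloor> = c i)" for x
    using c by (auto simp: cell_def cells_def fun_eq_iff PiE_iff extensional_def)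
  then have "cell d R l -` {c} \<inter> space (Rd d)
      = {x\<in>space (Rd d). \<forall>i\<in>{..<d}. \<lfloor>2 ^ l * truncate_at R (x i)\<rfloor> = c i}"
    by auto
  also have "\<dots> \<in> sets (Rd d)" unfolding truncate_at_def by measurable
  finally show "cell d R l -` {c} \<inter> space P \<in> sets P"
    using P sets_eq_imp_space_eq[OF P] by simp
qed

text \<open>Acts on cell indices, so that all coarser levels become partitions of the finite set of
  finest cells, on which the nested coupling operates.\<close>

definition coarsen :: "nat \<Rightarrow> nat \<Rightarrow> (nat \<Rightarrow> int) \<Rightarrow> nat \<Rightarrow> int" where
  "coarsen d e c = (\<lambda>i\<in>{..<d}. c i div 2 ^ e)"

text \<open>Dyadic cells are nested because rounding down commutes with division by a positive
  integer; clipping happens at the same \<open>R\<close> on all levels, before rounding.\<close>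

lemma cell_coarsen:
  assumes "l \<le> m"
  shows "cell d R l x = coarsen d (m - l) (cell d R m x)"
proof (rule ext)
  fix i
  have e: "(2::real) ^ m = 2 ^ (m - l) * 2 ^ l" using assms by (simp add: power_add[symmetric])
  have "\<lfloor>2 ^ l * t\<rfloor> = \<lfloor>2 ^ m * t\<rfloor> div 2 ^ (m - l)" for t :: real
    using floor_divide_real_eq_div[of "2 ^ (m - l)" "2 ^ m * t"] by (simp add: e)
  then show "cell d R l x i = coarsen d (m - l) (cell d R m x) i"
    by (simp add: cell_def coarsen_def)
qed

lemma coarsen_coarsen: "coarsen d e (coarsen d f c) = coarsen d (f + e) c"
  by (auto simp: coarsen_def fun_eq_iff power_add zdiv_zmult2_eq)

lemma truncated_dist_cell:
  assumes "cell d R l x = cell d R l y"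
  shows "(\<Sum>i<d. (truncate_at R (x i) - truncate_at R (y i))\<^sup>2) \<le> real d / 4 ^ l"
proof -
  have "(truncate_at R (x i) - truncate_at R (y i))\<^sup>2 \<le> 1 / 4 ^ l" if "i < d" for i
  proof -
    let ?a = "2 ^ l * truncate_at R (x i)" and ?b = "2 ^ l * truncate_at R (y i)"
    have "\<lfloor>?a\<rfloor> = \<lfloor>?b\<rfloor>" using fun_cong[OF assms, of i] that by (simp add: cell_def)
    then have "\<bar>?a - ?b\<bar> \<le> 1" by linarith
    then have "(?a - ?b)\<^sup>2 \<le> 1" by (simp add: abs_square_le_1)
    also have "(?a - ?b)\<^sup>2 = 4 ^ l * (truncate_at R (x i) - truncate_at R (y i))\<^sup>2"
    proof -
      have "((2::real) ^ l)\<^sup>2 = (2\<^sup>2) ^ l" by (simp only: power_mult[symmetric] mult.commute)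
      then show ?thesis by (simp add: right_diff_distrib[symmetric] power_mult_distrib)
    qed
    finally show ?thesis by (simp add: field_simps)
  qed
  then have "(\<Sum>i<d. (truncate_at R (x i) - truncate_at R (y i))\<^sup>2) \<le> (\<Sum>i<d. 1 / 4 ^ l)"
    by (intro sum_mono) auto
  then show ?thesis by simp
qed

lemma truncated_dist:
  assumes R: "0 \<le> R"
  shows "(\<Sum>i<d. (truncate_at R (x i) - truncate_at R (y i))\<^sup>2) \<le> 4 * real d * R\<^sup>2"
proof -
  have "(truncate_at R a - truncate_at R b)\<^sup>2 \<le> (2 * R)\<^sup>2" for a b
    using truncate_at_bounds[OF R, of a] truncate_at_bounds[OF R, of b] R
    by (intro power2_le_iff_abs_le[THEN iffD2]) auto
  then have "(\<Sum>i<d. (truncate_at R (x i) - truncate_at R (y i))\<^sup>2) \<le> (\<Sum>i<d. (2 * R)\<^sup>2)"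
    by (intro sum_mono)
  then show ?thesis by (simp add: power_mult_distrib algebra_simps)
qed

lemma truncation_error:
  assumes R: "0 \<le> R"
  shows "(\<Sum>i<d. (x i - truncate_at R (x i))\<^sup>2) \<le> tail_sq d R x"
proof (cases "R < euclid_norm d x")
  case True
  have "(x i - truncate_at R (x i))\<^sup>2 \<le> (x i)\<^sup>2" for i
    using R by (intro power2_le_iff_abs_le[THEN iffD2] abs_le_square_iff[THEN iffD1])
      (auto simp: truncate_at_def max_def min_def)
  then show ?thesis using True by (simp add: tail_sq_def euclid_norm_sq sum_mono)
next
  case False
  have "truncate_at R (x i) = x i" if "i < d" for i
  proof -
    have "sqrt ((x i)\<^sup>2) \<le> euclid_norm d x"
      unfolding euclid_norm_def L2_set_def using that by (intro real_sqrt_le_mono member_le_sum) auto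
    then show ?thesis using False by (auto simp: truncate_at_def)
  qed
  then show ?thesis by simp
qed

text \<open>Take the first level that separates the two points: one level earlier they still share a
  cell, whose diameter bounds their distance. Points separated at level 0 are at most the clipped
  range apart, and points never separated share a finest cell.\<close>

lemma truncated_dist_levels:
  assumes R: "0 \<le> R"
  shows "(\<Sum>i<d. (truncate_at R (x i) - truncate_at R (y i))\<^sup>2)
    \<le> real d / 4 ^ m + (\<Sum>l\<le>m. level_weight d R l * (if cell d R l x \<noteq> cell d R l y then 1 else 0))" (is "?L \<le> _ + ?S")
proof -
  have S: "level_weight d R l \<le> ?S" if "l \<le> m" "cell d R l x \<noteq> cell d R l y" for l
    using member_le_sum[of l "{..m}" "\<lambda>l. level_weight d R l * (if cell d R l x \<noteq> cell d R l y then 1 else 0)"] that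
    by simp
  have S0: "0 \<le> ?S" by (intro sum_nonneg) auto
  show ?thesis
  proof (cases "\<forall>l\<le>m. cell d R l x = cell d R l y")
    case True
    then show ?thesis using truncated_dist_cell[of d R m x y] S0 by simp
  next
    case False
    define l where "l = (LEAST l. cell d R l x \<noteq> cell d R l y)"
    obtain l0 where l0: "l0 \<le> m" "cell d R l0 x \<noteq> cell d R l0 y" using False by blast
    have l: "cell d R l x \<noteq> cell d R l y" unfolding l_def by (rule LeastI[of _ l0]) (rule l0)
    have lm: "l \<le> m" unfolding l_def using Least_le[of "\<lambda>l. cell d R l x \<noteq> cell d R l y" l0] l0 by simp
    have "?L \<le> level_weight d R l"
    proof (cases l)
      case 0
      then show ?thesis using truncated_dist[OF R] by (simp add: level_weight_def)
    next
      case (Suc k)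
      \<comment> \<open>The shared cell has level \<open>k = l - 1\<close>; this shift is the factor
        4 in \<open>level_weight\<close>.\<close>
      have "cell d R k x = cell d R k y" using not_less_Least[of k "\<lambda>l. cell d R l x \<noteq> cell d R l y"] Suc by (simp add: l_def)
      then show ?thesis using truncated_dist_cell[of d R k x y] Suc by (simp add: level_weight_def)
    qed
    then show ?thesis using S[OF lm l] by (simp add: add_increasing)
  qed
qed

lemma dist_sq_levels:
  assumes R: "0 \<le> R"
  shows "(euclid_norm d (\<lambda>i. x i - y i))\<^sup>2 \<le> 3 * tail_sq d R x + 3 * tail_sq d R y
    + 3 * (real d / 4 ^ m + (\<Sum>l\<le>m. level_weight d R l * (if cell d R l x \<noteq> cell d R l y then 1 else 0)))"
proof -
  let ?t = "truncate_at R"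
  have sq3: "(a - b)\<^sup>2 \<le> 3 * (a - s)\<^sup>2 + 3 * (b - t)\<^sup>2 + 3 * (s - t)\<^sup>2" for a b s t :: real
  proof -
    \<comment> \<open>With \<open>a - b\<close> split into the pieces \<open>a - s\<close>,
      \<open>s - t\<close> and \<open>t - b\<close>, these squares are the slack in the
      Cauchy-Schwarz inequality for three summands.\<close>
    have "0 \<le> ((a - s) - (s - t))\<^sup>2 + ((a - s) + (b - t))\<^sup>2 + ((s - t) + (b - t))\<^sup>2" by simp
    also have "\<dots> = 3 * (a - s)\<^sup>2 + 3 * (b - t)\<^sup>2 + 3 * (s - t)\<^sup>2 - (a - b)\<^sup>2"
      by (simp add: power2_eq_square algebra_simps)
    finally show ?thesis by simp
  qed
  have "(euclid_norm d (\<lambda>i. x i - y i))\<^sup>2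
      \<le> (\<Sum>i<d. 3 * (x i - ?t (x i))\<^sup>2 + 3 * (y i - ?t (y i))\<^sup>2 + 3 * (?t (x i) - ?t (y i))\<^sup>2)"
    unfolding euclid_norm_sq by (intro sum_mono sq3)
  also have "\<dots> = 3 * (\<Sum>i<d. (x i - ?t (x i))\<^sup>2) + 3 * (\<Sum>i<d. (y i - ?t (y i))\<^sup>2) + 3 * (\<Sum>i<d. (?t (x i) - ?t (y i))\<^sup>2)"
    by (simp add: sum.distrib sum_distrib_left)
  also have "\<dots> \<le> 3 * tail_sq d R x + 3 * tail_sq d R y
    + 3 * (real d / 4 ^ m + (\<Sum>l\<le>m. level_weight d R l * (if cell d R l x \<noteq> cell d R l y then 1 else 0)))"
    by (intro add_mono mult_left_mono truncation_error truncated_dist_levels R) auto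
  finally show ?thesis .
qed

section \<open>From cell discrepancies to the transport cost\<close>

lemma (in prob_space) sum_fibre_prob:
  assumes g: "g \<in> measurable M (count_space I)" and I: "finite I"
  shows "(\<Sum>i\<in>{i\<in>I. G i = c}. prob {x\<in>space M. g x = i}) = prob {x\<in>space M. G (g x) = c}"
proof -
  have "(\<Sum>i\<in>{i\<in>I. G i = c}. prob {x\<in>space M. g x = i}) = prob (\<Union>i\<in>{i\<in>I. G i = c}. {x\<in>space M. g x = i})"
    using I sets_fibre[OF g]
    by (intro finite_measure_finite_Union[symmetric]) (auto simp: disjoint_family_on_def)
  also have "(\<Union>i\<in>{i\<in>I. G i = c}. {x\<in>space M. g x = i}) = {x\<in>space M. G (g x) = c}"
    using measurable_space[OF g] by auto
  finally show ?thesis .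
qed

lemma tail_sq_measurable:
  assumes "sets P = sets (Rd d)"
  shows "tail_sq d R \<in> borel_measurable P"
proof -
  have "tail_sq d R \<in> borel_measurable (Rd d)"
    unfolding tail_sq_def euclid_norm_def L2_set_def by measurable
  then show ?thesis using measurable_cong_sets[OF assms refl] by blast
qed

text \<open>A deterministic statement about one sample: the nested coupling of the finest cell
  masses, lifted to the laws, turns the pointwise distance bound into tails plus weighted
  discrepancies. Chance enters afterwards only through the sample tail and the
  discrepancies.\<close>

lemma wasserstein2_discrepancy:
  assumes N: "0 < N" and P: "P \<in> zero_mean_laws d" and R: "0 \<le> R"
    and int: "\<And>i. i < d \<Longrightarrow> integrable P (\<lambda>\<xi>. \<xi> i * \<xi> i)"
    and tail: "(\<integral>\<^sup>+x. ennreal (tail_sq d R x) \<partial>P) \<le> ennreal t" and t: "0 \<le> t" and B: "0 \<le> B"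
    and bound: "3 * ((\<Sum>k<N. tail_sq d R (\<omega> k)) / real N + t + real d / 4 ^ m
      + (\<Sum>l\<le>m. level_weight d R l * discrepancy d R N P l \<omega>)) \<le> B\<^sup>2"
  shows "wasserstein2 d (centered_empirical d N \<omega>) P \<le> ennreal B"
proof -
  have setsP: "sets P = sets (Rd d)" and "prob_space P"
    using P by (auto simp: zero_mean_laws_def)
  interpret P: prob_space P by fact
  interpret U: prob_space "index_law N" by (rule prob_space_index_law[OF N])
  define g1 where "g1 k = cell d R m (\<omega> k)" for k
  let ?g2 = "cell d R m" and ?I = "cells d R m"
  let ?G = "\<lambda>l. coarsen d (m - l)"
  define a where "a i = U.prob {k\<in>space (index_law N). g1 k = i}" for i
  define b where "b i = P.prob {x\<in>space P. ?g2 x = i}" for i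
  have g1: "g1 \<in> measurable (index_law N) (count_space ?I)"
    using cell_in_cells[OF R] by (auto simp: measurable_def g1_def uniform_count_measure_def sets_point_measure space_point_measure)
  have g2: "?g2 \<in> measurable P (count_space ?I)" by (rule cell_measurable[OF R setsP])
  have I: "finite ?I" by simp
  have tot: "sum a ?I = 1" "sum b ?I = 1"
    using U.sum_fibre_prob[OF g1 I, of "\<lambda>_. ()" "()"] P.sum_fibre_prob[OF g2 I, of "\<lambda>_. ()" "()"]
    by (auto simp: a_def b_def U.prob_space P.prob_space)
  have nested: "?G l i = ?G l j" if "l < m" "?G (Suc l) i = ?G (Suc l) j" for l i j
  proof -
    have "?G l c = coarsen d 1 (?G (Suc l) c)" for c
      using that(1) by (simp add: coarsen_coarsen Suc_diff_Suc)
    then show ?thesis using that(2) by metis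
  qed
  have "\<exists>q. (\<forall>i\<in>?I. \<forall>j\<in>?I. 0 \<le> q i j) \<and> (\<forall>i\<in>?I. (\<Sum>j\<in>?I. q i j) = a i) \<and> (\<forall>j\<in>?I. (\<Sum>i\<in>?I. q i j) = b j)
    \<and> (\<forall>l\<le>m. (\<Sum>i\<in>?I. \<Sum>j\<in>?I. if ?G l i \<noteq> ?G l j then q i j else 0)
      \<le> (\<Sum>c\<in>?G l ` ?I. \<bar>(\<Sum>i\<in>{i\<in>?I. ?G l i = c}. a i) - (\<Sum>i\<in>{i\<in>?I. ?G l i = c}. b i)\<bar>))"
  proof (rule nested_coupling)
    show "finite ?I" by (rule I)
    show "0 \<le> a i" "0 \<le> b i" for i by (simp_all only: a_def b_def measure_nonneg)
    show "sum a ?I = sum b ?I" by (simp only: tot)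
    show "?G l i = ?G l j" if "l < m" "?G (Suc l) i = ?G (Suc l) j" for l i j
      using that by (rule nested)
  qed
  then obtain q where q: "\<forall>i\<in>?I. \<forall>j\<in>?I. 0 \<le> q i j"
    and row: "\<forall>i\<in>?I. (\<Sum>j\<in>?I. q i j) = a i" and col: "\<forall>j\<in>?I. (\<Sum>i\<in>?I. q i j) = b j"
    and lev: "\<forall>l\<le>m. (\<Sum>i\<in>?I. \<Sum>j\<in>?I. if ?G l i \<noteq> ?G l j then q i j else 0)
      \<le> (\<Sum>c\<in>?G l ` ?I. \<bar>(\<Sum>i\<in>{i\<in>?I. ?G l i = c}. a i) - (\<Sum>i\<in>{i\<in>?I. ?G l i = c}. b i)\<bar>)"
    by (elim exE conjE) (rule that)
  have "\<exists>\<pi>. sets \<pi> = sets (index_law N \<Otimes>\<^sub>M P) \<and> distr \<pi> (index_law N) fst = index_law N \<and> distr \<pi> P snd = P \<and>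
    (\<forall>F. (\<forall>i j. 0 \<le> F i j) \<longrightarrow>
      (\<integral>\<^sup>+z. ennreal (F (g1 (fst z)) (?g2 (snd z))) \<partial>\<pi>) = ennreal (\<Sum>i\<in>?I. \<Sum>j\<in>?I. F i j * q i j))"
    by (rule block_coupling[OF U.prob_space_axioms P.prob_space_axioms I g1 g2])
      (use q row col in \<open>simp_all only: a_def b_def\<close>)
  then obtain \<pi> where \<pi>: "sets \<pi> = sets (index_law N \<Otimes>\<^sub>M P)" "distr \<pi> (index_law N) fst = index_law N" "distr \<pi> P snd = P"
    and \<pi>F: "\<forall>F. (\<forall>i j. 0 \<le> F i j) \<longrightarrow>
      (\<integral>\<^sup>+z. ennreal (F (g1 (fst z)) (?g2 (snd z))) \<partial>\<pi>) = ennreal (\<Sum>i\<in>?I. \<Sum>j\<in>?I. F i j * q i j)"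
    by (elim exE conjE) (rule that)
  have disc: "(\<Sum>i\<in>?I. \<Sum>j\<in>?I. if ?G l i \<noteq> ?G l j then q i j else 0) \<le> discrepancy d R N P l \<omega>" if l: "l \<le> m" for l
  proof -
    let ?f = "\<lambda>c. \<bar>real (card {k\<in>{..<N}. cell d R l (\<omega> k) = c}) / real N - P.prob {x\<in>space P. cell d R l x = c}\<bar>"
    have f: "\<bar>(\<Sum>i\<in>{i\<in>?I. ?G l i = c}. a i) - (\<Sum>i\<in>{i\<in>?I. ?G l i = c}. b i)\<bar> = ?f c" for c
    proof -
      have "(\<Sum>i\<in>{i\<in>?I. ?G l i = c}. a i) = U.prob {k\<in>{..<N}. cell d R l (\<omega> k) = c}"
        unfolding a_def U.sum_fibre_prob[OF g1 I]
        by (simp add: space_uniform_count_measure g1_def cell_coarsen[OF l, symmetric])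
      also have "\<dots> = real (card {k\<in>{..<N}. cell d R l (\<omega> k) = c}) / real N"
        by (subst measure_uniform_count_measure) auto
      finally show ?thesis
        unfolding b_def P.sum_fibre_prob[OF g2 I] by (simp add: cell_coarsen[OF l, symmetric])
    qed
    \<comment> \<open>The coarsened indices and \<open>cells d R l\<close> need not be the same set.
      An index outside the latter is the cell of no point, so both of its masses vanish.\<close>
    have "(\<Sum>c\<in>?G l ` ?I. ?f c) = (\<Sum>c\<in>?G l ` ?I \<inter> cells d R l. ?f c)"
    proof (rule sum.mono_neutral_right)
      show "\<forall>c\<in>?G l ` ?I - ?G l ` ?I \<inter> cells d R l. ?f c = 0"
      proof
        fix c assume "c \<in> ?G l ` ?I - ?G l ` ?I \<inter> cells d R l"
        then have "c \<notin> cells d R l" by blast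
        then have "cell d R l x \<noteq> c" for x using cell_in_cells[OF R, of d l x] by metis
        then show "?f c = 0" by simp
      qed
    qed auto
    also have "\<dots> \<le> (\<Sum>c\<in>cells d R l. ?f c)" by (intro sum_mono2) auto
    finally show ?thesis using lev[rule_format, OF l] unfolding f discrepancy_def by linarith
  qed
  \<comment> \<open>The distance bound as a function of the two finest cells alone, which is the
    kind of cost that the block coupling evaluates.\<close>
  define F where "F i j = real d / 4 ^ m + (\<Sum>l\<le>m. level_weight d R l * (if ?G l i \<noteq> ?G l j then 1 else 0))" for i j
  have F: "0 \<le> F i j" for i j unfolding F_def by (intro add_nonneg_nonneg sum_nonneg) auto
  have Fq: "(\<Sum>i\<in>?I. \<Sum>j\<in>?I. F i j * q i j) \<le> real d / 4 ^ m + (\<Sum>l\<le>m. level_weight d R l * discrepancy d R N P l \<omega>)"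
  proof -
    have e1: "(\<Sum>i\<in>?I. \<Sum>j\<in>?I. F i j * q i j) = (\<Sum>i\<in>?I. \<Sum>j\<in>?I. real d / 4 ^ m * q i j)
        + (\<Sum>i\<in>?I. \<Sum>j\<in>?I. \<Sum>l\<le>m. level_weight d R l * (if ?G l i \<noteq> ?G l j then q i j else 0))"
      unfolding sum.distrib[symmetric]
      by (intro sum.cong refl) (simp add: F_def distrib_right sum_distrib_right if_distrib if_distribR mult.assoc cong: if_cong)
    have e2: "(\<Sum>i\<in>?I. \<Sum>j\<in>?I. real d / 4 ^ m * q i j) = real d / 4 ^ m"
    proof -
      have "(\<Sum>i\<in>?I. \<Sum>j\<in>?I. real d / 4 ^ m * q i j) = real d / 4 ^ m * (\<Sum>i\<in>?I. \<Sum>j\<in>?I. q i j)"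
        by (simp only: sum_distrib_left)
      moreover have "(\<Sum>i\<in>?I. \<Sum>j\<in>?I. q i j) = 1" using row tot(1) by simp
      ultimately show ?thesis by (simp only: mult_1_right)
    qed
    have e3: "(\<Sum>i\<in>?I. \<Sum>j\<in>?I. \<Sum>l\<le>m. level_weight d R l * (if ?G l i \<noteq> ?G l j then q i j else 0))
        = (\<Sum>l\<le>m. level_weight d R l * (\<Sum>i\<in>?I. \<Sum>j\<in>?I. if ?G l i \<noteq> ?G l j then q i j else 0))"
      unfolding sum_distrib_left by (subst sum.swap[of _ "{..m}"]) (subst sum.swap[of _ ?I "{..m}"], rule refl)
    have e4: "(\<Sum>l\<le>m. level_weight d R l * (\<Sum>i\<in>?I. \<Sum>j\<in>?I. if ?G l i \<noteq> ?G l j then q i j else 0)) \<le> (\<Sum>l\<le>m. level_weight d R l * discrepancy d R N P l \<omega>)"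
      by (intro sum_mono mult_left_mono disc) auto
    show ?thesis unfolding e1 e2 e3 by (intro add_left_mono e4)
  qed
  note \<pi>(1)[measurable_cong]
  have tm: "tail_sq d R \<in> borel_measurable P" by (rule tail_sq_measurable[OF setsP])
  have um: "(\<lambda>k. tail_sq d R (\<omega> k)) \<in> borel_measurable (index_law N)"
    by (auto simp: measurable_def uniform_count_measure_def sets_point_measure space_point_measure)
  have m1: "fst \<in> \<pi> \<rightarrow>\<^sub>M index_law N" and m2: "snd \<in> \<pi> \<rightarrow>\<^sub>M P" by measurable
  have c1: "(\<integral>\<^sup>+z. ennreal (tail_sq d R (\<omega> (fst z))) \<partial>\<pi>) = ennreal ((\<Sum>k<N. tail_sq d R (\<omega> k)) / real N)"
  proof -
    have "(\<integral>\<^sup>+z. ennreal (tail_sq d R (\<omega> (fst z))) \<partial>\<pi>) = (\<integral>\<^sup>+k. ennreal (tail_sq d R (\<omega> k)) \<partial>index_law N)"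
      using nn_integral_distr[OF m1, of "\<lambda>k. ennreal (tail_sq d R (\<omega> k))"] um by (simp add: \<pi>(2))
    also have "\<dots> = ennreal (LINT k|index_law N. tail_sq d R (\<omega> k))"
      by (rule nn_integral_eq_integral[OF integrable_index_law]) simp
    finally show ?thesis by (simp add: integral_index_law)
  qed
  have c2: "(\<integral>\<^sup>+z. ennreal (tail_sq d R (snd z)) \<partial>\<pi>) \<le> ennreal t"
    using nn_integral_distr[OF m2, of "\<lambda>x. ennreal (tail_sq d R x)"] tm tail by (simp add: \<pi>(3))
  have c3: "(\<integral>\<^sup>+z. ennreal (F (g1 (fst z)) (?g2 (snd z))) \<partial>\<pi>)
      \<le> ennreal (real d / 4 ^ m + (\<Sum>l\<le>m. level_weight d R l * discrepancy d R N P l \<omega>))"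
  proof -
    have "\<forall>i j. 0 \<le> F i j" using F by blast
    then have "(\<integral>\<^sup>+z. ennreal (F (g1 (fst z)) (?g2 (snd z))) \<partial>\<pi>) = ennreal (\<Sum>i\<in>?I. \<Sum>j\<in>?I. F i j * q i j)"
      by (rule mp[OF spec[OF \<pi>F, of F]])
    then show ?thesis using Fq by (simp only: ennreal_leI)
  qed
  have Fm: "(\<lambda>z. ennreal (F (g1 (fst z)) (?g2 (snd z)))) \<in> borel_measurable \<pi>"
  proof -
    have "count_space (?I \<times> ?I) = count_space ?I \<Otimes>\<^sub>M count_space ?I"
      by (intro pair_measure_countable[symmetric]) (auto intro: countable_finite)
    moreover have "(\<lambda>z. (g1 (fst z), ?g2 (snd z))) \<in> \<pi> \<rightarrow>\<^sub>M count_space ?I \<Otimes>\<^sub>M count_space ?I"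
      by (intro measurable_Pair measurable_compose[OF m1 g1] measurable_compose[OF m2 g2])
    ultimately have "(\<lambda>z. (g1 (fst z), ?g2 (snd z))) \<in> \<pi> \<rightarrow>\<^sub>M count_space (?I \<times> ?I)" by simp
    from measurable_compose[OF this, of "\<lambda>(i, j). ennreal (F i j)" borel] show ?thesis by simp
  qed
  have "(\<integral>\<^sup>+z. ennreal ((euclid_norm d (\<lambda>i. \<omega> (fst z) i - snd z i))\<^sup>2) \<partial>\<pi>)
      \<le> (\<integral>\<^sup>+z. ennreal 3 * ennreal (tail_sq d R (\<omega> (fst z))) + ennreal 3 * ennreal (tail_sq d R (snd z))
        + ennreal 3 * ennreal (F (g1 (fst z)) (?g2 (snd z))) \<partial>\<pi>)"
  proof (rule nn_integral_mono)
    fix z :: "nat \<times> (nat \<Rightarrow> real)"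
    have "(euclid_norm d (\<lambda>i. \<omega> (fst z) i - snd z i))\<^sup>2
        \<le> 3 * tail_sq d R (\<omega> (fst z)) + 3 * tail_sq d R (snd z) + 3 * F (g1 (fst z)) (?g2 (snd z))"
      using dist_sq_levels[OF R, of d "\<omega> (fst z)" "snd z" m]
      by (simp add: F_def g1_def cell_coarsen[symmetric])
    then show "ennreal ((euclid_norm d (\<lambda>i. \<omega> (fst z) i - snd z i))\<^sup>2)
      \<le> ennreal 3 * ennreal (tail_sq d R (\<omega> (fst z))) + ennreal 3 * ennreal (tail_sq d R (snd z))
        + ennreal 3 * ennreal (F (g1 (fst z)) (?g2 (snd z)))"
      using F by (simp add: ennreal_mult[symmetric] ennreal_plus[symmetric] del: ennreal_plus ennreal_numeral)
  qed
  also have "\<dots> = ennreal 3 * (\<integral>\<^sup>+z. ennreal (tail_sq d R (\<omega> (fst z))) \<partial>\<pi>) + ennreal 3 * (\<integral>\<^sup>+z. ennreal (tail_sq d R (snd z)) \<partial>\<pi>)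
        + ennreal 3 * (\<integral>\<^sup>+z. ennreal (F (g1 (fst z)) (?g2 (snd z))) \<partial>\<pi>)"
    using measurable_compose[OF m1 um] measurable_compose[OF m2 tm] Fm
    by (simp add: nn_integral_add nn_integral_cmult)
  also have "\<dots> \<le> ennreal 3 * ennreal ((\<Sum>k<N. tail_sq d R (\<omega> k)) / real N) + ennreal 3 * ennreal t
        + ennreal 3 * ennreal (real d / 4 ^ m + (\<Sum>l\<le>m. level_weight d R l * discrepancy d R N P l \<omega>))"
    unfolding c1 by (intro add_mono mult_left_mono c2 c3 order_refl) auto
  also have "\<dots> = ennreal (3 * ((\<Sum>k<N. tail_sq d R (\<omega> k)) / real N + t + real d / 4 ^ m
      + (\<Sum>l\<le>m. level_weight d R l * discrepancy d R N P l \<omega>)))"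
  proof -
    have "0 \<le> (\<Sum>k<N. tail_sq d R (\<omega> k)) / real N"
      "0 \<le> real d / 4 ^ m + (\<Sum>l\<le>m. level_weight d R l * discrepancy d R N P l \<omega>)"
      by (auto intro!: add_nonneg_nonneg sum_nonneg divide_nonneg_nonneg mult_nonneg_nonneg simp: discrepancy_def)
    then show ?thesis
      using t by (simp add: ennreal_mult[symmetric] ennreal_plus[symmetric] del: ennreal_plus ennreal_numeral)
  qed
  also have "\<dots> \<le> ennreal (B\<^sup>2)" using bound by (rule ennreal_leI)
  finally show ?thesis
    by (intro wasserstein2_centered_le[OF N P int \<pi>]) (use B in auto)
qed

section \<open>Discrepancies of a sample\<close>

text \<open>A Riemann sum for the integral of 1/(1 + x^2), of order \<open>M\<close> and uniform in
  \<open>n\<close>. The induction carries a telescoping majorant that comes from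
  \<open>1 / (M\<^sup>2 + j\<^sup>2) \<le> 2 / (M + j)\<^sup>2\<close>.\<close>

lemma sum_inverse_square_le:
  fixes M :: real
  assumes M: "1 \<le> M"
  shows "(\<Sum>z\<in>{- int n..int n}. 1 / (1 + (real_of_int z / M)\<^sup>2)) \<le> 5 * M"
proof -
  have "(\<Sum>z\<in>{- int n..int n}. 1 / (1 + (real_of_int z / M)\<^sup>2)) \<le> 1 + 4 * M\<^sup>2 * (1 / M - 1 / (M + n))"
  proof (induction n)
    case 0
    then show ?case by simp
  next
    case (Suc n)
    have "{- int (Suc n)..int (Suc n)} = insert (- int (Suc n)) (insert (int (Suc n)) {- int n..int n})" by auto
    then have "(\<Sum>z\<in>{- int (Suc n)..int (Suc n)}. 1 / (1 + (real_of_int z / M)\<^sup>2))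
        = 2 * (1 / (1 + (real (Suc n) / M)\<^sup>2)) + (\<Sum>z\<in>{- int n..int n}. 1 / (1 + (real_of_int z / M)\<^sup>2))"
      by (simp add: power2_eq_square algebra_simps)
    moreover have "1 / (1 + (real (Suc n) / M)\<^sup>2) \<le> 2 * M\<^sup>2 * (1 / (M + n) - 1 / (M + Suc n))"
    proof -
      let ?v = "M + real (Suc n)"
      have "?v\<^sup>2 \<le> 2 * (M\<^sup>2 + (real (Suc n))\<^sup>2)"
        using sum_squares_bound[of M "real (Suc n)"] by (simp add: power2_sum)
      then have "1 / (M\<^sup>2 + (real (Suc n))\<^sup>2) \<le> 2 / ?v\<^sup>2"
        using M by (simp add: field_simps add_pos_nonneg)
      also have "\<dots> \<le> 2 / ((M + n) * ?v)"
        using M by (intro divide_left_mono) (auto simp: power2_eq_square intro!: mult_mono mult_pos_pos add_pos_nonneg)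
      also have "\<dots> = 2 * (1 / (M + n) - 1 / ?v)"
        using M by (simp add: field_simps)
      finally have "M\<^sup>2 * (1 / (M\<^sup>2 + (real (Suc n))\<^sup>2)) \<le> M\<^sup>2 * (2 * (1 / (M + n) - 1 / ?v))"
        by (intro mult_left_mono) auto
      moreover have "M\<^sup>2 * (1 / (M\<^sup>2 + (real (Suc n))\<^sup>2)) = 1 / (1 + (real (Suc n) / M)\<^sup>2)"
        using M by (simp add: power_divide add_divide_eq_iff)
      ultimately show ?thesis by (simp only: mult_ac)
    qed
    ultimately have "(\<Sum>z\<in>{- int (Suc n)..int (Suc n)}. 1 / (1 + (real_of_int z / M)\<^sup>2))
        \<le> 2 * (2 * M\<^sup>2 * (1 / (M + n) - 1 / (M + Suc n))) + (1 + 4 * M\<^sup>2 * (1 / M - 1 / (M + n)))"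
      using Suc.IH by linarith
    also have "\<dots> = 1 + 4 * M\<^sup>2 * (1 / M - 1 / (M + Suc n))" by (simp add: algebra_simps)
    finally show ?case .
  qed
  also have "\<dots> \<le> 1 + 4 * M\<^sup>2 * (1 / M)"
    using M by (intro add_left_mono mult_left_mono) auto
  also have "\<dots> \<le> 5 * M" using M by (simp add: power2_eq_square)
  finally show ?thesis .
qed

text \<open>A polynomial weight in the position of the cell: its reciprocals sum to order
  \<open>2 ^ (l * d)\<close> whatever the truncation radius, while the exponential moment bounds its
  mean. It serves as the second factor in a Cauchy-Schwarz estimate.\<close>

definition cell_weight :: "nat \<Rightarrow> nat \<Rightarrow> (nat \<Rightarrow> int) \<Rightarrow> real" where
  "cell_weight d l c = (\<Prod>i<d. 1 + (real_of_int (c i) / 2 ^ l)\<^sup>2)"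

lemma cell_weight_pos: "0 < cell_weight d l c"
  unfolding cell_weight_def by (intro prod_pos) (auto intro: add_pos_nonneg)

lemma sum_inverse_cell_weight:
  assumes R: "0 \<le> R"
  shows "(\<Sum>c\<in>cells d R l. 1 / cell_weight d l c) \<le> (5 * 2 ^ l) ^ d"
proof -
  define n where "n = nat \<lceil>2 ^ l * R\<rceil>"
  have n: "\<lceil>2 ^ l * R\<rceil> = int n"
  proof -
    have "0 \<le> 2 ^ l * R" using R by simp
    then have "0 \<le> \<lceil>2 ^ l * R\<rceil>" by (simp only: zero_le_ceiling)
    then show ?thesis by (simp add: n_def)
  qed
  have "(\<Sum>c\<in>cells d R l. 1 / cell_weight d l c)
      = (\<Sum>c\<in>{..<d} \<rightarrow>\<^sub>E {- int n..int n}. \<Prod>i<d. 1 / (1 + (real_of_int (c i) / 2 ^ l)\<^sup>2))"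
    by (simp add: cells_def cell_weight_def n prod_dividef)
  also have "\<dots> = (\<Prod>i<d. \<Sum>z\<in>{- int n..int n}. 1 / (1 + (real_of_int z / 2 ^ l)\<^sup>2))"
    by (rule prod_sum_PiE[symmetric]) auto
  also have "\<dots> \<le> (\<Prod>i<d. 5 * 2 ^ l)"
    by (intro prod_mono conjI sum_nonneg sum_inverse_square_le) auto
  finally show ?thesis by simp
qed

lemma power_le_exp:
  fixes y :: real
  assumes "0 \<le> y" "0 < n"
  shows "y ^ n \<le> real n ^ n * exp y"
proof -
  have "(y / n) ^ n \<le> (1 + y / n) ^ n" using assms by (intro power_mono) auto
  also have "\<dots> \<le> exp y" using assms by (intro exp_ge_one_plus_x_over_n_power_n) auto
  finally show ?thesis using assms by (simp add: power_divide field_simps)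
qed

lemma euclid_norm_nonneg [simp]: "0 \<le> euclid_norm d x"
  by (simp add: euclid_norm_def)

lemma cell_weight_cell:
  assumes \<gamma>: "2 < \<gamma>" and d: "0 < d" and R: "0 \<le> R"
  shows "cell_weight d l (cell d R l x) \<le> (5 * real d) ^ d * exp (euclid_norm d x powr \<gamma>)"
proof -
  let ?u = "euclid_norm d x"
  have "1 + (real_of_int (cell d R l x i) / 2 ^ l)\<^sup>2 \<le> 3 + 2 * ?u\<^sup>2" if i: "i < d" for i
  proof -
    let ?t = "truncate_at R (x i)"
    have t: "\<bar>?t\<bar> \<le> \<bar>x i\<bar>" using R by (auto simp: truncate_at_def)
    \<comment> \<open>Rounding shifts by at most 1, which is at most \<open>2 ^ l\<close>; after
      division by \<open>2 ^ l\<close> the level has disappeared from the bound.\<close>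
    have "\<bar>real_of_int \<lfloor>2 ^ l * ?t\<rfloor>\<bar> \<le> \<bar>2 ^ l * ?t\<bar> + 1" by linarith
    also have "\<dots> \<le> 2 ^ l * \<bar>x i\<bar> + 2 ^ l * 1"
      using t by (intro add_mono) (auto simp: abs_mult)
    finally have "\<bar>real_of_int (cell d R l x i) / 2 ^ l\<bar> \<le> \<bar>x i\<bar> + 1"
      using i by (simp add: cell_def field_simps)
    then have "(real_of_int (cell d R l x i) / 2 ^ l)\<^sup>2 \<le> (\<bar>x i\<bar> + 1)\<^sup>2"
      by (simp add: abs_le_square_iff[symmetric])
    also have "\<dots> \<le> 2 * (x i)\<^sup>2 + 2"
      using sum_squares_bound[of "\<bar>x i\<bar>" 1] by (simp add: power2_sum)
    also have "(x i)\<^sup>2 \<le> ?u\<^sup>2"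
      unfolding euclid_norm_sq using i by (intro member_le_sum) auto
    finally show ?thesis by simp
  qed
  then have "cell_weight d l (cell d R l x) \<le> (\<Prod>i<d. 3 + 2 * ?u\<^sup>2)"
    unfolding cell_weight_def by (intro prod_mono) (auto intro: add_nonneg_nonneg)
  also have "\<dots> = (3 + 2 * ?u\<^sup>2) ^ d" by simp
  also have "\<dots> \<le> (5 * real d) ^ d * exp (?u powr \<gamma>)"
  proof (cases "?u \<le> 1")
    case True
    have "?u\<^sup>2 \<le> 1" using True by (simp add: power_le_one)
    then have "(3 + 2 * ?u\<^sup>2) ^ d \<le> (5 * real d) ^ d" using d by (intro power_mono) auto
    also have "\<dots> \<le> (5 * real d) ^ d * exp (?u powr \<gamma>)"
      using mult_left_mono[of 1 "exp (?u powr \<gamma>)" "(5 * real d) ^ d"] by simp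
    finally show ?thesis .
  next
    case False
    then have u: "1 \<le> ?u" by simp
    have "?u\<^sup>2 = ?u powr 2" using u by simp
    also have "\<dots> \<le> ?u powr \<gamma>" using u \<gamma> by (intro powr_mono) auto
    finally have u2: "?u\<^sup>2 \<le> ?u powr \<gamma>" .
    have "1 \<le> ?u\<^sup>2" using u by simp
    then have "(3 + 2 * ?u\<^sup>2) ^ d \<le> (5 * ?u powr \<gamma>) ^ d" using u2 by (intro power_mono) auto
    also have "\<dots> = 5 ^ d * (?u powr \<gamma>) ^ d" by (rule power_mult_distrib)
    also have "\<dots> \<le> 5 ^ d * (real d ^ d * exp (?u powr \<gamma>))"
      using d by (intro mult_left_mono power_le_exp) auto
    finally show ?thesis by (simp add: power_mult_distrib)
  qed
  finally show ?thesis .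
qed

section \<open>Mean and fluctuations of the discrepancies\<close>

lemma (in prob_space) integral_centered_sum_square:
  fixes g :: "'a \<Rightarrow> real"
  assumes [measurable]: "g \<in> borel_measurable M" and bd: "\<And>x. x \<in> space M \<Longrightarrow> \<bar>g x\<bar> \<le> 1" and mean: "expectation g = 0"
  shows "(\<integral>\<omega>. (\<Sum>k<N. g (\<omega> k))\<^sup>2 \<partial>(iid_law N M)) = real N * expectation (\<lambda>x. (g x)\<^sup>2)"
proof (induction N)
  case 0
  show ?case by simp
next
  case (Suc N)
  interpret PM: product_sigma_finite "\<lambda>_. M" by unfold_locales
  interpret P: prob_space "iid_law N M" by (intro prob_space_PiM prob_space_axioms)
  interpret P': prob_space "iid_law (Suc N) M" by (intro prob_space_PiM prob_space_axioms)
  have S: "insert N {..<N} = {..<Suc N}" by auto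
  have sm: "(\<lambda>\<omega>. (\<Sum>k<n. g (\<omega> k))\<^sup>2) \<in> borel_measurable (iid_law n M)" for n by measurable
  have sb: "\<bar>(\<Sum>k<n. g (\<omega> k))\<^sup>2\<bar> \<le> (real n)\<^sup>2" if "\<omega> \<in> space (iid_law n M)" for n \<omega>
  proof -
    have "\<bar>\<Sum>k<n. g (\<omega> k)\<bar> \<le> (\<Sum>k<n. \<bar>g (\<omega> k)\<bar>)" by (rule sum_abs)
    also have "\<dots> \<le> (\<Sum>k<n. 1)" using that by (intro sum_mono bd) (auto simp: space_PiM)
    finally have "\<bar>\<Sum>k<n. g (\<omega> k)\<bar> \<le> real n" by simp
    then show ?thesis by (simp add: abs_le_square_iff[symmetric])
  qed
  have i1: "integrable (iid_law N M) (\<lambda>\<omega>. (\<Sum>k<N. g (\<omega> k))\<^sup>2)"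
    using sb[of _ N] by (intro P.integrable_const_bound[of _ "(real N)\<^sup>2"] sm AE_I2) auto
  have i2: "integrable (iid_law (Suc N) M) (\<lambda>\<omega>. (\<Sum>k<Suc N. g (\<omega> k))\<^sup>2)"
    using sb[of _ "Suc N"] by (intro P'.integrable_const_bound[of _ "(real (Suc N))\<^sup>2"] sm AE_I2) (auto simp del: sum.lessThan_Suc)
  have ig: "integrable M g" by (rule integrable_const_bound[of _ 1]) (use bd in auto)
  have ig2: "integrable M (\<lambda>x. (g x)\<^sup>2)"
    by (rule integrable_const_bound[of _ 1]) (use bd in \<open>auto simp: abs_square_le_1\<close>)
  have "(\<integral>\<omega>. (\<Sum>k<Suc N. g (\<omega> k))\<^sup>2 \<partial>(iid_law (Suc N) M))
      = (\<integral>\<omega>. (\<integral>y. (\<Sum>k<Suc N. g (fun_upd \<omega> N y k))\<^sup>2 \<partial>M) \<partial>(iid_law N M))"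
    using PM.product_integral_insert[of "{..<N}" N "\<lambda>\<omega>. (\<Sum>k<Suc N. g (\<omega> k))\<^sup>2"] i2 unfolding S by simp
  also have "\<dots> = (\<integral>\<omega>. (\<Sum>k<N. g (\<omega> k))\<^sup>2 + expectation (\<lambda>x. (g x)\<^sup>2) \<partial>(iid_law N M))"
  proof (rule Bochner_Integration.integral_cong[OF refl])
    fix \<omega>
    have "(\<Sum>k<Suc N. g (fun_upd \<omega> N y k))\<^sup>2 = (\<Sum>k<N. g (\<omega> k))\<^sup>2 + 2 * (\<Sum>k<N. g (\<omega> k)) * g y + (g y)\<^sup>2" for y
      by (simp add: power2_sum)
    then have "(\<integral>y. (\<Sum>k<Suc N. g (fun_upd \<omega> N y k))\<^sup>2 \<partial>M)
        = (\<integral>y. (\<Sum>k<N. g (\<omega> k))\<^sup>2 + 2 * (\<Sum>k<N. g (\<omega> k)) * g y + (g y)\<^sup>2 \<partial>M)" by simp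
    also have "\<dots> = (\<Sum>k<N. g (\<omega> k))\<^sup>2 + expectation (\<lambda>x. (g x)\<^sup>2)"
      using ig ig2 mean by (simp add: prob_space)
    finally show "(\<integral>y. (\<Sum>k<Suc N. g (fun_upd \<omega> N y k))\<^sup>2 \<partial>M) = (\<Sum>k<N. g (\<omega> k))\<^sup>2 + expectation (\<lambda>x. (g x)\<^sup>2)" .
  qed
  also have "\<dots> = real (Suc N) * expectation (\<lambda>x. (g x)\<^sup>2)"
    using i1 Suc.IH by (simp add: P.prob_space algebra_simps)
  finally show ?case .
qed

lemma (in prob_space) expectation_abs_le_sqrt:
  fixes X :: "'a \<Rightarrow> real"
  assumes X: "integrable M X" "integrable M (\<lambda>x. (X x)\<^sup>2)"
  shows "expectation (\<lambda>x. \<bar>X x\<bar>) \<le> sqrt (expectation (\<lambda>x. (X x)\<^sup>2))"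
proof (rule real_le_rsqrt)
  have "0 \<le> variance (\<lambda>x. \<bar>X x\<bar>)" by (rule variance_positive)
  also have "variance (\<lambda>x. \<bar>X x\<bar>) = expectation (\<lambda>x. (X x)\<^sup>2) - (expectation (\<lambda>x. \<bar>X x\<bar>))\<^sup>2"
    using X by (subst variance_eq) auto
  finally show "(expectation (\<lambda>x. \<bar>X x\<bar>))\<^sup>2 \<le> expectation (\<lambda>x. (X x)\<^sup>2)" by simp
qed

lemma ennreal_power_mono: "(x::ennreal) \<le> y \<Longrightarrow> x ^ n \<le> y ^ n"
  by (induction n) (auto intro: mult_mono)

lemma card_cell_eq_sum:
  fixes N :: nat
  shows "real (card {k\<in>{..<N}. cell d R l (\<omega> k) = c}) = (\<Sum>k<N. indicator {c} (cell d R l (\<omega> k)))"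
  by (simp add: indicator_def Int_def)

context
  fixes d :: nat and R :: real and P :: "(nat \<Rightarrow> real) measure" and N :: nat
  assumes prob: "prob_space P" and setsP: "sets P = sets (Rd d)" and R: "0 \<le> R" and N: "0 < N"
begin

interpretation P: prob_space P by (rule prob)
interpretation PN: prob_space "iid_law N P" by (intro prob_space_PiM prob)

lemma cell_indicator_measurable: "(\<lambda>x. indicator {c} (cell d R l x) :: real) \<in> borel_measurable P"
  by (rule measurable_compose[OF cell_measurable[OF R setsP]]) simp

lemma discrepancy_measurable: "discrepancy d R N P l \<in> borel_measurable (iid_law N P)"
proof -
  have "(\<lambda>\<omega>. indicator {c} (cell d R l (\<omega> k)) :: real) \<in> borel_measurable (iid_law N P)" if "k < N" for c k
    by (rule measurable_compose[OF _ cell_indicator_measurable]) (use that in auto)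
  then show ?thesis
    unfolding discrepancy_def card_cell_eq_sum
    by (intro borel_measurable_sum borel_measurable_abs borel_measurable_diff borel_measurable_divide borel_measurable_const) auto
qed

lemma sum_cells_indicator: "(\<Sum>c\<in>cells d R l. indicator {c} (cell d R l x) :: real) = 1"
proof -
  have "indicator {c} (cell d R l x) = (if cell d R l x = c then 1 else (0::real))" for c
    by (cases "cell d R l x = c") simp_all
  moreover have "cell d R l x \<in> cells d R l" by (rule cell_in_cells[OF R])
  ultimately show ?thesis by simp
qed

lemma sum_cells_prob: "(\<Sum>c\<in>cells d R l. P.prob {x\<in>space P. cell d R l x = c}) = 1"
  using P.sum_fibre_prob[OF cell_measurable[OF R setsP] finite_cells, where G = "\<lambda>_. ()" and c = "()"]
  by (simp add: P.prob_space)

lemma discrepancy_le: "\<bar>discrepancy d R N P l \<omega>\<bar> \<le> 2"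
proof -
  have "discrepancy d R N P l \<omega> \<le> (\<Sum>c\<in>cells d R l. (\<Sum>k<N. indicator {c} (cell d R l (\<omega> k))) / real N
      + P.prob {x\<in>space P. cell d R l x = c})"
    unfolding discrepancy_def card_cell_eq_sum
  proof (rule sum_mono)
    fix c
    have "0 \<le> (\<Sum>k<N. indicator {c} (cell d R l (\<omega> k)) :: real) / real N"
      by (intro divide_nonneg_nonneg sum_nonneg) auto
    then show "\<bar>(\<Sum>k<N. indicator {c} (cell d R l (\<omega> k))) / real N - P.prob {x\<in>space P. cell d R l x = c}\<bar>
      \<le> (\<Sum>k<N. indicator {c} (cell d R l (\<omega> k))) / real N + P.prob {x\<in>space P. cell d R l x = c}"
      using P.prob_space measure_nonneg[of P "{x\<in>space P. cell d R l x = c}"] by linarith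
  qed
  also have "\<dots> = (\<Sum>k<N. \<Sum>c\<in>cells d R l. indicator {c} (cell d R l (\<omega> k))) / real N + 1"
    unfolding sum.distrib sum_cells_prob sum_divide_distrib[symmetric] by (subst sum.swap) simp
  also have "\<dots> = 2" using N by (simp only: sum_cells_indicator) simp
  finally have "discrepancy d R N P l \<omega> \<le> 2" .
  moreover have "0 \<le> discrepancy d R N P l \<omega>" by (simp add: discrepancy_def sum_nonneg)
  ultimately show ?thesis by simp
qed

text \<open>Changing one sample point moves empirical mass \<open>1 / N\<close> from one cell to
  another, so at most two frequencies change.\<close>

lemma discrepancy_fun_upd:
  assumes k: "k < N"
  shows "\<bar>discrepancy d R N P l (fun_upd \<omega> k y) - discrepancy d R N P l \<omega>\<bar> \<le> 2 / real N"
proof -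
  let ?i = "\<lambda>c x. indicator {c} (cell d R l x) :: real"
  let ?s = "\<lambda>c \<omega>. (\<Sum>k<N. ?i c (\<omega> k)) / real N"
  have s: "?s c (fun_upd \<omega> k y) - ?s c \<omega> = (?i c y - ?i c (\<omega> k)) / real N" for c
  proof -
    have "(\<Sum>j\<in>{..<N} - {k}. ?i c ((fun_upd \<omega> k y) j)) = (\<Sum>j\<in>{..<N} - {k}. ?i c (\<omega> j))"
      by (intro sum.cong) auto
    then have "(\<Sum>j<N. ?i c ((fun_upd \<omega> k y) j)) - (\<Sum>j<N. ?i c (\<omega> j)) = ?i c y - ?i c (\<omega> k)"
      using k by (simp add: sum.remove[of "{..<N}" k])
    then show ?thesis by (simp add: diff_divide_distrib[symmetric])
  qed
  have "\<bar>discrepancy d R N P l (fun_upd \<omega> k y) - discrepancy d R N P l \<omega>\<bar>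
      \<le> (\<Sum>c\<in>cells d R l. (?i c y + ?i c (\<omega> k)) / real N)"
    unfolding discrepancy_def card_cell_eq_sum sum_subtractf[symmetric]
  proof (rule order_trans[OF sum_abs], rule sum_mono)
    fix c
    let ?p = "P.prob {x\<in>space P. cell d R l x = c}"
    have "\<bar>\<bar>?s c (fun_upd \<omega> k y) - ?p\<bar> - \<bar>?s c \<omega> - ?p\<bar>\<bar> \<le> \<bar>?s c (fun_upd \<omega> k y) - ?s c \<omega>\<bar>" by linarith
    also have "\<dots> \<le> (?i c y + ?i c (\<omega> k)) / real N"
      unfolding s by (auto simp: indicator_def)
    finally show "\<bar>\<bar>?s c (fun_upd \<omega> k y) - ?p\<bar> - \<bar>?s c \<omega> - ?p\<bar>\<bar> \<le> (?i c y + ?i c (\<omega> k)) / real N" .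
  qed
  also have "\<dots> = 2 / real N"
    unfolding sum_divide_distrib[symmetric] sum.distrib sum_cells_indicator by simp
  finally show ?thesis .
qed

text \<open>The mean absolute deviation is at most the standard deviation, and a cell frequency has
  variance \<open>p * (1 - p) / N\<close>. The bound keeps \<open>sqrt p\<close>, because the sum
  over cells has to exploit that most cells are unlikely.\<close>

lemma expectation_cell_deviation:
  "(\<integral>\<omega>. \<bar>(\<Sum>k<N. indicator {c} (cell d R l (\<omega> k))) / real N - P.prob {x\<in>space P. cell d R l x = c}\<bar> \<partial>(iid_law N P))
    \<le> sqrt (P.prob {x\<in>space P. cell d R l x = c}) / sqrt N"
proof -
  let ?C = "{x\<in>space P. cell d R l x = c}"
  let ?p = "P.prob ?C"
  have C: "?C \<in> sets P"
  proof (cases "c \<in> cells d R l")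
    case True
    then show ?thesis by (rule sets_fibre[OF cell_measurable[OF R setsP]])
  next
    case False
    then have "?C = {}" using cell_in_cells[OF R, of d l] by auto
    then show ?thesis by (simp only: sets.empty_sets)
  qed
  define g where "g x = indicator {c} (cell d R l x) - ?p" for x
  have gm[measurable]: "g \<in> borel_measurable P"
    unfolding g_def using cell_indicator_measurable by (intro borel_measurable_diff borel_measurable_const)
  have gb: "\<bar>g x\<bar> \<le> 1" for x
    using P.prob_le_1[of ?C] measure_nonneg[of P ?C] by (auto simp: g_def indicator_def)
  have ii: "integrable P (\<lambda>x. indicator {c} (cell d R l x) :: real)"
  proof (rule P.integrable_const_bound[of _ 1])
    show "AE x in P. norm (indicator {c} (cell d R l x) :: real) \<le> 1" by (auto simp: indicator_def)
  qed (rule cell_indicator_measurable)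
  have ei: "P.expectation (\<lambda>x. indicator {c} (cell d R l x) :: real) = ?p"
  proof -
    have "P.expectation (\<lambda>x. indicator {c} (cell d R l x) :: real) = P.expectation (indicator ?C)"
      by (intro Bochner_Integration.integral_cong) (auto simp: indicator_def)
    then show ?thesis using C by simp
  qed
  have g0: "P.expectation g = 0" unfolding g_def using ii ei by (simp add: P.prob_space)
  have g2: "P.expectation (\<lambda>x. (g x)\<^sup>2) \<le> ?p"
  proof -
    have "(g x)\<^sup>2 = (1 - 2 * ?p) * indicator {c} (cell d R l x) + ?p\<^sup>2" for x
      by (auto simp: g_def indicator_def power2_eq_square algebra_simps)
    then have "P.expectation (\<lambda>x. (g x)\<^sup>2) = (1 - 2 * ?p) * ?p + ?p\<^sup>2"
      using ii ei by (simp add: P.prob_space)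
    also have "\<dots> = ?p - ?p\<^sup>2" by (simp add: power2_eq_square algebra_simps)
    finally show ?thesis by simp
  qed
  let ?X = "\<lambda>\<omega>. (\<Sum>k<N. indicator {c} (cell d R l (\<omega> k))) / real N - ?p"
  have X: "?X \<omega> = (\<Sum>k<N. g (\<omega> k)) / real N" for \<omega>
    using N by (simp add: g_def sum_subtractf diff_divide_distrib)
  have Xm[measurable]: "?X \<in> borel_measurable (iid_law N P)" unfolding X by measurable
  have Xb: "\<bar>?X \<omega>\<bar> \<le> 1" for \<omega>
  proof -
    have "\<bar>\<Sum>k<N. g (\<omega> k)\<bar> \<le> (\<Sum>k<N. 1)" by (rule order_trans[OF sum_abs]) (intro sum_mono gb)
    then show ?thesis unfolding X using N by simp
  qed
  have Xi: "integrable (iid_law N P) ?X"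
    by (rule PN.integrable_const_bound[of _ 1]) (use Xb in auto)
  have Xi2: "integrable (iid_law N P) (\<lambda>\<omega>. (?X \<omega>)\<^sup>2)"
    by (rule PN.integrable_const_bound[of _ 1]) (use Xb in \<open>auto simp: abs_square_le_1\<close>)
  have "PN.expectation (\<lambda>\<omega>. \<bar>?X \<omega>\<bar>) \<le> sqrt (PN.expectation (\<lambda>\<omega>. (?X \<omega>)\<^sup>2))"
    by (rule PN.expectation_abs_le_sqrt[OF Xi Xi2])
  also have "PN.expectation (\<lambda>\<omega>. (?X \<omega>)\<^sup>2) = PN.expectation (\<lambda>\<omega>. (\<Sum>k<N. g (\<omega> k))\<^sup>2) / (real N)\<^sup>2"
    unfolding X by (simp add: power_divide)
  also have "\<dots> = P.expectation (\<lambda>x. (g x)\<^sup>2) / real N"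
    unfolding P.integral_centered_sum_square[OF gm gb g0] using N by (simp add: power2_eq_square)
  also have "sqrt \<dots> \<le> sqrt (?p / real N)"
    using g2 by (intro real_sqrt_le_mono divide_right_mono) auto
  finally show ?thesis by (simp add: real_sqrt_divide)
qed

context
  fixes \<gamma> \<tau> :: real
  assumes d: "0 < d" and \<gamma>: "2 < \<gamma>" and \<tau>: "0 \<le> \<tau>"
    and moment: "(\<integral>\<^sup>+x. ennreal (exp (euclid_norm d x powr \<gamma>)) \<partial>P) \<le> ennreal \<tau>"
begin

text \<open>Cauchy-Schwarz with the cell weight controls the sum of \<open>sqrt (?p c)\<close>: the
  weighted probabilities are bounded by the exponential moment of \<open>P\<close>, the reciprocal
  weights sum to at most \<open>(5 * 2 ^ l) ^ d\<close>. Each of the two bounds contributes a 5,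
  hence the 25.\<close>

lemma expectation_discrepancy:
  "(\<integral>\<omega>. discrepancy d R N P l \<omega> \<partial>(iid_law N P))
    \<le> sqrt ((25 * real d) ^ d * \<tau>) * sqrt (2 ^ l) ^ d / sqrt N"
proof -
  let ?p = "\<lambda>c. P.prob {x\<in>space P. cell d R l x = c}" and ?W = "cell_weight d l"
  have W: "0 < ?W c" for c by (rule cell_weight_pos)
  have cm: "cell d R l \<in> measurable P (count_space (cells d R l))" by (rule cell_measurable[OF R setsP])
  have em: "(\<lambda>x. ennreal (exp (euclid_norm d x powr \<gamma>))) \<in> borel_measurable P"
  proof -
    have "(\<lambda>x. ennreal (exp (euclid_norm d x powr \<gamma>))) \<in> borel_measurable (Rd d)"
      unfolding euclid_norm_def L2_set_def by measurable
    then show ?thesis using measurable_cong_sets[OF setsP refl] by blast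
  qed
  have pW: "(\<Sum>c\<in>cells d R l. ?p c * ?W c) \<le> (5 * real d) ^ d * \<tau>"
  proof -
    have "ennreal (\<Sum>c\<in>cells d R l. ?p c * ?W c) = (\<Sum>c\<in>cells d R l. ennreal (?W c) * emeasure P {x\<in>space P. cell d R l x = c})"
      using less_imp_le[OF W] by (simp add: P.emeasure_eq_measure ennreal_mult[symmetric] mult.commute)
    also have "\<dots> = (\<integral>\<^sup>+x. ennreal (?W (cell d R l x)) \<partial>P)"
      by (rule nn_integral_finite_range[OF cm finite_cells, symmetric])
    also have "\<dots> \<le> (\<integral>\<^sup>+x. ennreal ((5 * real d) ^ d) * ennreal (exp (euclid_norm d x powr \<gamma>)) \<partial>P)"
      using cell_weight_cell[OF \<gamma> d R] by (intro nn_integral_mono) (simp add: ennreal_mult[symmetric] ennreal_leI)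
    also have "\<dots> = ennreal ((5 * real d) ^ d) * (\<integral>\<^sup>+x. ennreal (exp (euclid_norm d x powr \<gamma>)) \<partial>P)"
      by (rule nn_integral_cmult[OF em])
    also have "\<dots> \<le> ennreal ((5 * real d) ^ d) * ennreal \<tau>" by (intro mult_left_mono moment) auto
    finally show ?thesis using \<tau> by (simp add: ennreal_mult[symmetric])
  qed
  have "(\<Sum>c\<in>cells d R l. sqrt (?p c))\<^sup>2 = (\<Sum>c\<in>cells d R l. sqrt (?p c * ?W c) * sqrt (1 / ?W c))\<^sup>2"
    using W by (simp add: real_sqrt_mult[symmetric] less_imp_neq[symmetric])
  also have "\<dots> \<le> (\<Sum>c\<in>cells d R l. (sqrt (?p c * ?W c))\<^sup>2) * (\<Sum>c\<in>cells d R l. (sqrt (1 / ?W c))\<^sup>2)"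
    by (rule Cauchy_Schwarz_ineq_sum)
  also have "\<dots> = (\<Sum>c\<in>cells d R l. ?p c * ?W c) * (\<Sum>c\<in>cells d R l. 1 / ?W c)"
    using less_imp_le[OF W] by simp
  also have "\<dots> \<le> ((5 * real d) ^ d * \<tau>) * (5 * 2 ^ l) ^ d"
    using pW sum_inverse_cell_weight[OF R, of d l] less_imp_le[OF W] \<tau>
    by (intro mult_mono) (auto intro!: sum_nonneg mult_nonneg_nonneg)
  also have "\<dots> = (25 * real d) ^ d * \<tau> * (2 ^ l) ^ d"
  proof -
    have "(5 * real d) ^ d * (5 * 2 ^ l) ^ d = (25 * real d) ^ d * (2 ^ l) ^ d"
      unfolding power_mult_distrib[symmetric] by (rule arg_cong[where f = "\<lambda>x. x ^ d"]) simp
    from arg_cong[OF this, of "\<lambda>x. \<tau> * x"] show ?thesis by (simp only: mult_ac)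
  qed
  finally have "(\<Sum>c\<in>cells d R l. sqrt (?p c))\<^sup>2 \<le> (25 * real d) ^ d * \<tau> * (2 ^ l) ^ d" .
  then have "(\<Sum>c\<in>cells d R l. sqrt (?p c)) \<le> sqrt ((25 * real d) ^ d * \<tau> * (2 ^ l) ^ d)"
    by (rule real_le_rsqrt)
  then have sp: "(\<Sum>c\<in>cells d R l. sqrt (?p c)) \<le> sqrt ((25 * real d) ^ d * \<tau>) * sqrt (2 ^ l) ^ d"
    by (simp only: real_sqrt_mult real_sqrt_power)
  have i: "integrable (iid_law N P) (\<lambda>\<omega>. \<bar>(\<Sum>k<N. indicator {c} (cell d R l (\<omega> k))) / real N - ?p c\<bar>)" for c
  proof (rule PN.integrable_const_bound[of _ 2])
    have "(\<lambda>\<omega>. indicator {c} (cell d R l (\<omega> k)) :: real) \<in> borel_measurable (iid_law N P)" if "k < N" for k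
      by (rule measurable_compose[OF _ cell_indicator_measurable]) (use that in auto)
    then show "(\<lambda>\<omega>. \<bar>(\<Sum>k<N. indicator {c} (cell d R l (\<omega> k))) / real N - ?p c\<bar>) \<in> borel_measurable (iid_law N P)"
      by (intro borel_measurable_sum borel_measurable_abs borel_measurable_diff borel_measurable_divide borel_measurable_const) auto
    have "\<bar>(\<Sum>k<N. indicator {c} (cell d R l (\<omega> k))) / real N - ?p c\<bar> \<le> 2" for \<omega>
    proof -
      have "(\<Sum>k<N. indicator {c} (cell d R l (\<omega> k)) :: real) \<le> (\<Sum>k<N. 1)" by (intro sum_mono) (auto simp: indicator_def)
      then have "(\<Sum>k<N. indicator {c} (cell d R l (\<omega> k)) :: real) / real N \<le> 1" using N by simp
      moreover have "0 \<le> (\<Sum>k<N. indicator {c} (cell d R l (\<omega> k)) :: real) / real N"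
        by (intro divide_nonneg_nonneg sum_nonneg) auto
      moreover have "0 \<le> ?p c" "?p c \<le> 1" by auto
      ultimately show ?thesis by linarith
    qed
    then show "AE \<omega> in iid_law N P. norm \<bar>(\<Sum>k<N. indicator {c} (cell d R l (\<omega> k))) / real N - ?p c\<bar> \<le> 2"
      by simp
  qed
  have "PN.expectation (discrepancy d R N P l)
      = (\<Sum>c\<in>cells d R l. PN.expectation (\<lambda>\<omega>. \<bar>(\<Sum>k<N. indicator {c} (cell d R l (\<omega> k))) / real N - ?p c\<bar>))"
    unfolding discrepancy_def card_cell_eq_sum by (rule Bochner_Integration.integral_sum[OF i])
  also have "\<dots> \<le> (\<Sum>c\<in>cells d R l. sqrt (?p c) / sqrt N)"
    by (intro sum_mono expectation_cell_deviation)
  also have "\<dots> \<le> (sqrt ((25 * real d) ^ d * \<tau>) * sqrt (2 ^ l) ^ d) / sqrt N"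
    unfolding sum_divide_distrib[symmetric] using sp by (intro divide_right_mono) auto
  finally show ?thesis .
qed

text \<open>McDiarmid's inequality is applied once, to the weighted sum over all levels, which
  avoids a union bound over levels. One sample point changes \<open>f\<close> by at most
  \<open>2 * V / N\<close>, and \<open>b\<close> bounds the mean of \<open>f\<close>.\<close>

lemma weighted_discrepancy_deviation:
  fixes m :: nat and t :: real
  assumes t: "0 < t"
  defines "V \<equiv> \<Sum>l\<le>m. level_weight d R l"
    and "f \<equiv> \<lambda>\<omega>. \<Sum>l\<le>m. level_weight d R l * discrepancy d R N P l \<omega>"
    and "b \<equiv> \<Sum>l\<le>m. level_weight d R l * (sqrt ((25 * real d) ^ d * \<tau>) * sqrt (2 ^ l) ^ d / sqrt N)"
  assumes V: "0 < V"
  shows "f \<in> borel_measurable (iid_law N P)"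
    and "measure (iid_law N P) {\<omega> \<in> space (iid_law N P). b + t \<le> f \<omega>} \<le> exp (- (t\<^sup>2 * N / (2 * V\<^sup>2)))"
proof -
  show fm[measurable]: "f \<in> borel_measurable (iid_law N P)"
    unfolding f_def by (intro borel_measurable_sum borel_measurable_times borel_measurable_const discrepancy_measurable)
  have di: "integrable (iid_law N P) (discrepancy d R N P l)" for l
    by (rule PN.integrable_const_bound[of _ 2]) (use discrepancy_le discrepancy_measurable in auto)
  have "PN.expectation f = (\<Sum>l\<le>m. level_weight d R l * PN.expectation (discrepancy d R N P l))"
    unfolding f_def using di by simp
  also have "\<dots> \<le> b"
    unfolding b_def by (intro sum_mono mult_left_mono expectation_discrepancy) auto
  finally have eb: "PN.expectation f \<le> b" .
  have fB: "\<bar>f \<omega>\<bar> \<le> 2 * V" for \<omega>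
  proof -
    have "\<bar>f \<omega>\<bar> \<le> (\<Sum>l\<le>m. level_weight d R l * 2)"
      unfolding f_def by (rule order_trans[OF sum_abs]) (auto intro!: sum_mono mult_left_mono discrepancy_le simp: abs_mult)
    also have "\<dots> = V * 2" unfolding V_def by (rule sum_distrib_right[symmetric])
    finally show ?thesis by simp
  qed
  have fd: "\<bar>f (fun_upd \<omega> k y) - f \<omega>\<bar> \<le> 2 * V / N" if "k < N" for \<omega> k y
  proof -
    have "\<bar>f (fun_upd \<omega> k y) - f \<omega>\<bar> \<le> (\<Sum>l\<le>m. level_weight d R l * (2 / N))"
      unfolding f_def sum_subtractf[symmetric] right_diff_distrib[symmetric]
    proof (rule order_trans[OF sum_abs], rule sum_mono)
      fix l
      show "\<bar>level_weight d R l * (discrepancy d R N P l (fun_upd \<omega> k y) - discrepancy d R N P l \<omega>)\<bar>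
          \<le> level_weight d R l * (2 / N)"
        unfolding abs_mult abs_of_nonneg[OF level_weight_nonneg]
        by (intro mult_left_mono discrepancy_fun_upd that level_weight_nonneg)
    qed
    also have "\<dots> = V * (2 / N)" unfolding V_def by (rule sum_distrib_right[symmetric])
    finally show ?thesis by (simp add: mult.commute)
  qed
  have "PN.prob {\<omega> \<in> space (iid_law N P). b + t \<le> f \<omega>}
      \<le> PN.prob {\<omega> \<in> space (iid_law N P). PN.expectation f + t \<le> f \<omega>}"
    using eb by (intro PN.finite_measure_mono) auto
  also have "\<dots> \<le> exp (- 2 * t\<^sup>2 / (N * (2 * V / N)\<^sup>2))"
    by (rule P.mcdiarmid[OF N fm _ t]) (use V N fB fd in auto)
  also have "- 2 * t\<^sup>2 / (N * (2 * V / N)\<^sup>2) = - (t\<^sup>2 * N / (2 * V\<^sup>2))"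
    using N V by (simp add: field_simps power2_eq_square)
  finally show "measure (iid_law N P) {\<omega> \<in> space (iid_law N P). b + t \<le> f \<omega>} \<le> exp (- (t\<^sup>2 * N / (2 * V\<^sup>2)))" .
qed

end

text \<open>Chernoff's bound with the parameter fixed at 1, since any scaling can be built into
  \<open>Z\<close>; independence turns the exponential moment of the sum into a product.\<close>

lemma sum_chernoff:
  assumes Z: "Z \<in> borel_measurable P" and b: "(\<integral>\<^sup>+x. ennreal (exp (Z x)) \<partial>P) \<le> ennreal (exp b)"
  shows "measure (iid_law N P) {\<omega> \<in> space (iid_law N P). t \<le> (\<Sum>k<N. Z (\<omega> k))} \<le> exp (real N * b - t)"
proof -
  interpret PM: product_sigma_finite "\<lambda>_. P" by unfold_locales
  have m: "(\<lambda>\<omega>. \<Sum>k<N. Z (\<omega> k)) \<in> borel_measurable (iid_law N P)"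
    using Z by measurable
  have "(\<integral>\<^sup>+\<omega>. ennreal (exp (1 * (\<Sum>k<N. Z (\<omega> k)))) \<partial>(iid_law N P))
      = (\<integral>\<^sup>+\<omega>. (\<Prod>k<N. ennreal (exp (Z (\<omega> k)))) \<partial>(iid_law N P))"
    by (simp add: exp_sum prod_ennreal)
  also have "\<dots> = (\<Prod>k<N. (\<integral>\<^sup>+x. ennreal (exp (Z x)) \<partial>P))"
    using Z by (intro PM.product_nn_integral_prod) auto
  also have "\<dots> \<le> (\<Prod>k<N. ennreal (exp b))"
    using b by (simp add: ennreal_power_mono)
  also have "\<dots> = ennreal (exp (real N * b))"
    by (simp add: ennreal_power exp_of_nat_mult)
  finally have "PN.prob {\<omega> \<in> space (iid_law N P). t \<le> (\<Sum>k<N. Z (\<omega> k))} \<le> exp (real N * b - 1 * t)"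
    by (intro PN.markov_exp[OF m]) auto
  then show ?thesis by simp
qed

end

section \<open>Concentration in Wasserstein distance\<close>

lemma sq_le_exp_powr:
  fixes u \<gamma> :: real
  assumes "0 \<le> u" "2 < \<gamma>"
  shows "u\<^sup>2 \<le> exp (u powr \<gamma>)"
proof (cases "u \<le> 1")
  case True
  then have "u\<^sup>2 \<le> 1" using assms by (simp add: power_le_one)
  also have "1 \<le> exp (u powr \<gamma>)" by simp
  finally show ?thesis .
next
  case False
  then have "u\<^sup>2 = u powr 2" by simp
  also have "\<dots> \<le> u powr \<gamma>" using False assms by (intro powr_mono) auto
  also have "\<dots> \<le> exp (u powr \<gamma>)" using exp_ge_add_one_self[of "u powr \<gamma>"] by linarith
  finally show ?thesis .
qed

text \<open>Above \<open>S\<close> the missing power \<open>2 - \<gamma>\<close> is negative and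
  largest at \<open>S\<close>. If \<open>S powr \<gamma> = s\<close> and the values
  \<open>u powr \<gamma>\<close> are of order \<open>s\<close> on average, both terms are of order
  \<open>S\<^sup>2\<close>.\<close>

lemma sq_le_interpolate:
  fixes u \<gamma> :: real
  assumes "0 \<le> u" "2 < \<gamma>" "0 < S"
  shows "u\<^sup>2 \<le> S\<^sup>2 + u powr \<gamma> * S powr (2 - \<gamma>)"
proof (cases "u \<le> S")
  case True
  then have "u\<^sup>2 \<le> S\<^sup>2" using assms by (intro power_mono) auto
  then show ?thesis by (simp add: add_increasing2)
next
  case False
  then have "u\<^sup>2 = u powr \<gamma> * u powr (2 - \<gamma>)" using assms by (simp add: powr_add[symmetric])
  also have "u powr (2 - \<gamma>) \<le> S powr (2 - \<gamma>)" using False assms by (intro powr_mono2') auto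
  finally have "u\<^sup>2 \<le> u powr \<gamma> * S powr (2 - \<gamma>)" by (simp add: mult_left_mono)
  then show ?thesis by (simp add: add_increasing)
qed

text \<open>Only half of \<open>u powr \<gamma>\<close> is put into the exponent: the other half of
  the available moment yields the small factor \<open>exp (- (R powr \<gamma>) / 2)\<close>. The
  log-moment of the tail is then of order \<open>s\<close>, and so is the average tail of a
  sample.\<close>

definition tail_exponent :: "nat \<Rightarrow> real \<Rightarrow> real \<Rightarrow> (nat \<Rightarrow> real) \<Rightarrow> real" where
  "tail_exponent d \<gamma> R x = (if R < euclid_norm d x then euclid_norm d x powr \<gamma> / 2 else 0)"

lemma tail_sq_le_tail_exponent:
  assumes \<gamma>: "2 < \<gamma>" and R: "1 \<le> R"
  shows "tail_sq d R x \<le> 2 * tail_exponent d \<gamma> R x"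
proof (cases "R < euclid_norm d x")
  case True
  then have "(euclid_norm d x)\<^sup>2 = euclid_norm d x powr 2" using R by simp
  also have "\<dots> \<le> euclid_norm d x powr \<gamma>" using True R \<gamma> by (intro powr_mono) auto
  finally show ?thesis using True by (simp add: tail_sq_def tail_exponent_def)
qed (simp add: tail_sq_def tail_exponent_def)

lemma exp_tail_exponent_le:
  assumes \<gamma>: "2 < \<gamma>" and R: "1 \<le> R" and s: "exp (- (R powr \<gamma>) / 2) \<le> s" and s0: "0 < s"
  shows "exp (tail_exponent d \<gamma> R x) \<le> 1 + s * exp (euclid_norm d x powr \<gamma>)"
proof (cases "R < euclid_norm d x")
  case True
  let ?v = "euclid_norm d x powr \<gamma>"
  have "R powr \<gamma> \<le> ?v" using True R \<gamma> by (intro powr_mono2) auto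
  then have "exp (?v / 2) \<le> exp (- (R powr \<gamma>) / 2 + ?v)" by simp
  also have "\<dots> = exp (- (R powr \<gamma>) / 2) * exp ?v" by (rule exp_add)
  also have "\<dots> \<le> s * exp ?v" using s by (intro mult_right_mono) auto
  finally show ?thesis using True by (simp add: tail_exponent_def)
qed (use s0 in \<open>simp add: tail_exponent_def\<close>)

lemma sum_level_weight:
  assumes "1 \<le> R"
  shows "(\<Sum>l\<le>m. level_weight d R l) \<le> 6 * real d * R\<^sup>2"
proof -
  have "(\<Sum>l\<le>m. level_weight d R l) \<le> 4 * real d * R\<^sup>2 + 2 * real d * (1 - 1 / 4 ^ m)"
  proof (induction m)
    case 0
    then show ?case by (simp add: level_weight_def)
  next
    case (Suc m)
    have "4 * real d / 4 ^ Suc m \<le> 2 * real d * (1 / 4 ^ m - 1 / 4 ^ Suc m)"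
      by (simp add: field_simps)
    then show ?case using Suc by (simp add: level_weight_def algebra_simps)
  qed
  also have "\<dots> \<le> 4 * real d * R\<^sup>2 + 2 * real d * R\<^sup>2"
  proof -
    have "1 - 1 / (4::real) ^ m \<le> 1" by simp
    also have "1 \<le> R\<^sup>2" using assms by simp
    finally show ?thesis by (intro add_left_mono mult_left_mono) auto
  qed
  finally show ?thesis by simp
qed

lemma sum_geometric_le:
  fixes q :: real
  assumes q: "sqrt 2 \<le> q"
  shows "(\<Sum>l\<le>m. q ^ l) \<le> 4 * q ^ m"
proof (induction m)
  case (Suc m)
  \<comment> \<open>The induction step needs \<open>4 + q \<le> 4 * q\<close>, that is,
    \<open>4 / 3 \<le> q\<close>.\<close>
  have "4 / 3 \<le> sqrt (2::real)" by (rule real_le_rsqrt) (simp add: power2_eq_square)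
  then have "4 / 3 \<le> q" using q by simp
  then have "4 * q ^ m + q ^ m * q \<le> 4 * (q ^ m * q)"
    using mult_left_mono[of "4 / 3" q "q ^ m"] by simp
  then show ?case using Suc by (simp add: mult.commute)
qed simp

text \<open>
  For \<open>4 < d\<close> the finest level dominates this sum: the cell count \<open>2\<^sup>l\<^sup>d\<close> beats the
  squared cell diameter \<open>4\<^sup>-\<^sup>l\<close> even after taking the square root.
\<close>

lemma sum_level_weight_cells:
  assumes d: "4 < d" and \<sigma>: "0 < \<sigma>" and m: "1 / \<sigma> \<le> 2 ^ m" "2 ^ m \<le> 2 / \<sigma>"
  shows "sqrt \<sigma> ^ d * (\<Sum>l\<le>m. level_weight d R l * sqrt (2 ^ l) ^ d)
    \<le> 4 * real d * R\<^sup>2 * sqrt \<sigma> ^ d + 16 * real d * sqrt 2 ^ d * \<sigma>\<^sup>2"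
proof -
  \<comment> \<open>The growth from one level to the next of the weight times the root of the cell
    count; already \<open>d = 5\<close> gives exactly \<open>sqrt 2\<close>.\<close>
  define q where "q = sqrt 2 ^ d / (4::real)"
  have "sqrt 2 ^ 5 \<le> sqrt (2::real) ^ d" using d by (intro power_increasing) auto
  moreover have "sqrt 2 ^ 5 = 4 * sqrt (2::real)" by (simp add: eval_nat_numeral)
  ultimately have q: "sqrt 2 \<le> q" by (simp add: q_def)
  have ql: "q ^ l = sqrt (2 ^ l) ^ d / 4 ^ l" for l
    by (simp add: q_def power_divide real_sqrt_power power_mult[symmetric] mult.commute)
  have "level_weight d R l * sqrt (2 ^ l) ^ d \<le> (if l = 0 then 4 * real d * R\<^sup>2 else 0) + 4 * real d * q ^ l" for l
  proof (cases "l = 0")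
    case False
    then have "level_weight d R l * sqrt (2 ^ l) ^ d = 4 * real d * q ^ l" by (simp add: level_weight_def ql)
    then show ?thesis using False by simp
  qed (simp add: level_weight_def)
  then have "(\<Sum>l\<le>m. level_weight d R l * sqrt (2 ^ l) ^ d)
      \<le> (\<Sum>l\<le>m. (if l = 0 then 4 * real d * R\<^sup>2 else 0) + 4 * real d * q ^ l)"
    by (intro sum_mono)
  also have "\<dots> = 4 * real d * R\<^sup>2 + 4 * real d * (\<Sum>l\<le>m. q ^ l)"
    by (simp add: sum.distrib sum_distrib_left)
  also have "\<dots> \<le> 4 * real d * R\<^sup>2 + 4 * real d * (4 * q ^ m)"
    by (intro add_left_mono mult_left_mono sum_geometric_le q) auto
  finally have "sqrt \<sigma> ^ d * (\<Sum>l\<le>m. level_weight d R l * sqrt (2 ^ l) ^ d)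
      \<le> sqrt \<sigma> ^ d * (4 * real d * R\<^sup>2 + 4 * real d * (4 * q ^ m))"
    using \<sigma> by (intro mult_left_mono) auto
  also have "\<dots> = 4 * real d * R\<^sup>2 * sqrt \<sigma> ^ d + 16 * real d * (sqrt \<sigma> ^ d * q ^ m)"
    by (simp add: algebra_simps)
  also have "sqrt \<sigma> ^ d * q ^ m \<le> sqrt 2 ^ d * \<sigma>\<^sup>2"
  proof -
    have "sqrt \<sigma> ^ d * q ^ m = sqrt (\<sigma> * 2 ^ m) ^ d * (1 / 4 ^ m)"
      by (simp add: ql real_sqrt_mult power_mult_distrib)
    also have "\<dots> \<le> sqrt 2 ^ d * \<sigma>\<^sup>2"
    proof (intro mult_mono power_mono real_sqrt_le_mono)
      show "\<sigma> * 2 ^ m \<le> 2" using m(2) \<sigma> by (simp add: field_simps)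
      have "(1 / \<sigma>)\<^sup>2 \<le> (2 ^ m)\<^sup>2" using m(1) \<sigma> by (intro power_mono) auto
      also have "(2 ^ m)\<^sup>2 = (4::real) ^ m" by (simp add: power2_eq_square power_mult_distrib[symmetric])
      finally show "1 / 4 ^ m \<le> \<sigma>\<^sup>2" using \<sigma> by (simp add: field_simps)
    qed (use \<sigma> in auto)
    finally show ?thesis .
  qed
  then have "16 * real d * (sqrt \<sigma> ^ d * q ^ m) \<le> 16 * real d * (sqrt 2 ^ d * \<sigma>\<^sup>2)" by (intro mult_left_mono) auto
  finally show ?thesis by (simp add: mult.assoc)
qed

lemma dyadic_scale:
  fixes y :: real
  assumes "1 \<le> y"
  obtains m :: nat where "y \<le> 2 ^ m" "2 ^ m \<le> 2 * y"
proof -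
  define m where "m = nat \<lceil>log 2 y\<rceil>"
  have l: "0 \<le> log 2 y" using assms by simp
  then have m: "real m = of_int \<lceil>log 2 y\<rceil>" by (simp add: m_def)
  have p: "2 ^ m = 2 powr real m" by (simp add: powr_realpow)
  have "y = 2 powr log 2 y" using assms by simp
  also have "\<dots> \<le> 2 ^ m" unfolding p m by (intro powr_mono) auto
  finally have 1: "y \<le> 2 ^ m" .
  have "2 ^ m \<le> 2 powr (log 2 y + 1)" unfolding p m by (intro powr_mono) linarith+
  also have "\<dots> = 2 * y" using assms by (simp add: powr_add)
  finally show thesis using 1 that by blast
qed

lemma (in prob_space) prob_both_less:
  fixes f g :: "'a \<Rightarrow> real"
  assumes [measurable]: "f \<in> borel_measurable M" "g \<in> borel_measurable M"
    and "prob {x\<in>space M. a \<le> f x} \<le> p" "prob {x\<in>space M. b \<le> g x} \<le> q"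
  shows "1 - (p + q) \<le> prob {x\<in>space M. f x < a \<and> g x < b}"
proof -
  let ?A = "{x\<in>space M. a \<le> f x}" and ?B = "{x\<in>space M. b \<le> g x}"
  have "{x\<in>space M. f x < a \<and> g x < b} = space M - (?A \<union> ?B)" by auto
  then have "prob {x\<in>space M. f x < a \<and> g x < b} = 1 - prob (?A \<union> ?B)"
    by (simp add: prob_compl)
  moreover have "prob (?A \<union> ?B) \<le> prob ?A + prob ?B" by (rule measure_Un_le) measurable
  ultimately show ?thesis using assms(3,4) by linarith
qed

text \<open>The exponent 1/10 is the gap between 1/2 and 2/5: multiplied by \<open>sqrt s\<close>
  the right-hand side becomes a multiple of \<open>s powr (2 / 5)\<close>, which is at most that of
  \<open>s powr (2 / real d)\<close> as soon as \<open>d \<ge> 5\<close>.\<close>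

lemma ln_inverse_le_powr:
  fixes s :: real
  assumes "0 < s" "s \<le> 1"
  shows "1 + 2 * ln (1 / s) \<le> 21 * s powr (- 1 / 10)"
proof -
  let ?z = "s powr (- 1 / 10)"
  have z: "1 \<le> ?z" using assms powr_mono2'[of "- 1 / 10" s 1] by simp
  have "ln ?z = ln (1 / s) / 10" using assms by (simp add: ln_powr ln_div)
  then have "ln (1 / s) = 10 * ln ?z" by simp
  also have "\<dots> \<le> 10 * (?z - 1)"
    by (rule mult_left_mono[OF ln_le_minus_one]) (use z in linarith)+
  finally show ?thesis using z by simp
qed

text \<open>The factor of s^(2/d) in the squared distance; the leading 3 comes from splitting the
  distance at the clipped points. The summands are the sample tail, the true tail, \<open>d\<close>
  for the finest cells with \<open>189 * d\<close> for the fluctuation, and the mean discrepancy,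
  where 84 is 4 times the 21 of the logarithm estimate.\<close>

definition small_const :: "nat \<Rightarrow> real \<Rightarrow> real" where
  "small_const d \<tau> = 3 * (2 * (\<tau> + 1) + 2 * \<tau> + 190 * real d
     + sqrt ((25 * real d) ^ d * \<tau>) * (84 * real d + 16 * real d * sqrt 2 ^ d))"

lemma small_const_nonneg: "0 < \<tau> \<Longrightarrow> 0 \<le> small_const d \<tau>"
  by (simp add: small_const_def)

text \<open>The factor of s^(2/\<gamma>) in the squared distance for all levels above the argument
  \<open>s\<close>: quantities of constant size are divided by that power of the lower
  bound.\<close>

definition large_const :: "nat \<Rightarrow> real \<Rightarrow> real \<Rightarrow> real \<Rightarrow> real" where
  "large_const d \<gamma> \<tau> s = 3 * (2 + ln (max 1 \<tau>) / s + (\<tau> + real d) / s powr (2 / \<gamma>))"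

lemma large_const_nonneg: "0 < \<tau> \<Longrightarrow> 0 < s \<Longrightarrow> 0 \<le> large_const d \<gamma> \<tau> s"
  by (simp add: large_const_def)

locale light_tailed_law =
  fixes d :: nat and \<gamma> \<tau> :: real and P :: "(nat \<Rightarrow> real) measure"
  assumes d: "4 < d" and \<gamma>: "2 < \<gamma>" and \<tau>: "0 < \<tau>" and law: "P \<in> zero_mean_laws d"
    and moment: "(\<integral>\<^sup>+x. ennreal (exp (euclid_norm d x powr \<gamma>)) \<partial>P) \<le> ennreal \<tau>"
begin

lemma prob: "prob_space P" and setsP: "sets P = sets (Rd d)"
  using law by (auto simp: zero_mean_laws_def)

sublocale P: prob_space P by (rule prob)

lemma euclid_norm_measurable [measurable]: "euclid_norm d \<in> borel_measurable P"
proof -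
  have "euclid_norm d \<in> borel_measurable (Rd d)" unfolding euclid_norm_def L2_set_def by measurable
  then show ?thesis using measurable_cong_sets[OF setsP refl] by blast
qed

lemma integrable_product:
  assumes "i < d" "j < d"
  shows "integrable P (\<lambda>\<xi>. \<xi> i * \<xi> j)"
proof (rule integrableI_bounded)
  show "(\<lambda>\<xi>. \<xi> i * \<xi> j) \<in> borel_measurable P"
    using assms setsP by (intro borel_measurable_times coordinate_measurable)
  have "(\<integral>\<^sup>+\<xi>. ennreal (norm (\<xi> i * \<xi> j)) \<partial>P) \<le> (\<integral>\<^sup>+x. ennreal (exp (euclid_norm d x powr \<gamma>)) \<partial>P)"
  proof (intro nn_integral_mono ennreal_leI)
    fix \<xi> :: "nat \<Rightarrow> real"
    have c: "\<bar>\<xi> k\<bar> \<le> euclid_norm d \<xi>" if "k < d" for k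
    proof -
      have "sqrt ((\<xi> k)\<^sup>2) \<le> euclid_norm d \<xi>"
        unfolding euclid_norm_def L2_set_def using that by (intro real_sqrt_le_mono member_le_sum) auto
      then show ?thesis by simp
    qed
    have "norm (\<xi> i * \<xi> j) \<le> euclid_norm d \<xi> * euclid_norm d \<xi>"
      unfolding real_norm_def abs_mult using c assms by (intro mult_mono) auto
    also have "\<dots> \<le> exp (euclid_norm d \<xi> powr \<gamma>)"
      using sq_le_exp_powr[OF _ \<gamma>, of "euclid_norm d \<xi>"] by (simp add: power2_eq_square)
    finally show "norm (\<xi> i * \<xi> j) \<le> exp (euclid_norm d \<xi> powr \<gamma>)" .
  qed
  also have "\<dots> < \<infinity>" using moment by (simp add: le_less_trans)
  finally show "(\<integral>\<^sup>+\<xi>. ennreal (norm (\<xi> i * \<xi> j)) \<partial>P) < \<infinity>" .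
qed

text \<open>Every scale is chosen so that each of the two failures has probability at most
  \<open>exp (- (s * N))\<close> and each contribution to the squared distance is of order
  \<open>\<sigma>\<^sup>2\<close>, where \<open>\<sigma> = s powr (1 / real d)\<close>.\<close>

lemma concentration_small:
  assumes N: "0 < N" and s: "0 < s" "s \<le> 1" "1 \<le> s * real N"
  shows "\<exists>E \<in> sets (iid_law N P). 1 - 2 * exp (- (s * real N)) \<le> measure (iid_law N P) E \<and>
    (\<forall>\<omega>\<in>E. wasserstein2 d (centered_empirical d N \<omega>) P \<le> ennreal (sqrt (small_const d \<tau>) * s powr (1 / real d)))"
proof -
  interpret PN: prob_space "iid_law N P" by (intro prob_space_PiM prob)
  have d0: "0 < d" using d by simp
  have \<tau>0: "0 \<le> \<tau>" using \<tau> by simp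
  define \<sigma> where "\<sigma> = s powr (1 / real d)"
  have \<sigma>: "0 < \<sigma>" "\<sigma> \<le> 1" using s by (auto simp: \<sigma>_def powr_le1)
  have \<sigma>d: "\<sigma> ^ d = s" using s d0 by (simp add: \<sigma>_def powr_realpow[symmetric] powr_powr)
  have \<sigma>2: "\<sigma>\<^sup>2 = s powr (2 / real d)" using s by (simp add: \<sigma>_def power2_eq_square powr_add[symmetric])
  have s\<sigma>: "s \<le> \<sigma>\<^sup>2" unfolding \<sigma>d[symmetric] using \<sigma> d by (intro power_decreasing) auto
  have sqs: "sqrt s = sqrt \<sigma> ^ d" by (simp add: \<sigma>d[symmetric] real_sqrt_power)
  \<comment> \<open>Large enough for \<open>exp (- (R powr \<gamma>) / 2) \<le> s\<close>, yet only
    logarithmic in \<open>1 / s\<close>; the summand 1 ensures \<open>1 \<le> R\<close>.\<close>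
  define R where "R = (1 + 2 * ln (1 / s)) powr (1 / \<gamma>)"
  have ls: "0 \<le> ln (1 / s)" using s by simp
  have R\<gamma>: "R powr \<gamma> = 1 + 2 * ln (1 / s)" using ls \<gamma> by (simp add: R_def powr_powr)
  have R: "1 \<le> R" using ls \<gamma> by (simp add: R_def ge_one_powr_ge_zero)
  then have R0: "0 \<le> R" by simp
  have "- (R powr \<gamma>) / 2 = - 1 / 2 + ln s" unfolding R\<gamma> using s by (simp add: ln_div)
  then have "exp (- (R powr \<gamma>) / 2) = exp (- 1 / 2) * s" using s by (simp only: exp_add exp_ln)
  also have "\<dots> \<le> 1 * s" using s by (intro mult_right_mono) auto
  finally have Rs: "exp (- (R powr \<gamma>) / 2) \<le> s" by simp
  have R2: "R\<^sup>2 * sqrt s \<le> 21 * \<sigma>\<^sup>2"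
  proof -
    have "R\<^sup>2 = R powr 2" using R by simp
    also have "\<dots> \<le> R powr \<gamma>" using R \<gamma> by (intro powr_mono) auto
    also have "\<dots> \<le> 21 * s powr (- 1 / 10)" unfolding R\<gamma> using s(1,2) by (rule ln_inverse_le_powr)
    finally have "R\<^sup>2 * sqrt s \<le> 21 * s powr (- 1 / 10) * s powr (1 / 2)"
      using s by (simp add: powr_half_sqrt mult_right_mono)
    also have "\<dots> = 21 * s powr (2 / 5)" using s by (simp add: powr_add[symmetric])
    also have "\<dots> \<le> 21 * s powr (2 / real d)"
      using s d by (intro mult_left_mono powr_mono') (auto simp: field_simps)
    finally show ?thesis by (simp add: \<sigma>2)
  qed
  \<comment> \<open>The finest cells have side between \<open>\<sigma> / 2\<close> and
    \<open>\<sigma>\<close>, where the resolution error and the contribution of the cell count have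
    the same order.\<close>
  obtain m where "1 / \<sigma> \<le> 2 ^ m" "2 ^ m \<le> 2 * (1 / \<sigma>)"
    using dyadic_scale[of "1 / \<sigma>"] \<sigma> by auto
  then have m: "1 / \<sigma> \<le> 2 ^ m" "2 ^ m \<le> 2 / \<sigma>" by auto
  define V where "V = (\<Sum>l\<le>m. level_weight d R l)"
  have V6: "V \<le> 6 * real d * R\<^sup>2" unfolding V_def by (rule sum_level_weight[OF R])
  have "level_weight d R 0 \<le> V" unfolding V_def by (rule member_le_sum) auto
  then have V: "0 < V" using R d0 by (simp add: level_weight_def order_less_le_trans[rotated])
  \<comment> \<open>Chosen to make the McDiarmid exponent
    \<open>t\<^sup>2 * N / (2 * V\<^sup>2)\<close> equal to \<open>s * N\<close>.\<close>
  define t where "t = V * sqrt (2 * s)"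
  have t: "0 < t" using V s by (simp add: t_def)
  have t2: "t\<^sup>2 * N / (2 * V\<^sup>2) = s * N" using V s by (simp add: t_def power_mult_distrib)
  have t\<sigma>: "t \<le> 189 * real d * \<sigma>\<^sup>2"
  proof -
    have "sqrt 2 \<le> (3 / 2 :: real)" by (rule real_le_lsqrt) (simp_all add: power2_eq_square)
    then have "t \<le> (6 * real d * R\<^sup>2) * (3 / 2 * sqrt s)"
      unfolding t_def real_sqrt_mult using V6 V s by (intro mult_mono) auto
    also have "\<dots> = 9 * real d * (R\<^sup>2 * sqrt s)" by simp
    also have "\<dots> \<le> 9 * real d * (21 * \<sigma>\<^sup>2)" by (intro mult_left_mono R2) simp
    finally show ?thesis by simp
  qed
  define A where "A = sqrt ((25 * real d) ^ d * \<tau>)"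
  have A: "0 \<le> A" using \<tau> by (simp add: A_def)
  define f where "f = (\<lambda>\<omega>. \<Sum>l\<le>m. level_weight d R l * discrepancy d R N P l \<omega>)"
  define b where "b = (\<Sum>l\<le>m. level_weight d R l * (A * sqrt (2 ^ l) ^ d / sqrt N))"
  have b\<sigma>: "b \<le> A * (84 * real d + 16 * real d * sqrt 2 ^ d) * \<sigma>\<^sup>2"
  proof -
    \<comment> \<open>The condition \<open>1 \<le> s * N\<close> turns the sampling rate into
      \<open>sqrt s = sqrt \<sigma> ^ d\<close>, the prefactor with which the sum over levels was
      estimated.\<close>
    have "1 / sqrt N \<le> sqrt s"
    proof -
      have "1 \<le> sqrt (s * N)" using s(3) by simp
      then show ?thesis using N by (simp add: real_sqrt_mult field_simps)
    qed
    have "b = A * (\<Sum>l\<le>m. level_weight d R l * sqrt (2 ^ l) ^ d) * (1 / sqrt N)"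
      by (simp add: b_def sum_distrib_left sum_distrib_right mult_ac)
    also have "\<dots> \<le> A * (\<Sum>l\<le>m. level_weight d R l * sqrt (2 ^ l) ^ d) * sqrt s"
      using A \<open>1 / sqrt N \<le> sqrt s\<close> by (intro mult_left_mono mult_nonneg_nonneg sum_nonneg) auto
    also have "\<dots> = A * (sqrt \<sigma> ^ d * (\<Sum>l\<le>m. level_weight d R l * sqrt (2 ^ l) ^ d))"
      by (simp add: sqs mult_ac)
    also have "\<dots> \<le> A * (4 * real d * R\<^sup>2 * sqrt \<sigma> ^ d + 16 * real d * sqrt 2 ^ d * \<sigma>\<^sup>2)"
      by (intro mult_left_mono sum_level_weight_cells d \<sigma> m A)
    also have "\<dots> \<le> A * (4 * real d * (21 * \<sigma>\<^sup>2) + 16 * real d * sqrt 2 ^ d * \<sigma>\<^sup>2)"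
      using mult_left_mono[OF R2, of "4 * real d"] A
      by (intro mult_left_mono add_right_mono) (auto simp: sqs mult_ac)
    also have "\<dots> = A * (84 * real d + 16 * real d * sqrt 2 ^ d) * \<sigma>\<^sup>2" by (simp add: algebra_simps)
    finally show ?thesis .
  qed
  have fm: "f \<in> borel_measurable (iid_law N P)"
    and fp: "PN.prob {\<omega> \<in> space (iid_law N P). b + t \<le> f \<omega>} \<le> exp (- (s * N))"
    using weighted_discrepancy_deviation[OF prob setsP R0 N d0 \<gamma> \<tau>0 moment t, of m] V
    unfolding f_def b_def A_def V_def[symmetric] t2 by auto
  define Z where "Z = tail_exponent d \<gamma> R"
  have Zm: "Z \<in> borel_measurable P" unfolding Z_def tail_exponent_def by measurable
  have expZ: "exp (Z x) \<le> 1 + s * exp (euclid_norm d x powr \<gamma>)" for x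
    unfolding Z_def by (rule exp_tail_exponent_le[OF \<gamma> R Rs s(1)])
  have tZ: "tail_sq d R x \<le> 2 * Z x" for x unfolding Z_def by (rule tail_sq_le_tail_exponent[OF \<gamma> R])
  have sm: "(\<integral>\<^sup>+x. ennreal s * ennreal (exp (euclid_norm d x powr \<gamma>)) \<partial>P) \<le> ennreal (s * \<tau>)"
  proof -
    have "(\<integral>\<^sup>+x. ennreal s * ennreal (exp (euclid_norm d x powr \<gamma>)) \<partial>P)
        = ennreal s * (\<integral>\<^sup>+x. ennreal (exp (euclid_norm d x powr \<gamma>)) \<partial>P)"
      by (rule nn_integral_cmult) measurable
    also have "\<dots> \<le> ennreal s * ennreal \<tau>" by (intro mult_left_mono moment) auto
    finally show ?thesis using s by (simp add: ennreal_mult'[symmetric])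
  qed
  have "(\<integral>\<^sup>+x. ennreal (exp (Z x)) \<partial>P) \<le> (\<integral>\<^sup>+x. 1 + ennreal s * ennreal (exp (euclid_norm d x powr \<gamma>)) \<partial>P)"
  proof (rule nn_integral_mono)
    fix x
    have "ennreal (exp (Z x)) \<le> ennreal (1 + s * exp (euclid_norm d x powr \<gamma>))" using expZ by (rule ennreal_leI)
    also have "\<dots> = 1 + ennreal s * ennreal (exp (euclid_norm d x powr \<gamma>))"
      using s by (simp add: ennreal_plus ennreal_mult)
    finally show "ennreal (exp (Z x)) \<le> 1 + ennreal s * ennreal (exp (euclid_norm d x powr \<gamma>))" .
  qed
  also have "\<dots> = 1 + (\<integral>\<^sup>+x. ennreal s * ennreal (exp (euclid_norm d x powr \<gamma>)) \<partial>P)"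
    by (subst nn_integral_add) (auto simp: P.emeasure_space_1)
  also have "\<dots> \<le> 1 + ennreal (s * \<tau>)" by (intro add_left_mono sm)
  also have "\<dots> = ennreal (1 + s * \<tau>)" using s \<tau> by (simp add: ennreal_plus)
  also have "\<dots> \<le> ennreal (exp (s * \<tau>))" by (intro ennreal_leI exp_ge_add_one_self)
  finally have eZ: "(\<integral>\<^sup>+x. ennreal (exp (Z x)) \<partial>P) \<le> ennreal (exp (s * \<tau>))" .
  have tail: "(\<integral>\<^sup>+x. ennreal (tail_sq d R x) \<partial>P) \<le> ennreal (2 * (s * \<tau>))"
  proof -
    have "(\<integral>\<^sup>+x. ennreal (tail_sq d R x) \<partial>P) \<le> (\<integral>\<^sup>+x. ennreal 2 * (ennreal s * ennreal (exp (euclid_norm d x powr \<gamma>))) \<partial>P)"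
    proof (rule nn_integral_mono)
      fix x
      \<comment> \<open>The inequality \<open>1 + Z x \<le> exp (Z x)\<close> turns the bound on the
        exponential into one for \<open>Z\<close> itself, hence for the tail.\<close>
      have "tail_sq d R x \<le> 2 * (s * exp (euclid_norm d x powr \<gamma>))"
        using tZ[of x] expZ[of x] exp_ge_add_one_self[of "Z x"] by linarith
      then have "ennreal (tail_sq d R x) \<le> ennreal (2 * (s * exp (euclid_norm d x powr \<gamma>)))" by (rule ennreal_leI)
      then show "ennreal (tail_sq d R x) \<le> ennreal 2 * (ennreal s * ennreal (exp (euclid_norm d x powr \<gamma>)))"
        using s by (simp add: ennreal_mult)
    qed
    also have "\<dots> = ennreal 2 * (\<integral>\<^sup>+x. ennreal s * ennreal (exp (euclid_norm d x powr \<gamma>)) \<partial>P)"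
      by (rule nn_integral_cmult) measurable
    also have "\<dots> \<le> ennreal 2 * ennreal (s * \<tau>)" by (intro mult_left_mono sm) auto
    also have "\<dots> = ennreal (2 * (s * \<tau>))" using s \<tau> by (simp only: ennreal_mult''[symmetric] mult_nonneg_nonneg less_imp_le)
    finally show ?thesis .
  qed
  define g where "g = (\<lambda>\<omega>. \<Sum>k<N. Z (\<omega> k))"
  have gm: "g \<in> borel_measurable (iid_law N P)" unfolding g_def using Zm by measurable
  \<comment> \<open>The threshold is the log-moment \<open>N * (s * \<tau>)\<close> of the whole sum
    plus the excess \<open>s * N\<close>, which becomes the exponent of the probability.\<close>
  have gp: "PN.prob {\<omega> \<in> space (iid_law N P). real N * (s * \<tau>) + s * N \<le> g \<omega>} \<le> exp (- (s * N))"
    using sum_chernoff[OF prob setsP R0 N Zm eZ, of "real N * (s * \<tau>) + s * N"] by (simp add: g_def)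
  define E where "E = {\<omega> \<in> space (iid_law N P). f \<omega> < b + t \<and> g \<omega> < real N * (s * \<tau>) + s * N}"
  have "E \<in> sets (iid_law N P)" unfolding E_def using fm gm by measurable
  moreover have "1 - 2 * exp (- (s * N)) \<le> PN.prob E"
    using PN.prob_both_less[OF fm gm fp gp] by (simp add: E_def)
  moreover have "wasserstein2 d (centered_empirical d N \<omega>) P \<le> ennreal (sqrt (small_const d \<tau>) * s powr (1 / real d))"
    if \<omega>: "\<omega> \<in> E" for \<omega>
  proof (rule wasserstein2_discrepancy[OF N law R0 _ tail, where m = m])
    show "integrable P (\<lambda>\<xi>. \<xi> i * \<xi> i)" if "i < d" for i using that that by (rule integrable_product)
    show "0 \<le> 2 * (s * \<tau>)" using s \<tau> by simp
    show "0 \<le> sqrt (small_const d \<tau>) * s powr (1 / real d)" using small_const_nonneg[OF \<tau>] by simp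
    have f: "f \<omega> \<le> b + t" and g: "g \<omega> \<le> real N * (s * \<tau>) + s * N" using \<omega> by (auto simp: E_def)
    have "(\<Sum>k<N. tail_sq d R (\<omega> k)) \<le> (\<Sum>k<N. 2 * Z (\<omega> k))" by (intro sum_mono tZ)
    also have "\<dots> = 2 * g \<omega>" by (simp add: g_def sum_distrib_left)
    also have "\<dots> \<le> 2 * (\<tau> + 1) * s * N" using g by (simp add: algebra_simps)
    finally have 1: "(\<Sum>k<N. tail_sq d R (\<omega> k)) / N \<le> 2 * (\<tau> + 1) * s" using N by (simp add: divide_le_eq)
    have 2: "2 * (\<tau> + 1) * s \<le> 2 * (\<tau> + 1) * \<sigma>\<^sup>2" "2 * \<tau> * s \<le> 2 * \<tau> * \<sigma>\<^sup>2"
      using s\<sigma> \<tau> by (auto intro!: mult_left_mono)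
    have 3: "real d / 4 ^ m \<le> real d * \<sigma>\<^sup>2"
    proof -
      have "(1 / \<sigma>)\<^sup>2 \<le> (2 ^ m)\<^sup>2" using m(1) \<sigma> by (intro power_mono) auto
      also have "(2 ^ m)\<^sup>2 = (4::real) ^ m" by (simp add: power2_eq_square power_mult_distrib[symmetric])
      finally have "1 / 4 ^ m \<le> \<sigma>\<^sup>2" using \<sigma> by (simp add: field_simps)
      from mult_left_mono[OF this, of "real d"] show ?thesis by simp
    qed
    have "3 * ((\<Sum>k<N. tail_sq d R (\<omega> k)) / N + 2 * (s * \<tau>) + real d / 4 ^ m + f \<omega>)
        \<le> 3 * (2 * (\<tau> + 1) * \<sigma>\<^sup>2 + 2 * \<tau> * \<sigma>\<^sup>2 + real d * \<sigma>\<^sup>2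
          + (A * (84 * real d + 16 * real d * sqrt 2 ^ d) * \<sigma>\<^sup>2 + 189 * real d * \<sigma>\<^sup>2))"
    proof -
      have 4: "2 * (s * \<tau>) \<le> 2 * \<tau> * \<sigma>\<^sup>2" using 2(2) by (simp add: mult_ac)
      show ?thesis
        by (intro mult_left_mono add_mono order_trans[OF 1 2(1)] 3 4 order_trans[OF f add_mono[OF b\<sigma> t\<sigma>]]) simp
    qed
    also have "\<dots> = small_const d \<tau> * \<sigma>\<^sup>2"
      unfolding small_const_def A_def[symmetric] by (simp add: algebra_simps)
    also have "\<dots> = (sqrt (small_const d \<tau>) * s powr (1 / real d))\<^sup>2"
      using small_const_nonneg[OF \<tau>] by (simp add: power_mult_distrib \<sigma>_def)
    finally show "3 * ((\<Sum>k<N. tail_sq d R (\<omega> k)) / real N + 2 * (s * \<tau>) + real d / 4 ^ m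
      + (\<Sum>l\<le>m. level_weight d R l * discrepancy d R N P l \<omega>)) \<le> (sqrt (small_const d \<tau>) * s powr (1 / real d))\<^sup>2"
      by (simp add: f_def)
  qed
  ultimately show ?thesis by blast
qed

text \<open>Above \<open>s0\<close> the target distance is bounded below, so no resolution is
  required: clipping at 0 puts all points into a single cell, and transport is charged to second
  moments. The sample second moment is controlled by a Chernoff bound for the sum of
  \<open>euclid_norm d x powr \<gamma>\<close>.\<close>

lemma concentration_large:
  assumes N: "0 < N" and s0: "0 < s0" and s: "s0 \<le> s"
  shows "\<exists>E \<in> sets (iid_law N P). 1 - 2 * exp (- (s * real N)) \<le> measure (iid_law N P) E \<and>
    (\<forall>\<omega>\<in>E. wasserstein2 d (centered_empirical d N \<omega>) P \<le> ennreal (sqrt (large_const d \<gamma> \<tau> s0) * s powr (1 / \<gamma>)))"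
proof -
  interpret PN: prob_space "iid_law N P" by (intro prob_space_PiM prob)
  define S where "S = s powr (1 / \<gamma>)"
  define T where "T = ln (max 1 \<tau>)"
  have spos: "0 < s" using s s0 by simp
  have S: "0 < S" using spos by (simp add: S_def)
  have S\<gamma>: "S powr \<gamma> = s" using spos \<gamma> by (simp add: S_def powr_powr)
  have T: "0 \<le> T" "exp T = max 1 \<tau>" by (auto simp: T_def)
  define Z where "Z x = euclid_norm d x powr \<gamma>" for x
  have Zm: "Z \<in> borel_measurable P" unfolding Z_def by measurable
  have eZ: "(\<integral>\<^sup>+x. ennreal (exp (Z x)) \<partial>P) \<le> ennreal (exp T)"
    unfolding Z_def T(2) by (rule order_trans[OF moment]) (simp add: ennreal_leI)
  define g where "g = (\<lambda>\<omega>. \<Sum>k<N. Z (\<omega> k))"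
  have gm: "g \<in> borel_measurable (iid_law N P)" unfolding g_def using Zm by measurable
  have gp: "PN.prob {\<omega> \<in> space (iid_law N P). real N * T + s * N \<le> g \<omega>} \<le> exp (- (s * N))"
    using sum_chernoff[OF prob setsP order_refl N Zm eZ, of "real N * T + s * N"] by (simp add: g_def)
  \<comment> \<open>The same condition twice, so that the probability has the form common to both
    regimes.\<close>
  define E where "E = {\<omega> \<in> space (iid_law N P). g \<omega> < real N * T + s * N \<and> g \<omega> < real N * T + s * N}"
  have "E \<in> sets (iid_law N P)" unfolding E_def using gm by measurable
  moreover have "1 - 2 * exp (- (s * N)) \<le> PN.prob E"
    using PN.prob_both_less[OF gm gm gp gp] by (simp add: E_def)
  moreover have "wasserstein2 d (centered_empirical d N \<omega>) P \<le> ennreal (sqrt (large_const d \<gamma> \<tau> s0) * s powr (1 / \<gamma>))"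
    if \<omega>: "\<omega> \<in> E" for \<omega>
  \<comment> \<open>Here \<open>order_refl\<close> fixes \<open>R = 0\<close>; with
    \<open>m = 0\<close> the only level weight is \<open>4 * d * R\<^sup>2 = 0\<close>, so the
    discrepancy drops out.\<close>
  proof (rule wasserstein2_discrepancy[OF N law order_refl, where m = 0 and t = \<tau>])
    show "integrable P (\<lambda>\<xi>. \<xi> i * \<xi> i)" if "i < d" for i using that that by (rule integrable_product)
    have "(\<integral>\<^sup>+x. ennreal (tail_sq d 0 x) \<partial>P) \<le> (\<integral>\<^sup>+x. ennreal (exp (euclid_norm d x powr \<gamma>)) \<partial>P)"
      using sq_le_exp_powr[OF euclid_norm_nonneg \<gamma>]
      by (intro nn_integral_mono ennreal_leI) (simp add: tail_sq_def)
    also note moment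
    finally show "(\<integral>\<^sup>+x. ennreal (tail_sq d 0 x) \<partial>P) \<le> ennreal \<tau>" .
    show "0 \<le> \<tau>" using \<tau> by simp
    show "0 \<le> sqrt (large_const d \<gamma> \<tau> s0) * s powr (1 / \<gamma>)" using large_const_nonneg[OF \<tau> s0] by simp
    have g: "g \<omega> \<le> real N * T + s * N" using \<omega> by (auto simp: E_def)
    have "(\<Sum>k<N. tail_sq d 0 (\<omega> k)) \<le> (\<Sum>k<N. S\<^sup>2 + Z (\<omega> k) * S powr (2 - \<gamma>))"
    proof (rule sum_mono)
      fix k
      have "tail_sq d 0 (\<omega> k) \<le> (euclid_norm d (\<omega> k))\<^sup>2" by (simp add: tail_sq_def)
      also have "\<dots> \<le> S\<^sup>2 + Z (\<omega> k) * S powr (2 - \<gamma>)"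
        unfolding Z_def by (rule sq_le_interpolate[OF euclid_norm_nonneg \<gamma> S])
      finally show "tail_sq d 0 (\<omega> k) \<le> S\<^sup>2 + Z (\<omega> k) * S powr (2 - \<gamma>)" .
    qed
    also have "\<dots> = N * S\<^sup>2 + g \<omega> * S powr (2 - \<gamma>)" by (simp add: g_def sum.distrib sum_distrib_right)
    also have "\<dots> \<le> N * S\<^sup>2 + (real N * T + s * N) * S powr (2 - \<gamma>)"
      by (intro add_left_mono mult_right_mono g) simp
    also have "S powr (2 - \<gamma>) = S\<^sup>2 / s" using S by (simp add: powr_diff S\<gamma>)
    also have "N * S\<^sup>2 + (real N * T + s * N) * (S\<^sup>2 / s) = N * (S\<^sup>2 * (2 + T / s))"
      using spos by (simp add: field_simps)
    finally have "(\<Sum>k<N. tail_sq d 0 (\<omega> k)) / N \<le> S\<^sup>2 * (2 + T / s)"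
      using N by (simp add: divide_le_eq mult.commute)
    also have "\<dots> \<le> S\<^sup>2 * (2 + T / s0)"
      using s s0 T by (intro mult_left_mono add_left_mono divide_left_mono mult_pos_pos) auto
    finally have 1: "(\<Sum>k<N. tail_sq d 0 (\<omega> k)) / N \<le> S\<^sup>2 * (2 + T / s0)" .
    have "s0 powr (2 / \<gamma>) \<le> s powr (2 / \<gamma>)" using s s0 \<gamma> by (intro powr_mono2) auto
    also have "\<dots> = S\<^sup>2" using spos by (simp add: S_def power2_eq_square powr_add[symmetric])
    finally have "1 \<le> S\<^sup>2 / s0 powr (2 / \<gamma>)" using s0 by simp
    from mult_left_mono[OF this, of "\<tau> + real d"]
    have 2: "\<tau> + real d \<le> S\<^sup>2 * ((\<tau> + real d) / s0 powr (2 / \<gamma>))" using \<tau> by (simp add: mult.commute)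
    have "3 * ((\<Sum>k<N. tail_sq d 0 (\<omega> k)) / real N + \<tau> + real d / 4 ^ 0 + (\<Sum>l\<le>0. level_weight d 0 l * discrepancy d 0 N P l \<omega>))
        \<le> 3 * (S\<^sup>2 * (2 + T / s0) + S\<^sup>2 * ((\<tau> + real d) / s0 powr (2 / \<gamma>)))"
      using 1 2 by (simp add: level_weight_def)
    also have "\<dots> = (sqrt (large_const d \<gamma> \<tau> s0) * s powr (1 / \<gamma>))\<^sup>2"
      using large_const_nonneg[OF \<tau> s0]
      by (simp add: power_mult_distrib S_def[symmetric]) (simp add: large_const_def T_def algebra_simps)
    finally show "3 * ((\<Sum>k<N. tail_sq d 0 (\<omega> k)) / real N + \<tau> + real d / 4 ^ 0
      + (\<Sum>l\<le>0. level_weight d 0 l * discrepancy d 0 N P l \<omega>)) \<le> (sqrt (large_const d \<gamma> \<tau> s0) * s powr (1 / \<gamma>))\<^sup>2" .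
  qed
  ultimately show ?thesis by blast
qed

end

section \<open>Calibration of the constants and conclusion\<close>

lemma scale_exists:
  fixes C a u :: real
  assumes "0 \<le> C" "0 < a" "0 < u"
  shows "\<exists>c. 0 < c \<and> c \<le> u \<and> C * c powr a \<le> 2"
proof (intro exI conjI)
  let ?c = "min u ((2 / (C + 1)) powr (1 / a))"
  show "0 < ?c" "?c \<le> u" using assms by auto
  have "?c powr a \<le> ((2 / (C + 1)) powr (1 / a)) powr a" using assms by (intro powr_mono2) auto
  also have "\<dots> = 2 / (C + 1)" using assms by (simp add: powr_powr)
  finally have "C * ?c powr a \<le> C * (2 / (C + 1))" using assms by (intro mult_left_mono) auto
  also have "\<dots> \<le> 2" using assms by (simp add: field_simps)
  finally show "C * ?c powr a \<le> 2" .
qed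

context light_tailed_law
begin

text \<open>Solved for \<open>s\<close>, the sample size condition bounds \<open>s\<close> by
  \<open>c2\<close> times a power of \<open>\<rho> / 2\<close>. Where the regime of \<open>s\<close>
  and the branch of \<open>\<rho>\<close> agree, taking roots gives the claim; of the two mixed
  cases one is trivial and the other cannot occur.\<close>

lemma wasserstein2_concentration:
  fixes N :: nat and \<zeta> c2 s0 :: real
  assumes s0: "0 < s0" "s0 \<le> 1" "sqrt (small_const d \<tau>) * s0 powr (1 / real d) \<le> 2"
    and c2: "0 < c2" "c2 \<le> s0" "sqrt (large_const d \<gamma> \<tau> s0) * c2 powr (1 / \<gamma>) \<le> 2"
    and N: "1 \<le> N" and \<zeta>: "0 < \<zeta>" "\<zeta> \<le> 1"
  shows "\<exists>E \<in> sets (iid_law N P). 1 - \<zeta> \<le> measure (iid_law N P) E \<and>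
    (\<forall>\<omega>\<in>E. \<forall>\<rho>>0. N_w 2 c2 \<gamma> d (\<rho> / 2) \<zeta> < real N \<longrightarrow>
      wasserstein2 d (centered_empirical d N \<omega>) P \<le> ennreal \<rho>)"
proof -
  \<comment> \<open>The numerator is \<open>ln (2 * c1 / \<zeta>)\<close> for \<open>c1 = 2\<close>;
    it is at least 1, which provides the condition \<open>1 \<le> s * N\<close> of the small
    regime.\<close>
  define s where "s = ln (4 / \<zeta>) / real N"
  have N0: "0 < N" using N by simp
  have "ln 4 \<le> ln (4 / \<zeta>)" using \<zeta> by (intro ln_mono) (auto simp: field_simps)
  moreover have "1 \<le> ln (4::real)" using exp_le by (subst ln_ge_iff) auto
  ultimately have L: "1 \<le> ln (4 / \<zeta>)" by linarith
  have s: "0 < s" "s * real N = ln (4 / \<zeta>)" using L N0 by (auto simp: s_def)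
  have "exp (- (s * real N)) = \<zeta> / 4"
    unfolding s(2) using \<zeta> by (simp add: exp_minus)
  then have p: "1 - \<zeta> \<le> 1 - 2 * exp (- (s * real N))" using \<zeta> by simp
  have Nw: "s < c2 * (\<rho> / 2) ^ d" if "\<rho> / 2 \<le> 1" "0 < \<rho>" "N_w 2 c2 \<gamma> d (\<rho> / 2) \<zeta> < real N" for \<rho>
    using that c2(1) N0 by (simp add: N_w_def s_def field_simps)
  have Nw': "s < c2 * (\<rho> / 2) powr \<gamma>" if "\<not> \<rho> / 2 \<le> 1" "0 < \<rho>" "N_w 2 c2 \<gamma> d (\<rho> / 2) \<zeta> < real N" for \<rho>
  proof -
    have "0 < c2 * (\<rho> / 2) powr \<gamma>" using c2(1) that(2) by simp
    then show ?thesis using that(1,3) N0 unfolding N_w_def s_def by (simp add: field_simps)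
  qed
  show ?thesis
  proof (cases "s \<le> s0")
    case True
    obtain E where E: "E \<in> sets (iid_law N P)" "1 - 2 * exp (- (s * real N)) \<le> measure (iid_law N P) E"
      and W: "\<And>\<omega>. \<omega> \<in> E \<Longrightarrow> wasserstein2 d (centered_empirical d N \<omega>) P \<le> ennreal (sqrt (small_const d \<tau>) * s powr (1 / real d))"
      using concentration_small[OF N0 s(1)] True s0 L s(2) by auto
    have "sqrt (small_const d \<tau>) * s powr (1 / real d) \<le> \<rho>"
      if \<rho>: "0 < \<rho>" "N_w 2 c2 \<gamma> d (\<rho> / 2) \<zeta> < real N" for \<rho>
    proof (cases "\<rho> / 2 \<le> 1")
      case le: True
      have "s powr (1 / real d) \<le> (s0 * (\<rho> / 2) ^ d) powr (1 / real d)"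
        using Nw[OF le \<rho>] s(1) c2(2) \<rho>(1)
        by (intro powr_mono2) (auto intro: order_trans[OF less_imp_le] mult_right_mono)
      also have "\<dots> = s0 powr (1 / real d) * (\<rho> / 2)"
        using s0 \<rho>(1) d by (simp add: powr_mult powr_realpow[symmetric] powr_powr)
      finally have "sqrt (small_const d \<tau>) * s powr (1 / real d) \<le> sqrt (small_const d \<tau>) * (s0 powr (1 / real d) * (\<rho> / 2))"
        using small_const_nonneg[OF \<tau>] by (intro mult_left_mono) auto
      also have "\<dots> = (sqrt (small_const d \<tau>) * s0 powr (1 / real d)) * (\<rho> / 2)" by simp
      also have "\<dots> \<le> 2 * (\<rho> / 2)" using s0(3) \<rho>(1) by (intro mult_right_mono) auto
      finally show ?thesis by simp
    next
      case False
      \<comment> \<open>Here \<open>2 < \<rho>\<close>, and the bound at \<open>s0\<close> is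
        already at most 2.\<close>
      have "s powr (1 / real d) \<le> s0 powr (1 / real d)" using True s(1) by (intro powr_mono2) auto
      then have "sqrt (small_const d \<tau>) * s powr (1 / real d) \<le> sqrt (small_const d \<tau>) * s0 powr (1 / real d)"
        using small_const_nonneg[OF \<tau>] by (intro mult_left_mono) auto
      then show ?thesis using s0(3) False by linarith
    qed
    then show ?thesis using E p W by (meson ennreal_leI order_trans)
  next
    case False
    obtain E where E: "E \<in> sets (iid_law N P)" "1 - 2 * exp (- (s * real N)) \<le> measure (iid_law N P) E"
      and W: "\<And>\<omega>. \<omega> \<in> E \<Longrightarrow> wasserstein2 d (centered_empirical d N \<omega>) P \<le> ennreal (sqrt (large_const d \<gamma> \<tau> s0) * s powr (1 / \<gamma>))"
      using concentration_large[OF N0 s0(1), of s] False by auto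
    have "sqrt (large_const d \<gamma> \<tau> s0) * s powr (1 / \<gamma>) \<le> \<rho>"
      if \<rho>: "0 < \<rho>" "N_w 2 c2 \<gamma> d (\<rho> / 2) \<zeta> < real N" for \<rho>
    proof (cases "\<rho> / 2 \<le> 1")
      case le: True
      \<comment> \<open>This case is empty: a radius of at most 2 forces
        \<open>s < c2 \<le> s0\<close>.\<close>
      have "s < c2 * (\<rho> / 2) ^ d" by (rule Nw[OF le \<rho>])
      also have "\<dots> \<le> c2 * 1" using le \<rho>(1) c2(1) by (intro mult_left_mono power_le_one) auto
      finally show ?thesis using c2(2) False by simp
    next
      case gt: False
      have "s powr (1 / \<gamma>) \<le> (c2 * (\<rho> / 2) powr \<gamma>) powr (1 / \<gamma>)"
        using Nw'[OF gt \<rho>] s(1) \<gamma> by (intro powr_mono2) auto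
      also have "\<dots> = c2 powr (1 / \<gamma>) * (\<rho> / 2)"
        using c2(1) \<rho>(1) \<gamma> by (simp add: powr_mult powr_powr)
      finally have "sqrt (large_const d \<gamma> \<tau> s0) * s powr (1 / \<gamma>) \<le> sqrt (large_const d \<gamma> \<tau> s0) * (c2 powr (1 / \<gamma>) * (\<rho> / 2))"
        using large_const_nonneg[OF \<tau> s0(1)] by (intro mult_left_mono) auto
      also have "\<dots> = (sqrt (large_const d \<gamma> \<tau> s0) * c2 powr (1 / \<gamma>)) * (\<rho> / 2)" by simp
      also have "\<dots> \<le> 2 * (\<rho> / 2)" using c2(3) \<rho>(1) by (intro mult_right_mono) auto
      finally show ?thesis by simp
    qed
    then show ?thesis using E p W by (meson ennreal_leI order_trans)
  qed
qed

end

text \<open>The set of samples for which the implication holds involves minimising controllers at a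
  data-dependent radius, so its measurability is not evident. The probability is therefore stated
  for a measurable event contained in it.\<close>

theorem corollary1:
  fixes d :: nat and \<gamma> \<tau> :: real
  assumes "4 < d" and "2 < \<gamma>" and "0 < \<tau>"
  shows "\<exists>c1 c2 c3 :: real. 0 < c1 \<and> 0 < c2 \<and> 0 < c3 \<and>
    (\<forall>(S :: lq_problem) (Pstar :: (nat \<Rightarrow> real) measure) (N :: nat) (\<epsilon> :: real) (\<zeta> :: real).
      well_formed S \<and> noise_dim S = d \<and>
      Pstar \<in> zero_mean_laws d \<and> pos_def d (covariance d Pstar) \<and>
      (\<integral>\<^sup>+ \<xi>. ennreal (exp (euclid_norm d \<xi> powr \<gamma>)) \<partial>Pstar) \<le> ennreal \<tau> \<and>
      1 \<le> N \<and> 0 < \<epsilon> \<and> 0 < \<zeta> \<and> \<zeta> \<le> 1 \<longrightarrow>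
      (\<exists>E \<in> sets (\<Pi>\<^sub>M k\<in>{..<N}. Pstar).
        1 - \<zeta> \<le> measure (\<Pi>\<^sub>M k\<in>{..<N}. Pstar) E \<and>
        (\<forall>\<omega> \<in> E.
          let \<rho> = radius (alpha_star d Pstar) (beta_hat d N \<omega>) \<epsilon> in
          N_star c1 c2 c3 \<gamma> \<tau> d \<rho> \<zeta> < real N \<longrightarrow>
          (\<forall>Kstar Kdr.
            oracle_controller S Pstar Kstar \<and>
            dr_controller S \<rho> (centered_empirical d N \<omega>) Kdr \<longrightarrow>
            expected_cost S Kdr Pstar \<le> expected_cost S Kstar Pstar * ennreal (1 + \<epsilon>)))))"
proof -
  \<comment> \<open>The threshold \<open>s0\<close> comes before \<open>c2\<close> because
    \<open>large_const\<close> depends on it, and \<open>c2 \<le> s0\<close> lets one constant serve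
    both branches of \<open>N_w\<close>. The target 2 cancels the halving of the radius in
    \<open>N_star\<close>.\<close>
  obtain s0 where s0: "0 < s0" "s0 \<le> 1" "sqrt (small_const d \<tau>) * s0 powr (1 / real d) \<le> 2"
    using scale_exists[of "sqrt (small_const d \<tau>)" "1 / real d" 1] small_const_nonneg[OF assms(3)] assms(1) by auto
  obtain c2 where c2: "0 < c2" "c2 \<le> s0" "sqrt (large_const d \<gamma> \<tau> s0) * c2 powr (1 / \<gamma>) \<le> 2"
    using scale_exists[of "sqrt (large_const d \<gamma> \<tau> s0)" "1 / \<gamma>" s0] large_const_nonneg[OF assms(3) s0(1)] assms(2) s0(1) by auto
  show ?thesis
  \<comment> \<open>The choice \<open>c1 = 2\<close> makes the numerator
    \<open>ln (4 / \<zeta>)\<close>, which stays at least 1 even for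
    \<open>\<zeta> = 1\<close>.\<close>
  proof (rule exI[of _ 2], rule exI[of _ c2], rule exI[of _ 1], intro conjI allI impI)
    fix S :: lq_problem and Pstar :: "(nat \<Rightarrow> real) measure" and N :: nat and \<epsilon> \<zeta> :: real
    assume "well_formed S \<and> noise_dim S = d \<and>
      Pstar \<in> zero_mean_laws d \<and> pos_def d (covariance d Pstar) \<and>
      (\<integral>\<^sup>+ \<xi>. ennreal (exp (euclid_norm d \<xi> powr \<gamma>)) \<partial>Pstar) \<le> ennreal \<tau> \<and>
      1 \<le> N \<and> 0 < \<epsilon> \<and> 0 < \<zeta> \<and> \<zeta> \<le> 1"
    then have wf: "well_formed S" "noise_dim S = d" and P: "Pstar \<in> zero_mean_laws d" "pos_def d (covariance d Pstar)"
      and mom: "(\<integral>\<^sup>+ \<xi>. ennreal (exp (euclid_norm d \<xi> powr \<gamma>)) \<partial>Pstar) \<le> ennreal \<tau>"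
      and N: "1 \<le> N" and \<epsilon>: "0 < \<epsilon>" and \<zeta>: "0 < \<zeta>" "\<zeta> \<le> 1"
      by blast+
    interpret light_tailed_law d \<gamma> \<tau> Pstar
      using assms P(1) mom by unfold_locales
    have d0: "0 < d" using assms(1) by simp
    have N0: "0 < N" using N by simp
    obtain E where E: "E \<in> sets (iid_law N Pstar)" "1 - \<zeta> \<le> measure (iid_law N Pstar) E"
      and W: "\<forall>\<omega>\<in>E. \<forall>\<rho>>0. N_w 2 c2 \<gamma> d (\<rho> / 2) \<zeta> < real N \<longrightarrow>
        wasserstein2 d (centered_empirical d N \<omega>) Pstar \<le> ennreal \<rho>"
      using wasserstein2_concentration[OF s0 c2 N \<zeta>] by blast
    show "\<exists>E \<in> sets (iid_law N Pstar).
        1 - \<zeta> \<le> measure (iid_law N Pstar) E \<and>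
        (\<forall>\<omega> \<in> E.
          let \<rho> = radius (alpha_star d Pstar) (beta_hat d N \<omega>) \<epsilon> in
          N_star 2 c2 1 \<gamma> \<tau> d \<rho> \<zeta> < real N \<longrightarrow>
          (\<forall>Kstar Kdr.
            oracle_controller S Pstar Kstar \<and>
            dr_controller S \<rho> (centered_empirical d N \<omega>) Kdr \<longrightarrow>
            expected_cost S Kdr Pstar \<le> expected_cost S Kstar Pstar * ennreal (1 + \<epsilon>)))"
    proof (intro bexI[OF _ E(1)] conjI E(2) ballI, unfold Let_def, intro impI allI)
      fix \<omega> Kstar Kdr
      assume \<omega>: "\<omega> \<in> E"
      let ?\<rho> = "radius (alpha_star d Pstar) (beta_hat d N \<omega>) \<epsilon>"
      assume Ns: "N_star 2 c2 1 \<gamma> \<tau> d ?\<rho> \<zeta> < real N"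
        and opt: "oracle_controller S Pstar Kstar \<and> dr_controller S ?\<rho> (centered_empirical d N \<omega>) Kdr"
      have "0 < alpha_star d Pstar" using lambda_min_pos[OF P(2) d0] by (simp add: alpha_star_def)
      then have "0 < ?\<rho>" using \<epsilon> by (intro radius_pos) simp
      moreover have "N_w 2 c2 \<gamma> d (?\<rho> / 2) \<zeta> < real N" using Ns by (simp add: N_star_def)
      ultimately have "wasserstein2 d (centered_empirical d N \<omega>) Pstar \<le> ennreal ?\<rho>" using W \<omega> by blast
      then show "expected_cost S Kdr Pstar \<le> expected_cost S Kstar Pstar * ennreal (1 + \<epsilon>)"
        using opt
        by (intro dr_controller_suboptimality[OF wf d0 P integrable_product
              centered_empirical_zero_mean[OF N0] centered_empirical_integrable[OF N0] \<epsilon>])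
          (auto simp: beta_hat_def)
    qed
  qed (use c2 in auto)
qed

end
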